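(* Let $U$ be an open subset of $\mathbb{R}^d$, $\mu$ a Federer measure on $U$ and $F:U\to\mathrm{Mat}_{m,n}$ a continuous map such that $(F,\mu)$ is (i) good and (ii) weakly non-planar. Then $F_*\mu$ is inhomogeneously $\mathbf{r}$-extremal for every $(m+n)$-tuple $\mathbf{r}=(r_1,\dots,r_{m+n})$ of real numbers with $r_i\ge0$ for all $i$ and $r_1+\dots+r_m=r_{m+1}+\dots+r_{m+n}=1$.
   Context: $\mathrm{Mat}_{k,l}$: real $k\times l$ matrices; $Y_j$ is the $j$-th row of $Y$. $(Y;\mathbf{z})$ ($Y\in\mathrm{Mat}_{m,n}$, $\mathbf{z}\in\mathbb{R}^m$) is $\mathbf{r}$-VWA if there is $\varepsilon>0$ such that for arbitrarily large $Q>1$ there exist $\mathbf{q}\in\mathbb{Z}^n\setminus\{0\}$, $\mathbf{p}\in\mathbb{Z}^m$ with $|Y_j\mathbf{q}+z_j-p_j|<Q^{-(1+\varepsilon)r_j}$ ($1\le j\le m$) and $|q_i|<Q^{r_{m+i}}$ ($1\le i\le n$). A measure $\nu$ on $\mathrm{Mat}_{m,n}$ is inhomogeneously $\mathbf{r}$-extremal if for every $\mathbf{z}\in\mathbb{R}^m$, $(Y;\mathbf{z})$ is not $\mathbf{r}$-VWA for $\nu$-a.e. $Y$. $F_*\mu(S)=\mu(F^{-1}(S))$. All measures Radon; $\mu$ is $D$-Federer on open $U$ if $\mu(3V)<D\mu(V)$ for every ball $V\subset U$ centred in $\operatorname{supp}\mu$, and Federer if for $\mu$-a.e. $x$ this holds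 near $x$ for some $D$. $\|f\|_{\mu,V}=\sup_{V\cap\operatorname{supp}\mu}|f|$; $f$ is $(C,\alpha)$-good on $U$ w.r.t. $\mu$ if for every ball $V\subset U$ centred in $\operatorname{supp}\mu$ and $\varepsilon>0$, $\mu(\{x\in V:|f(x)|<\varepsilon\})\le C(\varepsilon/\|f\|_{\mu,V})^\alpha\mu(V)$. For $\mathbf{f}=(f_1,\dots,f_N)$, $(\mathbf{f},\mu)$ is good if for $\mu$-a.e. $x$ there are a neighbourhood $V$ and $C,\alpha>0$ with every real linear combination of $1,f_1,\dots,f_N$ $(C,\alpha)$-good on $V$. With $\mathbf{d}:\mathrm{Mat}_{m,n}\to\mathbb{R}^N$, $N=\binom{m+n}{n}-1$, listing all minors in a fixed order, $(F,\mu)$ is good if $(\mathbf{d}\circ F,\mu)$ is good. For $A\in\mathrm{Mat}_{n,m}$, $B\in\mathrm{Mat}_{n,n}$ let $\mathcal{H}_{A,B}=\{Y:\det(AY+B)=0\}$ and $\mathbf{H}_{m,n}$ the collection of $\mathcal{H}_{A,B}$ with $\operatorname{rank}(A|B)=n$; $(F,\mu)$ is weakly non-planar if $F(V\cap\operatorname{supp}\mu)\not\subset\mathcal{H}$ for every ball $V\subset U$ centred in $\operatorname{supp}\mu$ and every $\mathcal{H}\in\mathbf{H}_{m,n}$. *)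

theory Defs
  imports "HOL-Analysis.Analysis"
begin

text \<open>
  The space of real \<open>k \<times> l\<close> matrices is \<open>real ^ 'l ^ 'k\<close>. A weight vector is an element \<open>r\<close> of \<open>real ^ ('m + 'n)\<close>: the entries
  \<open>r $ Inl j\<close> are \<open>r_1, ..., r_m\<close> and the entries \<open>r $ Inr i\<close> are \<open>r_{m+1}, ..., r_{m+n}\<close>.
\<close>

subsection \<open>Diophantine approximation\<close>

definition VWA :: "real ^ ('m::finite + 'n::finite) \<Rightarrow> real ^ 'n ^ 'm \<Rightarrow> real ^ 'm \<Rightarrow> bool" where
  "VWA r Y z \<longleftrightarrow>
    (\<exists>\<epsilon>>0. \<forall>T. \<exists>Q::real. Q > T \<and> Q > 1 \<and>
      (\<exists>(q::int ^ 'n) (p::int ^ 'm). q \<noteq> 0 \<and>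
        (\<forall>j. \<bar>(Y *v (\<chi> i. real_of_int (q $ i))) $ j + z $ j - real_of_int (p $ j)\<bar>
              < Q powr (- (1 + \<epsilon>) * r $ Inl j)) \<and>
        (\<forall>i. real_of_int \<bar>q $ i\<bar> < Q powr (r $ Inr i))))"

definition inhom_extremal ::
  "real ^ ('m::finite + 'n::finite) \<Rightarrow> (real ^ 'n ^ 'm) measure \<Rightarrow> bool" where
  "inhom_extremal r \<nu> \<longleftrightarrow> (\<forall>z. AE Y in \<nu>. \<not> VWA r Y z)"

subsection \<open>Radon and Federer measures on an open set\<close>

text \<open>
  A measure on an open set \<open>U\<close> has \<open>U\<close> as its space and the Borel subsets of \<open>U\<close> as its measurable
  sets. So \<open>U\<close> is recovered as \<^term>\<open>space \<mu>\<close>, and subsets of the ambient space have to be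
  intersected with it before they are measured.
\<close>

definition radon_measure_on :: "'a::metric_space set \<Rightarrow> 'a measure \<Rightarrow> bool" where
  "radon_measure_on U \<mu> \<longleftrightarrow>
    space \<mu> = U \<and> sets \<mu> = sets (restrict_space borel U) \<and>
    (\<forall>K. compact K \<and> K \<subseteq> U \<longrightarrow> emeasure \<mu> K < \<infinity>) \<and>
    (\<forall>A\<in>sets \<mu>. emeasure \<mu> A = (SUP K\<in>{K. compact K \<and> K \<subseteq> A}. emeasure \<mu> K))"

definition msupp :: "'a::metric_space measure \<Rightarrow> 'a set" where
  "msupp \<mu> = {x \<in> space \<mu>. \<forall>W. open W \<and> x \<in> W \<longrightarrow> emeasure \<mu> (W \<inter> space \<mu>) > 0}"

text \<open>Balls are open balls of positive radius; \<open>3V\<close> is the ball with the same centre and three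
  times the radius. It need not be contained in \<open>U\<close>.\<close>

definition D_Federer_on :: "real \<Rightarrow> 'a::metric_space set \<Rightarrow> 'a measure \<Rightarrow> bool" where
  "D_Federer_on D W \<mu> \<longleftrightarrow>
    (\<forall>c \<rho>. c \<in> msupp \<mu> \<and> \<rho> > 0 \<and> ball c \<rho> \<subseteq> W \<longrightarrow>
      emeasure \<mu> (ball c (3 * \<rho>) \<inter> space \<mu>) < ennreal D * emeasure \<mu> (ball c \<rho>))"

definition federer :: "'a::metric_space measure \<Rightarrow> bool" where
  "federer \<mu> \<longleftrightarrow>
    (AE x in \<mu>. \<exists>W D. open W \<and> x \<in> W \<and> W \<subseteq> space \<mu> \<and> D > 0 \<and> D_Federer_on D W \<mu>)"

subsection \<open>Good functions and maps\<close>

definition supnorm_on :: "'a::metric_space measure \<Rightarrow> 'a set \<Rightarrow> ('a \<Rightarrow> real) \<Rightarrow> ennreal" where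
  "supnorm_on \<mu> V f = (SUP x\<in>V \<inter> msupp \<mu>. ennreal \<bar>f x\<bar>)"

text \<open>\<open>t\<^sup>\<alpha>\<close> for \<open>\<alpha> > 0\<close> and \<open>t\<close> in \<open>[0, \<infinity>]\<close>.\<close>

definition ennreal_rpow :: "ennreal \<Rightarrow> real \<Rightarrow> ennreal" where
  "ennreal_rpow t \<alpha> = (if t = \<infinity> then \<infinity> else ennreal (enn2real t powr \<alpha>))"

text \<open>
  The quotient is formed in \<open>[0, \<infinity>]\<close>, where \<open>\<epsilon> / 0 = \<infinity>\<close> for \<open>\<epsilon> > 0\<close>. A function that vanishes on
  \<open>V \<inter> supp \<mu>\<close> (such as the zero linear combination below) thus satisfies the condition for \<open>V\<close>.
\<close>

definition C_alpha_good_on ::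
  "real \<Rightarrow> real \<Rightarrow> 'a::metric_space set \<Rightarrow> 'a measure \<Rightarrow> ('a \<Rightarrow> real) \<Rightarrow> bool" where
  "C_alpha_good_on C \<alpha> W \<mu> f \<longleftrightarrow>
    (\<forall>c \<rho> \<epsilon>. c \<in> msupp \<mu> \<and> \<rho> > 0 \<and> ball c \<rho> \<subseteq> W \<and> \<epsilon> > 0 \<longrightarrow>
      emeasure \<mu> {x \<in> ball c \<rho>. \<bar>f x\<bar> < \<epsilon>}
        \<le> ennreal C * ennreal_rpow (ennreal \<epsilon> / supnorm_on \<mu> (ball c \<rho>) f) \<alpha>
            * emeasure \<mu> (ball c \<rho>))"

text \<open>A vector-valued map is given by its components \<open>f s\<close>, indexed by a finite set \<open>S\<close>.\<close>

definition good_family ::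
  "'s set \<Rightarrow> ('s \<Rightarrow> 'a::metric_space \<Rightarrow> real) \<Rightarrow> 'a measure \<Rightarrow> bool" where
  "good_family S f \<mu> \<longleftrightarrow>
    (AE x in \<mu>. \<exists>V C \<alpha>. open V \<and> x \<in> V \<and> V \<subseteq> space \<mu> \<and> C > 0 \<and> \<alpha> > 0 \<and>
      (\<forall>(a0::real) (a::'s \<Rightarrow> real).
        C_alpha_good_on C \<alpha> V \<mu> (\<lambda>y. a0 + (\<Sum>s\<in>S. a s * f s y))))"

text \<open>
  The minors of all orders \<open>1 \<le> k \<le> min m n\<close> are indexed by their sets of rows and columns. The
  Leibniz formula is written out because the order \<open>k\<close> varies; rows and columns keep the order of
  the index types.
\<close>

definition minor_index :: "('m::finite set \<times> 'n::finite set) set" where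
  "minor_index = {(I, J). I \<noteq> {} \<and> card I = card J}"

definition minor ::
  "real ^ 'n::{finite,linorder} ^ 'm::{finite,linorder} \<Rightarrow> 'm set \<times> 'n set \<Rightarrow> real" where
  "minor Y = (\<lambda>(I, J).
    \<Sum>\<pi> | \<pi> permutes {..<card I}. of_int (sign \<pi>) *
      (\<Prod>k<card I. Y $ (sorted_list_of_set I ! k) $ (sorted_list_of_set J ! \<pi> k)))"

lemma card_minor_index:
  "card (minor_index :: ('m::finite set \<times> 'n::finite set) set)
    = ((CARD('m) + CARD('n)) choose CARD('n)) - 1"
proof -
  let ?P = "\<lambda>k. {I::'m set. card I = k} \<times> {J::'n set. card J = k}"
  let ?A = "{(I::'m set, J::'n set). card I = card J}"
  have A: "?A = (\<Union>k\<in>{..CARD('n)}. ?P k)"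
    by (auto simp: card_mono)
  have "card ?A = (\<Sum>k\<le>CARD('n). card (?P k))"
    unfolding A by (rule card_UN_disjoint) auto
  also have "\<dots> = (\<Sum>k\<le>CARD('n). (CARD('m) choose k) * (CARD('n) choose (CARD('n) - k)))"
  proof (rule sum.cong)
    fix k assume "k \<in> {..CARD('n)}"
    then have k: "k \<le> CARD('n)" by simp
    have "card {I::'m set. card I = k} = CARD('m) choose k"
      using n_subsets[of "UNIV :: 'm set" k] by simp
    moreover have "card {J::'n set. card J = k} = CARD('n) choose k"
      using n_subsets[of "UNIV :: 'n set" k] by simp
    ultimately show "card (?P k) = (CARD('m) choose k) * (CARD('n) choose (CARD('n) - k))"
      using binomial_symmetric[OF k] by (simp add: card_cartesian_product)
  qed simp
  also have "\<dots> = (CARD('m) + CARD('n)) choose CARD('n)"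
    by (rule vandermonde)
  finally have "card ?A = (CARD('m) + CARD('n)) choose CARD('n)" .
  moreover have "minor_index = ?A - {({}, {})}"
    by (auto simp: minor_index_def)
  moreover have "({}, {}) \<in> ?A"
    by simp
  ultimately show ?thesis
    by (metis card_Diff_singleton)
qed

definition good_map ::
  "('a::metric_space \<Rightarrow> real ^ 'n::{finite,linorder} ^ 'm::{finite,linorder}) \<Rightarrow> 'a measure \<Rightarrow> bool" where
  "good_map F \<mu> \<longleftrightarrow> good_family minor_index (\<lambda>s x. minor (F x) s) \<mu>"

subsection \<open>Weak non-planarity\<close>

definition augmented :: "real ^ 'm ^ 'n \<Rightarrow> real ^ 'n ^ 'n \<Rightarrow> real ^ ('m::finite + 'n::finite) ^ 'n" where
  "augmented A B = (\<chi> i k. case k of Inl j \<Rightarrow> A $ i $ j | Inr l \<Rightarrow> B $ i $ l)"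

definition det_hypersurface ::
  "real ^ 'm::finite ^ 'n::finite \<Rightarrow> real ^ 'n ^ 'n \<Rightarrow> (real ^ 'n ^ 'm) set" where
  "det_hypersurface A B = {Y. det (A ** Y + B) = 0}"

definition det_hypersurfaces :: "(real ^ 'n::finite ^ 'm::finite) set set" where
  "det_hypersurfaces = {det_hypersurface A B | A B. rank (augmented A B) = CARD('n)}"

definition weakly_nonplanar ::
  "('a::metric_space \<Rightarrow> real ^ 'n::finite ^ 'm::finite) \<Rightarrow> 'a measure \<Rightarrow> bool" where
  "weakly_nonplanar F \<mu> \<longleftrightarrow>
    (\<forall>c \<rho>. c \<in> msupp \<mu> \<and> \<rho> > 0 \<and> ball c \<rho> \<subseteq> space \<mu> \<longrightarrow>
      (\<forall>H\<in>det_hypersurfaces. \<not> F ` (ball c \<rho> \<inter> msupp \<mu>) \<subseteq> H))"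

end

theory Submission
  imports Defs "Jordan_Normal_Form.Determinant"
begin

text \<open>
  An approximation with \<open>Q\<close> close to \<open>e\<^sup>n\<close> puts \<open>x\<close> into one of the sets
  \<open>A(q, p) = {x. \<bar>F\<^sub>j(x) q + z\<^sub>j - p\<^sub>j\<bar> < exp (- (1 + \<epsilon>) n r\<^sub>j) for all j}\<close>. By Borel--Cantelli it suffices to bound,
  near a given point of the support, the measure of their union by the terms of a convergent series.

  Two distinct sets with the same \<open>n\<close> meet only inside the set \<open>H\<close> of those \<open>x\<close> for which the lattice
  \<open>{(F(x) q - p, q)}\<close>, moved by a suitable diagonal matrix, has a vector that is exponentially short in
  \<open>n\<close>; this remains true if \<open>\<epsilon>\<close> is halved. The measure of \<open>H\<close> is exponentially small by the
  quantitative nondivergence theorem of Kleinbock and Margulis. Its input is that the covolume of every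
  rational subspace becomes large somewhere on every ball, and this is what weak nonplanarity
  gives: for each \<open>m\<close>-dimensional subspace there is a point \<open>x\<close> at which the graph of \<open>F(x)\<close>
  is complementary to it, and a compactness argument makes this uniform.

  Since the affine forms that define \<open>A(q, p)\<close> are good functions, \<open>A(q, p)\<close> occupies an
  exponentially small part of the corresponding set for \<open>\<epsilon> / 2\<close>. The latter sets are disjoint off \<open>H\<close>, so
  a covering argument bounds the union, the balls that lie mostly in \<open>H\<close> being treated by a
  maximal inequality (the inhomogeneous transference of Beresnevich and Velani).
\<close>

hide_const (open) Determinant.det Matrix.vec Matrix.mat Matrix.row Matrix.col Matrix.rows
  Matrix.cols Matrix.transpose_mat Matrix.unit_vec
hide_type (open) Matrix.vec Matrix.mat
no_notation vec_index (infixl "$" 100)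
no_notation scalar_prod (infix "\<bullet>" 70)
hide_const (open) Matrix.orthogonal
hide_fact (open) Matrix.vec_eq_iff Matrix.row_def Matrix.rows_def Matrix.orthogonal_def

section \<open>Doubling measures and coverings\<close>

text \<open>Subtracting two solutions removes \<open>z\<close>, which is why an inhomogeneous
  statement can rest on a homogeneous one. It costs three exponents: \<epsilon> for the solutions,
  \<epsilon> / 2 for the enlarged sets, and \<epsilon> / 4 in the flow, which must still contract
  the difference of two solutions for \<epsilon> / 2.

  The obstacle is that weak nonplanarity speaks of subspaces of dimension m only, whereas
  nondivergence needs every dimension, all times and all weights, zero weights included. A subspace
  of another dimension is enlarged or cut down to dimension m, and a Pluecker coordinate is selected
  whose total weight under the flow is nonnegative. It then suffices to bound that coordinate at
  time zero, where integrality makes the largest Pluecker coordinate of a rational subspace at least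
  1 and so gives compactness a scale.

  Goodness is a hypothesis on combinations of 1 and the minors of \<open>F\<close>. It covers the
  Pluecker coordinates of the moved integer vectors because they are such combinations, with the
  same \<open>C\<close> and \<alpha> for all subspaces and times.\<close>

lemma near_maximal_radius:
  fixes S :: "real set"
  assumes "S \<noteq> {}" and "\<And>r. r \<in> S \<Longrightarrow> 0 < r \<and> r \<le> b"
  obtains r where "r \<in> S" and "2 * r \<notin> S"
proof -
  have bdd: "bdd_above S"
    using assms(2) by (meson bdd_aboveI)
  obtain s where "s \<in> S" "0 < s"
    using assms by blast
  then have "0 < Sup S"
    using bdd by (meson cSup_upper less_le_trans)
  then have "Sup S / 2 < Sup S"
    by simp
  then obtain r where r: "r \<in> S" "Sup S / 2 < r"
    using assms(1) bdd less_cSup_iff by blast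
  have "2 * r \<notin> S"
    using r(2) cSup_upper[OF _ bdd, of "2 * r"] by auto
  with r that show thesis by blast
qed

text \<open>The exceptional sets quantify over flags, lattice vectors or radii. Bounding a
  measurable superset makes it possible to argue about them without deciding their
  measurability.\<close>

abbreviation outer_le :: "'a measure \<Rightarrow> 'a set \<Rightarrow> ennreal \<Rightarrow> bool" where
  "outer_le M E b \<equiv> \<exists>N\<in>sets M. E \<subseteq> N \<and> emeasure M N \<le> b"

text \<open>The sets \<open>N i\<close> may overlap; each is charged to \<open>G i\<close>, and only
  the charges have to be disjoint. The charges are pieces of one set in disjoint balls in Vitali's
  argument, and enlarged solution sets with the overlaps removed in the transference.\<close>

lemma emeasure_UN_le_disjoint:
  assumes C: "countable C"
    and N: "\<And>i. i \<in> C \<Longrightarrow> N i \<in> sets M"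
    and G: "\<And>i. i \<in> C \<Longrightarrow> G i \<in> sets M"
    and disj: "disjoint_family_on G C"
    and le: "\<And>i. i \<in> C \<Longrightarrow> emeasure M (N i) \<le> \<kappa> * emeasure M (G i)"
    and sub: "\<And>i. i \<in> C \<Longrightarrow> G i \<subseteq> H" and H: "H \<in> sets M"
  shows "emeasure M (\<Union>i\<in>C. N i) \<le> \<kappa> * emeasure M H"
proof -
  \<comment> \<open>The indices are moved to the natural numbers, with empty sets as padding, so
    that series can be compared.\<close>
  define I where "I = to_nat_on C ` C"
  define j where "j = inv_into C (to_nat_on C)"
  have inj: "inj_on (to_nat_on C) C"
    using C by (rule inj_on_to_nat_on)
  have jC: "j n \<in> C" if "n \<in> I" for n
    using that unfolding j_def I_def by (rule inv_into_into)
  have j_to: "j (to_nat_on C i) = i" if "i \<in> C" for i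
    using inj that by (simp add: j_def)
  have j_inj: "n = k" if "j n = j k" "n \<in> I" "k \<in> I" for n k
    using that by (metis I_def f_inv_into_f j_def)
  define A where "A n = (if n \<in> I then N (j n) else {})" for n
  define B where "B n = (if n \<in> I then G (j n) else {})" for n
  have A: "range A \<subseteq> sets M" and B: "range B \<subseteq> sets M"
    using N G jC by (auto simp: A_def B_def)
  have disjB: "disjoint_family B"
    unfolding disjoint_family_on_def
  proof (intro ballI impI)
    fix n k :: nat assume "n \<noteq> k"
    then have "n \<in> I \<Longrightarrow> k \<in> I \<Longrightarrow> G (j n) \<inter> G (j k) = {}"
      using disj j_inj jC unfolding disjoint_family_on_def by metis
    then show "B n \<inter> B k = {}"
      by (auto simp: B_def)
  qed
  have "(\<Union>i\<in>C. N i) = (\<Union>n. A n)"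
    using jC j_to by (auto simp: A_def I_def split: if_splits)
  then have "emeasure M (\<Union>i\<in>C. N i) \<le> (\<Sum>n. emeasure M (A n))"
    using emeasure_subadditive_countably[OF A] by simp
  also have "\<dots> \<le> (\<Sum>n. \<kappa> * emeasure M (B n))"
    by (intro suminf_le) (auto simp: A_def B_def le jC)
  also have "\<dots> = \<kappa> * (\<Sum>n. emeasure M (B n))"
    by simp
  also have "\<dots> = \<kappa> * emeasure M (\<Union>n. B n)"
    using suminf_emeasure[OF B disjB] by simp
  also have "\<dots> \<le> \<kappa> * emeasure M H"
    using sub jC H by (intro mult_left_mono emeasure_mono) (auto simp: B_def split: if_splits)
  finally show ?thesis .
qed

text \<open>The part of the Federer condition that covering arguments use. The tripled ball is
  required to lie in \<open>\<Omega>\<close>, hence in the domain of the measure, so no intersection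
  with that domain appears.\<close>

locale doubling_measure =
  fixes \<mu> :: "'a::euclidean_space measure" and \<Omega> :: "'a set" and D :: ennreal
  assumes open_Omega: "open \<Omega>"
    and borel_sets: "A \<in> sets borel \<Longrightarrow> A \<subseteq> \<Omega> \<Longrightarrow> A \<in> sets \<mu>"
    and doubling: "x \<in> msupp \<mu> \<Longrightarrow> 0 < r \<Longrightarrow> ball x (3 * r) \<subseteq> \<Omega> \<Longrightarrow>
      emeasure \<mu> (ball x (3 * r)) \<le> D * emeasure \<mu> (ball x r)"
begin

text \<open>Three steps suffice since 27 exceeds 10. The factor 10 is the ratio of
  \<open>2 * q\<close>, a radius at which a smallness property has failed, to \<open>q / 5\<close>,
  the radius passed to Vitali's lemma.\<close>

lemma doubling3:
  assumes x: "x \<in> msupp \<mu>" and r: "0 < r" and sub: "ball x r \<subseteq> \<Omega>"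
  shows "emeasure \<mu> (ball x r) \<le> D ^ 3 * emeasure \<mu> (ball x (r / 10))"
proof -
  have *: "emeasure \<mu> (ball x s) \<le> D * emeasure \<mu> (ball x (s / 3))" if "0 < s" "s \<le> r" for s
    using doubling[of x "s / 3"] x that sub subset_ball[of s r x] by auto
  have "emeasure \<mu> (ball x r) \<le> D * emeasure \<mu> (ball x (r / 3))"
    using * r by auto
  also have "\<dots> \<le> D * (D * emeasure \<mu> (ball x (r / 3 / 3)))"
    using r by (intro mult_left_mono *) auto
  also have "\<dots> \<le> D * (D * (D * emeasure \<mu> (ball x (r / 3 / 3 / 3))))"
    using r by (intro mult_left_mono *) auto
  also have "\<dots> \<le> D * (D * (D * emeasure \<mu> (ball x (r / 10))))"
  proof (intro mult_left_mono emeasure_mono)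
    show "ball x (r / 10) \<in> sets \<mu>"
      using r sub subset_ball[of "r / 10" r x] by (intro borel_sets) auto
    show "ball x (r / 3 / 3 / 3) \<subseteq> ball x (r / 10)"
      using r by (intro subset_ball) simp
  qed auto
  finally show ?thesis
    by (simp add: power3_eq_cube mult.assoc)
qed

text \<open>Vitali's lemma selects disjoint balls whose fivefold enlargements cover
  \<open>E\<close>. In each enlargement \<open>E\<close> is confined to \<open>N x\<close>, paid for
  by the mass of \<open>G\<close> in the small ball, and these shares of \<open>G\<close> are
  disjoint.\<close>

lemma vitali_outer:
  assumes \<rho>: "\<And>x. x \<in> E \<Longrightarrow> 0 < \<rho> x \<and> \<rho> x \<le> R"
    and sub: "\<And>x. x \<in> E \<Longrightarrow> ball x (\<rho> x) \<subseteq> \<Omega>"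
    and N: "\<And>x. x \<in> E \<Longrightarrow> N x \<in> sets \<mu>"
    and cov: "\<And>x. x \<in> E \<Longrightarrow> E \<inter> ball x (5 * \<rho> x) \<subseteq> N x"
    and le: "\<And>x. x \<in> E \<Longrightarrow> emeasure \<mu> (N x) \<le> \<kappa> * emeasure \<mu> (G \<inter> ball x (\<rho> x))"
    and G: "G \<in> sets \<mu>"
  shows "outer_le \<mu> E
      (\<kappa> * emeasure \<mu> G)"
proof -
  have "E \<subseteq> (\<Union>x\<in>E. ball x (\<rho> x))"
    using \<rho> by force
  then obtain C where C: "countable C" "C \<subseteq> E"
    and disj: "pairwise (\<lambda>i j. disjnt (ball i (\<rho> i)) (ball j (\<rho> j))) C"
    and E: "E \<subseteq> (\<Union>i\<in>C. ball i (5 * \<rho> i))"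
    using \<rho> Vitali_covering_lemma_balls[where a = "\<lambda>x. x" and r = \<rho> and K = E and S = E and B = R]
    by (metis (no_types, lifting))
  have "emeasure \<mu> (\<Union>i\<in>C. N i) \<le> \<kappa> * emeasure \<mu> G"
  proof (rule emeasure_UN_le_disjoint[where G = "\<lambda>i. G \<inter> ball i (\<rho> i)", OF C(1)])
    show "disjoint_family_on (\<lambda>i. G \<inter> ball i (\<rho> i)) C"
      using disj by (auto simp: disjoint_family_on_def pairwise_def disjnt_def)
    show "G \<inter> ball i (\<rho> i) \<in> sets \<mu>" if "i \<in> C" for i
      using that C(2) sub by (intro sets.Int[OF G] borel_sets) auto
  qed (use N le C(2) G in auto)
  moreover have "E \<subseteq> (\<Union>i\<in>C. N i)"
  proof
    fix x assume x: "x \<in> E"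
    then obtain i where "i \<in> C" "x \<in> ball i (5 * \<rho> i)"
      using E by blast
    then show "x \<in> (\<Union>i\<in>C. N i)"
      using cov[of i] C(2) x by blast
  qed
  moreover have "(\<Union>i\<in>C. N i) \<in> sets \<mu>"
    using C N by (intro sets.countable_UN') auto
  ultimately show ?thesis by blast
qed

end

section \<open>Quantitative nondivergence\<close>

text \<open>The family \<open>P\<close> plays the role of the rational subspaces, \<open>cmp\<close> that of comparability by inclusion and
  \<open>rk\<close> that of the dimension. At a marked point, all members of \<open>P\<close> that are comparable with a certain flag are
  large, and those of the flag are neither small nor large. In the induction, a member whose
  smallness ball has radius within a factor 2 of the largest possible is added to the flag; in this way no
  finiteness assumption on \<open>P\<close> is needed.\<close>

definition marked ::
  "('s \<Rightarrow> 's \<Rightarrow> bool) \<Rightarrow> ('s \<Rightarrow> 'a \<Rightarrow> real) \<Rightarrow> real \<Rightarrow> real \<Rightarrow> 's set \<Rightarrow> 'a \<Rightarrow> bool" where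
  "marked cmp \<psi> \<epsilon> \<rho> P x \<longleftrightarrow>
    (\<exists>T\<subseteq>P. finite T \<and> pairwise cmp T \<and> (\<forall>s\<in>T. \<epsilon> \<le> \<psi> s x \<and> \<psi> s x \<le> \<rho>) \<and>
      (\<forall>s\<in>P. (\<forall>t\<in>T. cmp s t) \<longrightarrow> s \<in> T \<or> \<rho> \<le> \<psi> s x))"

text \<open>In one inductive step the \<open>1\<close> accounts for the set where the new flag
  member is below \<epsilon>, \<open>D ^ 3\<close> for passing from radius \<open>2 * q\<close> to
  the Vitali radius \<open>q / 5\<close>, and one more \<open>D\<close> for returning from
  \<open>ball c (3 * r)\<close> to \<open>ball c r\<close>.\<close>

fun nondiv_const :: "ennreal \<Rightarrow> nat \<Rightarrow> ennreal" where
  "nondiv_const D 0 = 0"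
| "nondiv_const D (Suc d) = D ^ 4 * (nondiv_const D d + 1)"

lemma nondiv_const_finite: "D < \<infinity> \<Longrightarrow> nondiv_const D d < \<infinity>"
  by (induction d) (auto simp: ennreal_mult_less_top power_less_top_ennreal)

text \<open>Whatever is comparable with the enlarged flag is \<open>s\<close> itself or was already
  governed by the flag chosen among the members comparable with \<open>s\<close>.\<close>

lemma marked_insert:
  assumes s: "s \<in> P" and m: "marked cmp \<psi> \<epsilon> \<rho> {t \<in> P. cmp t s \<and> t \<noteq> s} y"
    and val: "\<epsilon> \<le> \<psi> s y" "\<psi> s y \<le> \<rho>" and sym: "symp cmp"
  shows "marked cmp \<psi> \<epsilon> \<rho> P y"
proof -
  obtain T where T: "T \<subseteq> {t \<in> P. cmp t s \<and> t \<noteq> s}" "finite T" "pairwise cmp T"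
      "\<forall>s\<in>T. \<epsilon> \<le> \<psi> s y \<and> \<psi> s y \<le> \<rho>"
      "\<forall>t\<in>P. cmp t s \<and> t \<noteq> s \<longrightarrow> (\<forall>u\<in>T. cmp t u) \<longrightarrow> t \<in> T \<or> \<rho> \<le> \<psi> t y"
    using m unfolding marked_def by fastforce
  have "pairwise cmp (insert s T)"
    using T(1,3) sym by (auto simp: pairwise_insert symp_def)
  then show ?thesis
    unfolding marked_def using T s val by (intro exI[of _ "insert s T"]) auto
qed

context doubling_measure
begin

text \<open>The induction is on the number of ranks that occur. Around an unmarked point some member
  \<open>s\<close> stays below \<rho> on a ball of nearly maximal radius; members comparable with
  \<open>s\<close> but different from it miss the rank of \<open>s\<close>, so the induction
  hypothesis applies to them on the doubled ball. The factor \<open>5 ^ d\<close> leaves room for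
  these shifted and doubled balls.\<close>

theorem nondivergence:
  assumes sym: "symp cmp"
    and rk: "\<And>s t. s \<in> P \<Longrightarrow> t \<in> P \<Longrightarrow> cmp s t \<Longrightarrow> s \<noteq> t \<Longrightarrow> rk s \<noteq> (rk t :: nat)"
    and fin: "finite (rk ` P)" and card: "card (rk ` P) \<le> d"
    and small: "\<And>s c r. s \<in> P \<Longrightarrow> c \<in> msupp \<mu> \<Longrightarrow> 0 < r \<Longrightarrow> ball c r \<subseteq> \<Omega> \<Longrightarrow>
        (\<exists>y\<in>ball c r \<inter> msupp \<mu>. \<rho> \<le> \<psi> s y) \<Longrightarrow>
        emeasure \<mu> {z \<in> ball c r. \<psi> s z < \<epsilon>} \<le> \<eta> * emeasure \<mu> (ball c r)"
    and cont: "\<And>s. s \<in> P \<Longrightarrow> continuous_on \<Omega> (\<psi> s)"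
    and c: "c \<in> msupp \<mu>" and r: "0 < r" and sub: "ball c (5 ^ d * r) \<subseteq> \<Omega>"
    and large: "\<And>s. s \<in> P \<Longrightarrow> \<exists>y\<in>ball c r \<inter> msupp \<mu>. \<rho> \<le> \<psi> s y"
  shows "outer_le \<mu> {x \<in> ball c r \<inter> msupp \<mu>. \<not> marked cmp \<psi> \<epsilon> \<rho> P x}
      (nondiv_const D d * \<eta> * emeasure \<mu> (ball c r))"
  using rk fin card small cont c r sub large
proof (induction d arbitrary: P c r)
  case 0
  then have "P = {}" by auto
  then have "marked cmp \<psi> \<epsilon> \<rho> P x" for x
    by (auto simp: marked_def)
  then show ?case by (intro bexI[of _ "{}"]) auto
next
  case (Suc d)
  note P_rk = Suc.prems(1) and P_fin = Suc.prems(2) and P_card = Suc.prems(3)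
    and P_small = Suc.prems(4) and P_cont = Suc.prems(5) and c = Suc.prems(6) and r = Suc.prems(7)
    and sub = Suc.prems(8) and large = Suc.prems(9)
  define E where "E = {x \<in> ball c r \<inter> msupp \<mu>. \<not> marked cmp \<psi> \<epsilon> \<rho> P x}"
  define K where "K = (nondiv_const D d + 1) * \<eta>"
  have five: "(1::real) \<le> 5 ^ d"
    by simp
  have sub5: "ball c (s * r) \<subseteq> \<Omega>" if "s \<le> 5" for s
  proof -
    have "s \<le> 5 * (5::real) ^ d"
      using five that by linarith
    then have "s * r \<le> 5 ^ Suc d * r"
      using r by (intro mult_right_mono) auto
    then show ?thesis
      using sub subset_ball by fastforce
  qed
  have "\<exists>\<rho>' N. 0 < \<rho>' \<and> \<rho>' \<le> 2 * r / 5 \<and> N \<in> sets \<mu> \<and> E \<inter> ball x (5 * \<rho>') \<subseteq> N \<and>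
          emeasure \<mu> N \<le> (D ^ 3 * K) * emeasure \<mu> (ball x \<rho>')" if x: "x \<in> E" for x
  proof -
    \<comment> \<open>Radii on whose ball one and the same member stays below \<rho> on the support.
      They are bounded, since by \<open>large\<close> every member reaches \<rho> somewhere in
      \<open>ball c r\<close>.\<close>
    define S where "S = {\<rho>'. 0 < \<rho>' \<and> (\<exists>s\<in>P. \<forall>y\<in>ball x \<rho>' \<inter> msupp \<mu>. \<psi> s y < \<rho>)}"
    have xc: "x \<in> ball c r" "x \<in> msupp \<mu>" and nm: "\<not> marked cmp \<psi> \<epsilon> \<rho> P x"
      using x by (auto simp: E_def)
    have x\<Omega>: "x \<in> \<Omega>"
      using xc(1) sub5[of 1] by auto
    \<comment> \<open>Otherwise the empty flag would mark \<open>x\<close>.\<close>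
    obtain s0 where s0: "s0 \<in> P" "\<psi> s0 x < \<rho>"
    proof (rule ccontr)
      assume "\<not> thesis"
      then have "\<forall>s\<in>P. \<rho> \<le> \<psi> s x"
        using that by force
      then have "marked cmp \<psi> \<epsilon> \<rho> P x"
        unfolding marked_def by (intro exI[of _ "{}"]) auto
      with nm show False by blast
    qed
    have "open {y \<in> \<Omega>. \<psi> s0 y < \<rho>}"
    proof -
      have "open (\<Omega> \<inter> \<psi> s0 -` {..<\<rho>})"
        using P_cont[OF s0(1)] open_Omega by (intro continuous_open_preimage) auto
      moreover have "\<Omega> \<inter> \<psi> s0 -` {..<\<rho>} = {y \<in> \<Omega>. \<psi> s0 y < \<rho>}"
        by auto
      ultimately show ?thesis by simp
    qed
    then obtain e where e: "0 < e" "ball x e \<subseteq> {y \<in> \<Omega>. \<psi> s0 y < \<rho>}"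
      using x\<Omega> s0(2) openE by blast
    then have "e \<in> S"
      using s0(1) by (auto simp: S_def)
    then have Sne: "S \<noteq> {}" by blast
    have Sbd: "0 < q \<and> q \<le> 2 * r" if q: "q \<in> S" for q
    proof -
      obtain s where s: "s \<in> P" "\<forall>y\<in>ball x q \<inter> msupp \<mu>. \<psi> s y < \<rho>"
        using q by (auto simp: S_def)
      obtain y where y: "y \<in> ball c r \<inter> msupp \<mu>" "\<rho> \<le> \<psi> s y"
        using large[OF s(1)] by blast
      have "y \<notin> ball x q"
        using s(2) y by force
      moreover have "dist x y < 2 * r"
        using xc(1) y(1) dist_triangle[of x y c] by (auto simp: dist_commute)
      ultimately have "q \<le> 2 * r" by auto
      with q show ?thesis by (auto simp: S_def)
    qed
    \<comment> \<open>On \<open>ball x q\<close> some member \<open>s\<close> stays below \<rho>,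
      the upper bound asked of the flag; on \<open>ball x (2 * q)\<close> every member reaches
      \<rho>, which feeds both the induction hypothesis and the estimate
      \<open>P_small\<close>.\<close>
    obtain q where q: "q \<in> S" "2 * q \<notin> S"
      using near_maximal_radius[OF Sne Sbd] by blast
    have q0: "0 < q" "q \<le> 2 * r"
      using Sbd q by auto
    obtain s where s: "s \<in> P" "\<forall>y\<in>ball x q \<inter> msupp \<mu>. \<psi> s y < \<rho>"
      using q(1) by (auto simp: S_def)
    have large': "\<exists>y\<in>ball x (2 * q) \<inter> msupp \<mu>. \<rho> \<le> \<psi> t y" if "t \<in> P" for t
      using q(2) q0 that by (auto simp: S_def not_less)
    have subx: "ball x (2 * q) \<subseteq> \<Omega>"
    proof -
      have "ball x (2 * q) \<subseteq> ball c (5 * r)"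
        using xc(1) q0 by (simp add: ball_subset_ball_iff dist_commute)
      then show ?thesis using sub5[of 5] by simp
    qed
    define P' where "P' = {t \<in> P. cmp t s \<and> t \<noteq> s}"
    have "outer_le \<mu> {y \<in> ball x (2 * q) \<inter> msupp \<mu>. \<not> marked cmp \<psi> \<epsilon> \<rho> P' y}
      (nondiv_const D d * \<eta> * emeasure \<mu> (ball x (2 * q)))"
    proof (rule Suc.IH)
      show "rk s1 \<noteq> rk t1" if "s1 \<in> P'" "t1 \<in> P'" "cmp s1 t1" "s1 \<noteq> t1" for s1 t1
        using that P_rk by (auto simp: P'_def)
      show "finite (rk ` P')"
        using P_fin by (rule finite_subset[rotated]) (auto simp: P'_def)
      have "rk ` P' \<subseteq> rk ` P - {rk s}"
        using P_rk s(1) by (fastforce simp: P'_def)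
      then have "card (rk ` P') \<le> card (rk ` P - {rk s})"
        using P_fin by (intro card_mono) auto
      also have "\<dots> = card (rk ` P) - 1"
        using s(1) P_fin by (subst card_Diff_singleton) auto
      finally show "card (rk ` P') \<le> d"
        using P_card by linarith
      have "ball x (5 ^ d * (2 * q)) \<subseteq> ball c (5 ^ Suc d * r)"
      proof -
        have "5 ^ d * (2 * q) \<le> 5 ^ d * (4 * r)"
          using q0 by (intro mult_left_mono) auto
        moreover have "1 * r \<le> 5 ^ d * r"
          using five r by (intro mult_right_mono) auto
        moreover have "5 ^ d * (4 * r) = 4 * (5 ^ d * r)" "5 ^ Suc d * r = 5 * (5 ^ d * r)"
          by simp_all
        moreover have "dist x c \<le> r"
          using xc(1) by (simp add: dist_commute)
        ultimately have "dist x c + 5 ^ d * (2 * q) \<le> 5 ^ Suc d * r"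
          by linarith
        then show ?thesis by (simp add: ball_subset_ball_iff)
      qed
      then show "ball x (5 ^ d * (2 * q)) \<subseteq> \<Omega>"
        using sub by blast
    qed (use xc q0 P_small P_cont large' in \<open>auto simp: P'_def\<close>)
    then obtain N' where N': "N' \<in> sets \<mu>"
        "{y \<in> ball x (2 * q) \<inter> msupp \<mu>. \<not> marked cmp \<psi> \<epsilon> \<rho> P' y} \<subseteq> N'"
        "emeasure \<mu> N' \<le> nondiv_const D d * \<eta> * emeasure \<mu> (ball x (2 * q))"
      by blast
    define A where "A = {z \<in> ball x (2 * q). \<psi> s z < \<epsilon>}"
    have "open A"
    proof -
      have "continuous_on (ball x (2 * q)) (\<psi> s)"
        using P_cont[OF s(1)] subx continuous_on_subset by blast
      then have "open (ball x (2 * q) \<inter> \<psi> s -` {..<\<epsilon>})"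
        by (intro continuous_open_preimage) auto
      moreover have "ball x (2 * q) \<inter> \<psi> s -` {..<\<epsilon>} = A"
        by (auto simp: A_def)
      ultimately show ?thesis by simp
    qed
    then have As: "A \<in> sets \<mu>"
      using subx by (intro borel_sets) (auto simp: A_def)
    have A: "emeasure \<mu> A \<le> \<eta> * emeasure \<mu> (ball x (2 * q))"
      unfolding A_def using P_small[OF s(1) xc(2) _ subx large'[OF s(1)]] q0 by simp
    \<comment> \<open>With Vitali radius \<open>q / 5\<close> the enlarged ball is
      \<open>ball x q\<close>, where \<open>s\<close> is below \<rho> on the support; off
      \<open>N'\<close> and \<open>A\<close> it may therefore join the flag, although points of
      \<open>E\<close> are unmarked.\<close>
    have "E \<inter> ball x (5 * (q / 5)) \<subseteq> N' \<union> A"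
    proof
      fix y assume "y \<in> E \<inter> ball x (5 * (q / 5))"
      then have y: "y \<in> E" "y \<in> ball x q" "y \<in> ball x (2 * q)" "y \<in> msupp \<mu>"
        using q0 by (auto simp: E_def)
      show "y \<in> N' \<union> A"
      proof (rule ccontr)
        assume "y \<notin> N' \<union> A"
        then have "marked cmp \<psi> \<epsilon> \<rho> P' y" "\<epsilon> \<le> \<psi> s y" "\<psi> s y \<le> \<rho>"
          using N'(2) y s(2) by (auto simp: A_def not_less intro: less_imp_le)
        then have "marked cmp \<psi> \<epsilon> \<rho> P y"
          using marked_insert[OF s(1)] sym by (auto simp: P'_def)
        with y(1) show False by (auto simp: E_def)
      qed
    qed
    moreover have "emeasure \<mu> (N' \<union> A) \<le> (D ^ 3 * K) * emeasure \<mu> (ball x (q / 5))"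
    proof -
      have "emeasure \<mu> (N' \<union> A) \<le> emeasure \<mu> N' + emeasure \<mu> A"
        using N'(1) As by (rule emeasure_subadditive)
      also have "\<dots> \<le> K * emeasure \<mu> (ball x (2 * q))"
        using add_mono[OF N'(3) A] by (simp add: K_def algebra_simps)
      also have "\<dots> \<le> K * (D ^ 3 * emeasure \<mu> (ball x (2 * q / 10)))"
        using doubling3[OF xc(2) _ subx] q0 by (intro mult_left_mono) auto
      finally show ?thesis
        by (simp add: mult_ac)
    qed
    ultimately show ?thesis
      using q0 N'(1) As by (intro exI[of _ "q / 5"] exI[of _ "N' \<union> A"]) auto
  qed
  then obtain \<rho>' N where \<rho>'N: "\<And>x. x \<in> E \<Longrightarrow> 0 < \<rho>' x \<and> \<rho>' x \<le> 2 * r / 5"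
      "\<And>x. x \<in> E \<Longrightarrow> N x \<in> sets \<mu>" "\<And>x. x \<in> E \<Longrightarrow> E \<inter> ball x (5 * \<rho>' x) \<subseteq> N x"
      "\<And>x. x \<in> E \<Longrightarrow> emeasure \<mu> (N x) \<le> (D ^ 3 * K) * emeasure \<mu> (ball x (\<rho>' x))"
    by metis
  have sub3: "ball x (\<rho>' x) \<subseteq> ball c (3 * r)" if "x \<in> E" for x
    using \<rho>'N(1)[OF that] that by (auto simp: E_def ball_subset_ball_iff dist_commute)
  have "outer_le \<mu> E
      ((D ^ 3 * K) * emeasure \<mu> (ball c (3 * r)))"
  proof (rule vitali_outer[where \<rho> = \<rho>' and N = N and R = "2 * r / 5"])
    show "ball c (3 * r) \<in> sets \<mu>"
      using sub5[of 3] by (intro borel_sets) auto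
    show "ball x (\<rho>' x) \<subseteq> \<Omega>" if "x \<in> E" for x
      using sub3[OF that] sub5[of 3] by auto
    show "emeasure \<mu> (N x) \<le> D ^ 3 * K * emeasure \<mu> (ball c (3 * r) \<inter> ball x (\<rho>' x))" if "x \<in> E" for x
      using \<rho>'N(4)[OF that] sub3[OF that] by (simp add: Int_absorb1)
  qed (use \<rho>'N in auto)
  then obtain N0 where N0: "N0 \<in> sets \<mu>" "E \<subseteq> N0"
      "emeasure \<mu> N0 \<le> (D ^ 3 * K) * emeasure \<mu> (ball c (3 * r))"
    by blast
  note N0(3)
  also have "(D ^ 3 * K) * emeasure \<mu> (ball c (3 * r)) \<le> (D ^ 3 * K) * (D * emeasure \<mu> (ball c r))"
    using c r sub5[of 3] by (intro mult_left_mono doubling) auto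
  also have "\<dots> = nondiv_const D (Suc d) * \<eta> * emeasure \<mu> (ball c r)"
    by (simp add: K_def power_Suc2 eval_nat_numeral mult_ac)
  finally show ?case
    using N0(1,2) unfolding E_def by blast
qed

end

section \<open>Determinants and the span of the minors\<close>

text \<open>The order is a number rather than an index type, since minors of every order are
  compared and expanded into one another; the formula is that of \<open>minor\<close>, and the
  theory comes from \<open>Determinant.det\<close>.\<close>

definition dt :: "nat \<Rightarrow> (nat \<Rightarrow> nat \<Rightarrow> real) \<Rightarrow> real" where
  "dt k M = (\<Sum>\<pi> | \<pi> permutes {..<k}. of_int (sign \<pi>) * (\<Prod>a<k. M a (\<pi> a)))"

lemma dt_det: "dt k M = Determinant.det (Matrix.mat k k (\<lambda>(i, j). M i j))"
proof -
  have "(\<Prod>a<k. M a (\<pi> a)) = (\<Prod>i = 0..<k. Matrix.mat k k (\<lambda>(i, j). M i j) $$ (i, \<pi> i))"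
    if "\<pi> permutes {..<k}" for \<pi>
  proof -
    have "\<pi> i < k" if "i < k" for i
      using permutes_in_image[OF \<open>\<pi> permutes {..<k}\<close>, of i] that by simp
    then show ?thesis
      by (simp add: lessThan_atLeast0)
  qed
  then show ?thesis
    by (auto simp: dt_def Determinant.det_def lessThan_atLeast0 intro!: sum.cong)
qed

lemma dt_cong:
  assumes "\<And>a c. a < k \<Longrightarrow> c < k \<Longrightarrow> M a c = M' a c"
  shows "dt k M = dt k M'"
  unfolding dt_def
proof (intro sum.cong refl arg_cong2[where f = "(*)"] prod.cong)
  fix \<pi> a assume "\<pi> \<in> {\<pi>. \<pi> permutes {..<k}}" "a \<in> {..<k}"
  then show "M a (\<pi> a) = M' a (\<pi> a)"
    using permutes_in_image[of \<pi> "{..<k}" a] by (intro assms) auto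
qed

lemma dt_0 [simp]: "dt 0 M = 1"
  by (simp add: dt_det)

lemma dt_mult: "dt k (\<lambda>a c. \<Sum>d<k. A a d * B d c) = dt k A * dt k B"
proof -
  have "Matrix.mat k k (\<lambda>(i, j). A i j) * Matrix.mat k k (\<lambda>(i, j). B i j)
      = Matrix.mat k k (\<lambda>(a, c). \<Sum>d<k. A a d * B d c)"
    by (rule eq_matI) (auto simp: scalar_prod_def lessThan_atLeast0 intro!: sum.cong)
  then show ?thesis
    using Determinant.det_mult[of "Matrix.mat k k (\<lambda>(i, j). A i j)" k "Matrix.mat k k (\<lambda>(i, j). B i j)"]
    by (simp add: dt_det)
qed

lemma dt_transpose: "dt k (\<lambda>a c. M c a) = dt k M"
proof -
  have "Matrix.transpose_mat (Matrix.mat k k (\<lambda>(i, j). M i j)) = Matrix.mat k k (\<lambda>(a, c). M c a)"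
    by (rule eq_matI) auto
  then show ?thesis
    using Determinant.det_transpose[of "Matrix.mat k k (\<lambda>(i, j). M i j)" k] by (simp add: dt_det)
qed

lemma dt_permute_rows:
  assumes "\<sigma> permutes {..<k}"
  shows "dt k (\<lambda>a c. M (\<sigma> a) c) = of_int (sign \<sigma>) * dt k M"
proof -
  have "dt k (\<lambda>a c. M (\<sigma> a) c)
      = Determinant.det (Matrix.mat k k (\<lambda>(i, j). Matrix.mat k k (\<lambda>(i, j). M i j) $$ (\<sigma> i, j)))"
    unfolding dt_det using permutes_in_image[OF assms]
    by (intro arg_cong[where f = Determinant.det] eq_matI) auto
  also have "\<dots> = of_int (sign \<sigma>) * dt k M"
    unfolding dt_det using assms by (intro det_permute_rows) (auto simp: lessThan_atLeast0)
  finally show ?thesis .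
qed

lemma dt_permute_cols:
  assumes "\<sigma> permutes {..<k}"
  shows "dt k (\<lambda>a c. M a (\<sigma> c)) = of_int (sign \<sigma>) * dt k M"
  using dt_permute_rows[OF assms, of "\<lambda>a c. M c a"]
  unfolding dt_transpose[of k M] dt_transpose[of k "\<lambda>a c. M a (\<sigma> c)"] .

lemma dt_eq_0_iff:
  "dt k M = 0 \<longleftrightarrow> (\<exists>x. (\<exists>i<k. x i \<noteq> 0) \<and> (\<forall>a<k. (\<Sum>i<k. M a i * x i) = 0))"
proof -
  let ?A = "Matrix.mat k k (\<lambda>(i, j). M i j)"
  have mv: "vec_index (?A *\<^sub>v v) a = (\<Sum>i<k. M a i * vec_index v i)" if "a < k" "v \<in> carrier_vec k" for a v
    using that by (auto simp: scalar_prod_def lessThan_atLeast0 intro!: sum.cong)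
  have "dt k M = 0 \<longleftrightarrow> (\<exists>v. v \<in> carrier_vec k \<and> v \<noteq> 0\<^sub>v k \<and> ?A *\<^sub>v v = 0\<^sub>v k)"
    unfolding dt_det by (rule det_0_iff_vec_prod_zero_field) simp
  also have "\<dots> \<longleftrightarrow> (\<exists>x. (\<exists>i<k. x i \<noteq> 0) \<and> (\<forall>a<k. (\<Sum>i<k. M a i * x i) = 0))"
  proof safe
    fix v :: "real Matrix.vec" assume v: "v \<in> carrier_vec k" "v \<noteq> 0\<^sub>v k" "?A *\<^sub>v v = 0\<^sub>v k"
    have "\<exists>i<k. vec_index v i \<noteq> 0"
    proof (rule ccontr)
      assume "\<not> ?thesis"
      then have "v = 0\<^sub>v k"
        using v(1) by (intro eq_vecI) auto
      with v(2) show False by blast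
    qed
    moreover have "(\<Sum>i<k. M a i * vec_index v i) = 0" if "a < k" for a
      using mv[OF that v(1)] v(3) that by simp
    ultimately show "\<exists>x. (\<exists>i<k. x i \<noteq> 0) \<and> (\<forall>a<k. (\<Sum>i<k. M a i * x i) = 0)"
      by blast
  next
    fix x i assume x: "\<forall>a<k. (\<Sum>i<k. M a i * x i) = 0" "i < k" "x i \<noteq> (0::real)"
    define v where "v = Matrix.vec k x"
    have v: "v \<in> carrier_vec k" by (simp add: v_def)
    moreover have "v \<noteq> 0\<^sub>v k"
      using x(2,3) by (metis index_vec index_zero_vec(1) v_def)
    moreover have "?A *\<^sub>v v = 0\<^sub>v k"
    proof (rule eq_vecI)
      fix a assume a: "a < dim_vec (0\<^sub>v k :: real Matrix.vec)"
      then have "vec_index (?A *\<^sub>v v) a = (\<Sum>i<k. M a i * vec_index v i)"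
        using mv[OF _ v] by simp
      also have "\<dots> = (\<Sum>i<k. M a i * x i)"
        by (intro sum.cong) (auto simp: v_def)
      finally show "vec_index (?A *\<^sub>v v) a = vec_index (0\<^sub>v k) a"
        using x(1) a by simp
    qed simp
    ultimately show "\<exists>v. v \<in> carrier_vec k \<and> v \<noteq> 0\<^sub>v k \<and> ?A *\<^sub>v v = 0\<^sub>v k"
      by blast
  qed
  finally show ?thesis .
qed

lemma dt_eq_0_iff_row:
  "dt k M = 0 \<longleftrightarrow> (\<exists>x. (\<exists>i<k. x i \<noteq> 0) \<and> (\<forall>c<k. (\<Sum>i<k. x i * M i c) = 0))"
  using dt_eq_0_iff[of k "\<lambda>a c. M c a"] unfolding dt_transpose[of k M] by (simp add: mult.commute)

text \<open>Padding with zero rows makes the system square and singular, because the unit vector at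
  a zero row is a left kernel vector.\<close>

lemma underdetermined_kernel:
  fixes M :: "nat \<Rightarrow> nat \<Rightarrow> real"
  assumes "l < k"
  shows "\<exists>x. (\<exists>i<k. x i \<noteq> 0) \<and> (\<forall>a<l. (\<Sum>i<k. M a i * x i) = 0)"
proof -
  define M' where "M' a i = (if a < l then M a i else 0)" for a i
  have "dt k M' = 0"
    unfolding dt_eq_0_iff_row using assms
    by (intro exI[of _ "\<lambda>i. if i = l then 1 else 0"])
      (auto simp: M'_def if_distrib[where f = "\<lambda>x. x * _"] cong: if_cong)
  then obtain x where "\<exists>i<k. x i \<noteq> 0" "\<forall>a<k. (\<Sum>i<k. M' a i * x i) = 0"
    unfolding dt_eq_0_iff by blast
  moreover have "(\<Sum>i<k. M a i * x i) = (\<Sum>i<k. M' a i * x i)" if "a < l" for a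
    using that by (simp add: M'_def)
  ultimately show ?thesis
    using assms by (intro exI[of _ x]) auto
qed

lemma dt_equal_rows:
  assumes "a < k" "b < k" "a \<noteq> b" "\<And>c. c < k \<Longrightarrow> M a c = M b c"
  shows "dt k M = 0"
  unfolding dt_eq_0_iff_row
proof (intro exI[of _ "\<lambda>i. if i = a then 1 else if i = b then -1 else 0"] conjI allI impI)
  show "\<exists>i<k. (if i = a then 1 else if i = b then - 1 else 0) \<noteq> (0::real)"
    using assms by auto
  fix c assume c: "c < k"
  have "(\<Sum>i<k. (if i = a then 1 else if i = b then - 1 else 0) * M i c)
      = (\<Sum>i<k. (if i = a then M a c else 0) + (if i = b then - M b c else 0))"
    using assms(3) by (intro sum.cong) auto
  also have "\<dots> = 0"
    using assms c by (simp add: sum.distrib)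
  finally show "(\<Sum>i<k. (if i = a then 1 else if i = b then - 1 else 0) * M i c) = 0" .
qed

lemma dt_equal_cols:
  assumes "a < k" "b < k" "a \<noteq> b" "\<And>c. c < k \<Longrightarrow> M c a = M c b"
  shows "dt k M = 0"
  using dt_equal_rows[of a k b "\<lambda>a c. M c a"] assms unfolding dt_transpose[of k M] by simp

lemma dt_laplace_row:
  assumes "i < k"
  shows "dt k M = (\<Sum>j<k. M i j * ((-1) ^ (i + j) *
           dt (k - 1) (\<lambda>a c. M (insert_index i a) (insert_index j c))))"
proof -
  let ?A = "Matrix.mat k k (\<lambda>(i, j). M i j)"
  have "dt k M = (\<Sum>j<k. ?A $$ (i, j) * cofactor ?A i j)"
    unfolding dt_det using assms by (intro laplace_expansion_row) auto
  also have "\<dots> = (\<Sum>j<k. M i j * ((-1) ^ (i + j) *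
           dt (k - 1) (\<lambda>a c. M (insert_index i a) (insert_index j c))))"
  proof (intro sum.cong refl)
    fix j assume j: "j \<in> {..<k}"
    have "mat_delete ?A i j = Matrix.mat (k - 1) (k - 1) (\<lambda>(a, c). M (insert_index i a) (insert_index j c))"
      by (rule eq_matI) (auto simp: mat_delete_def insert_index_def)
    then show "?A $$ (i, j) * cofactor ?A i j
        = M i j * ((-1) ^ (i + j) * dt (k - 1) (\<lambda>a c. M (insert_index i a) (insert_index j c)))"
      using j assms by (simp add: cofactor_def dt_det)
  qed
  finally show ?thesis .
qed

lemma dt_laplace_col:
  assumes "j < k"
  shows "dt k M = (\<Sum>i<k. M i j * ((-1) ^ (i + j) *
           dt (k - 1) (\<lambda>a c. M (insert_index i a) (insert_index j c))))"
proof -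
  have "dt k M = dt k (\<lambda>a c. M c a)"
    by (rule dt_transpose[symmetric])
  also have "\<dots> = (\<Sum>i<k. M i j * ((-1) ^ (j + i) *
           dt (k - 1) (\<lambda>a c. M (insert_index i c) (insert_index j a))))"
    by (rule dt_laplace_row[OF assms])
  also have "\<dots> = (\<Sum>i<k. M i j * ((-1) ^ (i + j) *
           dt (k - 1) (\<lambda>a c. M (insert_index i a) (insert_index j c))))"
  proof (intro sum.cong refl)
    fix i
    show "M i j * ((-1) ^ (j + i) * dt (k - 1) (\<lambda>a c. M (insert_index i c) (insert_index j a)))
        = M i j * ((-1) ^ (i + j) * dt (k - 1) (\<lambda>a c. M (insert_index i a) (insert_index j c)))"
      unfolding dt_transpose[of "k - 1" "\<lambda>a c. M (insert_index i a) (insert_index j c)"]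
      by (simp add: add.commute)
  qed
  finally show ?thesis .
qed

text \<open>Only the identity permutation contributes. As a form of Cramer's rule this later
  exhibits a single entry of a normalised family as one of its minors.\<close>

lemma dt_identity_with_row:
  assumes b: "b < k"
  shows "dt k (\<lambda>a c. if a = b then y c else if a = c then 1 else 0) = y b"
proof -
  let ?M = "\<lambda>a c. if a = b then y c else if a = c then 1 else (0::real)"
  have "(\<Prod>a<k. ?M a (\<pi> a)) = 0" if "\<pi> permutes {..<k}" "\<pi> \<noteq> id" for \<pi>
  proof -
    have "\<exists>a<k. a \<noteq> b \<and> \<pi> a \<noteq> a"
    proof (rule ccontr)
      assume "\<not> ?thesis"
      then have fix': "\<pi> a = a" if "a \<noteq> b" for a
        using that \<open>\<pi> permutes {..<k}\<close> by (metis lessThan_iff permutes_not_in)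
      have "\<pi> b = b"
        using fix' permutes_inj[OF \<open>\<pi> permutes {..<k}\<close>] by (metis injD)
      then have "\<pi> = id"
        using fix' by (metis eq_id_iff)
      with \<open>\<pi> \<noteq> id\<close> show False by blast
    qed
    then obtain a where "a < k" "a \<noteq> b" "\<pi> a \<noteq> a" by blast
    then show ?thesis
      by (intro prod_zero bexI[of _ a]) auto
  qed
  then have "dt k ?M = (\<Sum>\<pi> | \<pi> permutes {..<k}. if \<pi> = id then (\<Prod>a<k. ?M a (\<pi> a)) else 0)"
    unfolding dt_def by (intro sum.cong refl) (auto simp: sign_id)
  also have "\<dots> = (\<Prod>a<k. ?M a (id a))"
    by (simp add: finite_permutations permutes_id)
  also have "\<dots> = (\<Prod>a<k. if a = b then y b else 1)"
    by (rule prod.cong) auto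
  also have "\<dots> = y b"
    using b by simp
  finally show ?thesis .
qed

lemma dt_identity: "dt k (\<lambda>a c. if a = c then 1 else 0) = 1"
proof (cases "k = 0")
  case False
  then have "dt k (\<lambda>a c. if a = c then 1 else 0)
      = dt k (\<lambda>a c. if a = 0 then (if 0 = c then 1 else 0) else if a = c then 1 else 0)"
    by (intro dt_cong) auto
  also have "\<dots> = 1"
    using False by (subst dt_identity_with_row) auto
  finally show ?thesis .
qed simp

lemma dt_inverse:
  assumes "dt k M \<noteq> 0"
  obtains T where "\<And>a c. a < k \<Longrightarrow> c < k \<Longrightarrow> (\<Sum>d<k. M a d * T d c) = (if a = c then 1 else 0)"
    and "dt k M * dt k T = 1"
proof -
  let ?A = "Matrix.mat k k (\<lambda>(i, j). M i j)"
  have "?A \<in> Units (ring_mat TYPE(real) k ())"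
    using assms unfolding dt_det by (intro det_non_zero_imp_unit) auto
  then obtain B where B: "B \<in> carrier_mat k k" "?A * B = 1\<^sub>m k"
    by (auto simp: Units_def ring_mat_def)
  define T where "T d c = B $$ (d, c)" for d c
  have T: "(\<Sum>d<k. M a d * T d c) = (if a = c then 1 else 0)" if "a < k" "c < k" for a c
  proof -
    have "(?A * B) $$ (a, c) = (\<Sum>d<k. M a d * T d c)"
      using B(1) that by (auto simp: scalar_prod_def T_def lessThan_atLeast0 intro!: sum.cong)
    then show ?thesis
      using B(2) that by simp
  qed
  have "dt k M * dt k T = dt k (\<lambda>a c. if a = c then 1 else 0)"
    unfolding dt_mult[symmetric] using T by (intro dt_cong) auto
  then have "dt k M * dt k T = 1"
    by (simp add: dt_identity)
  with T show thesis
    by (rule that)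
qed

text \<open>The sum is over all selections of rows, not only over increasing ones, hence the factor \<open>fact k\<close>.\<close>

lemma cauchy_binet:
  fixes Z :: "nat \<Rightarrow> 's \<Rightarrow> real" and W :: "'s \<Rightarrow> nat \<Rightarrow> real"
  assumes X: "finite X"
  shows "fact k * dt k (\<lambda>a c. \<Sum>s\<in>X. Z a s * W s c)
    = (\<Sum>f\<in>{..<k} \<rightarrow>\<^sub>E X. dt k (\<lambda>a c. W (f a) c) * dt k (\<lambda>a c. Z a (f c)))"
proof -
  let ?P = "{\<pi>. \<pi> permutes {..<k}}" and ?E = "{..<k} \<rightarrow>\<^sub>E X"
  have expand: "dt k (\<lambda>a c. \<Sum>s\<in>X. Z a s * W s c)
      = (\<Sum>f\<in>?E. (\<Prod>a<k. Z a (f a)) * dt k (\<lambda>a c. W (f a) c))"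
  proof -
    have "dt k (\<lambda>a c. \<Sum>s\<in>X. Z a s * W s c)
        = (\<Sum>\<pi>\<in>?P. of_int (sign \<pi>) * (\<Sum>f\<in>?E. \<Prod>a<k. Z a (f a) * W (f a) (\<pi> a)))"
      unfolding dt_def using X by (subst prod_sum_PiE) auto
    also have "\<dots> = (\<Sum>\<pi>\<in>?P. \<Sum>f\<in>?E. of_int (sign \<pi>) * ((\<Prod>a<k. Z a (f a)) * (\<Prod>a<k. W (f a) (\<pi> a))))"
      by (simp add: sum_distrib_left prod.distrib)
    also have "\<dots> = (\<Sum>f\<in>?E. \<Sum>\<pi>\<in>?P. of_int (sign \<pi>) * ((\<Prod>a<k. Z a (f a)) * (\<Prod>a<k. W (f a) (\<pi> a))))"
      by (rule sum.swap)
    also have "\<dots> = (\<Sum>f\<in>?E. (\<Prod>a<k. Z a (f a)) * dt k (\<lambda>a c. W (f a) c))"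
      unfolding dt_def sum_distrib_left by (intro sum.cong refl) (simp add: mult_ac)
    finally show ?thesis .
  qed
  \<comment> \<open>Reindexing the selections by \<sigma> permutes the rows of the \<open>W\<close>
    minor and brings out its sign. Summing over all \<sigma> then turns the product of
    \<open>Z\<close> entries into a determinant.\<close>
  have twist: "(\<Sum>f\<in>?E. (\<Prod>a<k. Z a (f a)) * dt k (\<lambda>a c. W (f a) c))
      = (\<Sum>f\<in>?E. (of_int (sign \<sigma>) * (\<Prod>a<k. Z a (f (\<sigma> a)))) * dt k (\<lambda>a c. W (f a) c))"
    if \<sigma>: "\<sigma> permutes {..<k}" for \<sigma>
  proof -
    let ?r = "\<lambda>\<sigma> f. restrict (f \<circ> \<sigma>) {..<k}"
    have lt: "\<sigma> a < k" "Hilbert_Choice.inv \<sigma> a < k" if "a < k" for a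
      using that permutes_in_image[OF \<sigma>] permutes_in_image[OF permutes_inv[OF \<sigma>]] by auto
    have inv: "\<sigma> (Hilbert_Choice.inv \<sigma> a) = a" "Hilbert_Choice.inv \<sigma> (\<sigma> a) = a" for a
      using permutes_inverses[OF \<sigma>] by auto
    have "(\<Sum>f\<in>?E. (\<Prod>a<k. Z a (f a)) * dt k (\<lambda>a c. W (f a) c))
        = (\<Sum>f\<in>?E. (\<Prod>a<k. Z a (?r \<sigma> f a)) * dt k (\<lambda>a c. W (?r \<sigma> f a) c))"
      by (rule sum.reindex_bij_witness[where i = "?r \<sigma>" and j = "?r (Hilbert_Choice.inv \<sigma>)"])
        (auto simp: lt inv fun_eq_iff PiE_def extensional_def Pi_def restrict_def
          intro!: arg_cong2[where f = "(*)"] prod.cong dt_cong)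
    also have "\<dots> = (\<Sum>f\<in>?E. (of_int (sign \<sigma>) * (\<Prod>a<k. Z a (f (\<sigma> a)))) * dt k (\<lambda>a c. W (f a) c))"
    proof (intro sum.cong refl)
      fix f assume "f \<in> ?E"
      have "dt k (\<lambda>a c. W (?r \<sigma> f a) c) = dt k (\<lambda>a c. W (f (\<sigma> a)) c)"
        by (intro dt_cong) auto
      also have "\<dots> = of_int (sign \<sigma>) * dt k (\<lambda>a c. W (f a) c)"
        by (rule dt_permute_rows[OF \<sigma>])
      finally show "(\<Prod>a<k. Z a (?r \<sigma> f a)) * dt k (\<lambda>a c. W (?r \<sigma> f a) c)
          = (of_int (sign \<sigma>) * (\<Prod>a<k. Z a (f (\<sigma> a)))) * dt k (\<lambda>a c. W (f a) c)"
        by simp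
    qed
    finally show ?thesis .
  qed
  have "fact k * dt k (\<lambda>a c. \<Sum>s\<in>X. Z a s * W s c)
      = (\<Sum>\<sigma>\<in>?P. dt k (\<lambda>a c. \<Sum>s\<in>X. Z a s * W s c))"
    by (simp add: card_permutations)
  also have "\<dots> = (\<Sum>\<sigma>\<in>?P. \<Sum>f\<in>?E. (of_int (sign \<sigma>) * (\<Prod>a<k. Z a (f (\<sigma> a)))) * dt k (\<lambda>a c. W (f a) c))"
    unfolding expand by (rule sum.cong[OF refl]) (rule twist, simp)
  also have "\<dots> = (\<Sum>f\<in>?E. \<Sum>\<sigma>\<in>?P. (of_int (sign \<sigma>) * (\<Prod>a<k. Z a (f (\<sigma> a)))) * dt k (\<lambda>a c. W (f a) c))"
    by (rule sum.swap)
  also have "\<dots> = (\<Sum>f\<in>?E. dt k (\<lambda>a c. W (f a) c) * dt k (\<lambda>a c. Z a (f c)))"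
    by (intro sum.cong refl) (simp add: dt_def[of k "\<lambda>a c. Z a (_ c)"] sum_distrib_left mult_ac)
  finally show ?thesis .
qed

text \<open>Composed with \<open>F\<close>, these are the functions to which \<open>good_map\<close>
  applies near a point, with \<open>C\<close> and \<alpha> independent of the coefficients.\<close>

definition minor_span :: "(real ^ 'n::{finite,linorder} ^ 'm::{finite,linorder} \<Rightarrow> real) set" where
  "minor_span = {f. \<exists>a0 a. \<forall>Y. f Y = a0 + (\<Sum>s\<in>minor_index. a s * minor Y s)}"

lemma minor_span_const: "(\<lambda>Y. c) \<in> minor_span"
  unfolding minor_span_def by (auto intro!: exI[of _ c] exI[of _ "\<lambda>_. 0"])

lemma minor_span_add:
  assumes "f \<in> minor_span" "g \<in> minor_span"
  shows "(\<lambda>Y. f Y + g Y) \<in> minor_span"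
proof -
  obtain a0 a b0 b where "\<And>Y. f Y = a0 + (\<Sum>s\<in>minor_index. a s * minor Y s)"
      "\<And>Y. g Y = b0 + (\<Sum>s\<in>minor_index. b s * minor Y s)"
    using assms by (auto simp: minor_span_def)
  then have "\<And>Y. f Y + g Y = (a0 + b0) + (\<Sum>s\<in>minor_index. (a s + b s) * minor Y s)"
    by (simp add: algebra_simps sum.distrib)
  then show ?thesis
    unfolding minor_span_def by (auto intro!: exI[of _ "a0 + b0"] exI[of _ "\<lambda>s. a s + b s"])
qed

lemma minor_span_cmult:
  assumes "f \<in> minor_span"
  shows "(\<lambda>Y. c * f Y) \<in> minor_span"
proof -
  obtain a0 a where "\<And>Y. f Y = a0 + (\<Sum>s\<in>minor_index. a s * minor Y s)"
    using assms by (auto simp: minor_span_def)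
  then have "\<And>Y. c * f Y = c * a0 + (\<Sum>s\<in>minor_index. (c * a s) * minor Y s)"
    by (simp add: distrib_left sum_distrib_left mult_ac)
  then show ?thesis
    unfolding minor_span_def by (auto intro!: exI[of _ "c * a0"] exI[of _ "\<lambda>s. c * a s"])
qed

lemma minor_span_sum:
  assumes "\<And>i. i \<in> I \<Longrightarrow> f i \<in> minor_span"
  shows "(\<lambda>Y. \<Sum>i\<in>I. f i Y) \<in> minor_span"
  using assms
  by (induction I rule: infinite_finite_induct) (auto intro: minor_span_const minor_span_add)

text \<open>A \<open>minor\<close> lists its rows and columns in increasing order; an arbitrary
  injective selection differs from that by a permutation, which costs only a sign.\<close>

lemma sorted_list_enum:
  fixes j :: "nat \<Rightarrow> 'm::{finite,linorder}"
  assumes inj: "inj_on j {..<k}"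
  obtains \<sigma> where "\<sigma> permutes {..<k}"
    and "\<And>a. a < k \<Longrightarrow> j a = sorted_list_of_set (j ` {..<k}) ! \<sigma> a"
proof -
  let ?L = "sorted_list_of_set (j ` {..<k})"
  have len: "length ?L = k"
    using inj by (simp add: card_image)
  have bij: "bij_betw ((!) ?L) {..<k} (j ` {..<k})"
    using bij_betw_nth[of ?L "{..<k}" "j ` {..<k}"] len by simp
  have bij': "bij_betw (inv_into {..<k} ((!) ?L) \<circ> j) {..<k} {..<k}"
    using inj by (intro bij_betw_trans[OF _ bij_betw_inv_into[OF bij]]) (simp add: bij_betw_def)
  define \<sigma> where "\<sigma> a = (if a < k then inv_into {..<k} ((!) ?L) (j a) else a)" for a
  have "bij_betw \<sigma> {..<k} {..<k}"
    using bij' by (rule bij_betw_cong[THEN iffD1, rotated]) (simp add: \<sigma>_def)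
  then have "\<sigma> permutes {..<k}"
    by (rule bij_imp_permutes) (simp add: \<sigma>_def)
  moreover have "j a = ?L ! \<sigma> a" if "a < k" for a
    using that bij bij_betw_inv_into_right[OF bij, of "j a"] by (simp add: \<sigma>_def)
  ultimately show thesis
    using that by blast
qed

lemma dt_submatrix_in_span:
  "(\<lambda>Y :: real ^ 'n::{finite,linorder} ^ 'm::{finite,linorder}. dt k (\<lambda>a c. Y $ j a $ i c)) \<in> minor_span"
proof -
  consider "k = 0" | "k > 0" "\<not> inj_on j {..<k}" | "k > 0" "\<not> inj_on i {..<k}"
    | "k > 0" "inj_on j {..<k}" "inj_on i {..<k}" by auto
  then show ?thesis
  proof cases
    case 1
    then show ?thesis by (simp add: minor_span_const)
  next
    case 2
    then obtain a b where "a < k" "b < k" "a \<noteq> b" "j a = j b"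
      by (auto simp: inj_on_def)
    then have "dt k (\<lambda>a c. Y $ j a $ i c) = 0" for Y
      by (intro dt_equal_rows[of a k b]) auto
    then show ?thesis by (simp add: minor_span_const)
  next
    case 3
    then obtain a b where "a < k" "b < k" "a \<noteq> b" "i a = i b"
      by (auto simp: inj_on_def)
    then have "dt k (\<lambda>a c. Y $ j a $ i c) = 0" for Y
      by (intro dt_equal_cols[of a k b]) auto
    then show ?thesis by (simp add: minor_span_const)
  next
    case 4
    let ?I = "j ` {..<k}" and ?J = "i ` {..<k}"
    obtain \<sigma> where \<sigma>: "\<sigma> permutes {..<k}" "\<And>a. a < k \<Longrightarrow> j a = sorted_list_of_set ?I ! \<sigma> a"
      using sorted_list_enum[OF 4(2)] by blast
    obtain \<tau> where \<tau>: "\<tau> permutes {..<k}" "\<And>a. a < k \<Longrightarrow> i a = sorted_list_of_set ?J ! \<tau> a"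
      using sorted_list_enum[OF 4(3)] by blast
    have card: "card ?I = k" "card ?J = k"
      using 4 by (auto simp: card_image)
    have idx: "(?I, ?J) \<in> minor_index"
      using 4(1) card by (auto simp: minor_index_def)
    define e :: real where "e = of_int (sign \<sigma>) * of_int (sign \<tau>)"
    have "dt k (\<lambda>a c. Y $ j a $ i c) = e * minor Y (?I, ?J)" for Y
    proof -
      let ?M = "\<lambda>a c. Y $ (sorted_list_of_set ?I ! a) $ (sorted_list_of_set ?J ! c)"
      have "dt k (\<lambda>a c. Y $ j a $ i c) = dt k (\<lambda>a c. ?M (\<sigma> a) (\<tau> c))"
        by (intro dt_cong) (simp only: \<sigma>(2)[symmetric] \<tau>(2)[symmetric])
      also have "\<dots> = of_int (sign \<sigma>) * dt k (\<lambda>a c. ?M a (\<tau> c))"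
        by (rule dt_permute_rows[OF \<sigma>(1)])
      also have "dt k (\<lambda>a c. ?M a (\<tau> c)) = of_int (sign \<tau>) * dt k ?M"
        by (rule dt_permute_cols[OF \<tau>(1)])
      also have "dt k ?M = minor Y (?I, ?J)"
        by (simp add: dt_def minor_def card)
      finally show ?thesis by (simp add: e_def)
    qed
    moreover have "e * minor Y (?I, ?J)
        = 0 + (\<Sum>s\<in>minor_index. (if s = (?I, ?J) then e else 0) * minor Y s)" for Y
    proof -
      have "(\<Sum>s\<in>minor_index. (if s = (?I, ?J) then e else 0) * minor Y s)
          = (\<Sum>s\<in>minor_index. if s = (?I, ?J) then e * minor Y s else 0)"
        by (intro sum.cong) auto
      also have "\<dots> = e * minor Y (?I, ?J)"
        using idx by (subst sum.delta) auto
      finally show ?thesis by simp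
    qed
    ultimately show ?thesis
      unfolding minor_span_def
      by (intro CollectI exI[of _ 0] exI[of _ "\<lambda>s. if s = (?I, ?J) then e else 0"]) simp
  qed
qed

text \<open>These are the entries of the matrix \<open>[-1, Y; 0, 1]\<close>, which maps \<open>(p, q)\<close> to \<open>(Y q - p, q)\<close>.\<close>

fun block_entry :: "real ^ 'n ^ 'm \<Rightarrow> 'm + 'n \<Rightarrow> 'm + 'n \<Rightarrow> real" where
  "block_entry Y (Inl j) (Inl j') = (if j = j' then -1 else 0)"
| "block_entry Y (Inl j) (Inr i) = Y $ j $ i"
| "block_entry Y (Inr i) (Inl j) = 0"
| "block_entry Y (Inr i) (Inr i') = (if i = i' then 1 else 0)"

text \<open>A row with index \<open>Inr\<close> and a column with index \<open>Inl\<close> are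
  constant in \<open>Y\<close>, so Laplace expansion along it lowers the order with constant
  coefficients; when neither occurs, what remains is a submatrix of \<open>Y\<close>.\<close>

lemma dt_block_in_span:
  fixes f g :: "nat \<Rightarrow> 'm::{finite,linorder} + 'n::{finite,linorder}"
  shows "(\<lambda>Y. dt k (\<lambda>a c. block_entry Y (f a) (g c))) \<in> minor_span"
proof (induction k arbitrary: f g)
  case 0
  then show ?case by (simp add: minor_span_const)
next
  case (Suc k)
  consider (row) a i where "a < Suc k" "f a = Inr i" | (col) c j where "c < Suc k" "g c = Inl j"
    | (minor) "\<forall>a<Suc k. \<exists>j. f a = Inl j" "\<forall>c<Suc k. \<exists>i. g c = Inr i"
    by (metis sum.exhaust)
  then show ?case
  proof cases
    case row
    have const: "block_entry Y (f a) s = block_entry 0 (f a) s" for Y s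
      using row(2) by (cases s) auto
    have eq: "dt (Suc k) (\<lambda>a c. block_entry Y (f a) (g c))
        = (\<Sum>c<Suc k. (block_entry 0 (f a) (g c) * (-1) ^ (a + c)) *
            dt k (\<lambda>a' c'. block_entry Y (f (insert_index a a')) (g (insert_index c c'))))" for Y
      unfolding dt_laplace_row[OF row(1)] by (simp add: const[of Y] mult.assoc)
    show ?thesis
      unfolding eq by (intro minor_span_sum minor_span_cmult Suc.IH)
  next
    case col
    have const: "block_entry Y s (g c) = block_entry 0 s (g c)" for Y s
      using col(2) by (cases s) auto
    have eq: "dt (Suc k) (\<lambda>a c. block_entry Y (f a) (g c))
        = (\<Sum>a<Suc k. (block_entry 0 (f a) (g c) * (-1) ^ (a + c)) *
            dt k (\<lambda>a' c'. block_entry Y (f (insert_index a a')) (g (insert_index c c'))))" for Y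
      unfolding dt_laplace_col[OF col(1)] by (simp add: const[of Y] mult.assoc)
    show ?thesis
      unfolding eq by (intro minor_span_sum minor_span_cmult Suc.IH)
  next
    case minor
    then obtain j i where ji: "\<forall>a<Suc k. f a = Inl (j a)" "\<forall>c<Suc k. g c = Inr (i c)"
      by metis
    have "dt (Suc k) (\<lambda>a c. block_entry Y (f a) (g c)) = dt (Suc k) (\<lambda>a c. Y $ j a $ i c)" for Y
      using ji by (intro dt_cong) auto
    then show ?thesis
      using dt_submatrix_in_span by simp
  qed
qed

definition block_act :: "real ^ 'n ^ 'm \<Rightarrow> real ^ ('m::finite + 'n::finite) \<Rightarrow> real ^ ('m + 'n)" where
  "block_act Y v = (\<chi> s. \<Sum>s'\<in>UNIV. block_entry Y s s' * v $ s')"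

text \<open>This brings goodness to bear on the lattice: by the Cauchy-Binet formula every Pluecker
  coordinate of the moved vectors is a fixed combination of minors of the block matrix.\<close>

theorem dt_block_act_in_span:
  fixes f :: "nat \<Rightarrow> 'm::{finite,linorder} + 'n::{finite,linorder}"
  shows "(\<lambda>Y. dt k (\<lambda>a c. block_act Y (w c) $ f a)) \<in> minor_span"
proof -
  have eq: "dt k (\<lambda>a c. block_act Y (w c) $ f a)
      = (\<Sum>g\<in>{..<k} \<rightarrow>\<^sub>E UNIV. (dt k (\<lambda>a c. w c $ g a) / fact k) * dt k (\<lambda>a c. block_entry Y (f a) (g c)))" for Y
    using cauchy_binet[of UNIV k "\<lambda>a. block_entry Y (f a)" "\<lambda>s c. w c $ s"]
    by (simp add: block_act_def sum_divide_distrib[symmetric] field_simps)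
  show ?thesis
    unfolding eq by (intro minor_span_sum minor_span_cmult dt_block_in_span)
qed

section \<open>Weak nonplanarity and the growth of subspaces\<close>

lemma sum_UNIV_sum:
  fixes g :: "'m::finite + 'n::finite \<Rightarrow> 'a::comm_monoid_add"
  shows "(\<Sum>s\<in>UNIV. g s) = (\<Sum>j\<in>UNIV. g (Inl j)) + (\<Sum>i\<in>UNIV. g (Inr i))"
  unfolding UNIV_Plus_UNIV[symmetric] by (subst sum.Plus) (simp_all add: comp_def)

lemma block_act_Inl: "block_act Y v $ Inl j = (\<Sum>i\<in>UNIV. Y $ j $ i * v $ Inr i) - v $ Inl j"
  by (simp add: block_act_def sum_UNIV_sum if_distrib[where f = "\<lambda>x. x * _"] cong: if_cong)

lemma block_act_Inr: "block_act Y v $ Inr i = v $ Inr i"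
  by (simp add: block_act_def sum_UNIV_sum if_distrib[where f = "\<lambda>x. x * _"] cong: if_cong)

lemma linear_block_act: "linear (block_act Y)"
  by (rule linearI) (auto simp: block_act_def vec_eq_iff algebra_simps sum.distrib sum_distrib_left)

section \<open>Independent families, their spans and nonsingular minors\<close>

definition lin_indep :: "nat \<Rightarrow> (nat \<Rightarrow> 'a::real_vector) \<Rightarrow> bool" where
  "lin_indep k w \<longleftrightarrow> (\<forall>x. (\<Sum>c<k. x c *\<^sub>R w c) = 0 \<longrightarrow> (\<forall>c<k. x c = 0))"

lemma lin_indep_inj_on:
  assumes "lin_indep k w"
  shows "inj_on w {..<k}"
proof (rule inj_onI, rule ccontr)
  fix a b assume ab: "a \<in> {..<k}" "b \<in> {..<k}" "w a = w b" "a \<noteq> b"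
  have "(\<Sum>c<k. (if c = a then 1 else if c = b then -1 else 0) *\<^sub>R w c)
      = (\<Sum>c<k. (if c = a then w a else 0) + (if c = b then - w b else 0))"
    using ab(4) by (intro sum.cong) auto
  also have "\<dots> = 0"
    using ab by (simp add: sum.distrib)
  finally have "\<forall>c<k. (if c = a then 1 else if c = b then -1 else 0) = (0::real)"
    using assms assms[unfolded lin_indep_def, rule_format, of "\<lambda>c. if c = a then 1 else if c = b then -1 else 0"] by blast
  then show False
    using ab(1) by auto
qed

lemma lin_indep_independent:
  assumes "lin_indep k w"
  shows "independent (w ` {..<k})"
proof
  assume "dependent (w ` {..<k})"
  then obtain u v where u: "v \<in> w ` {..<k}" "u v \<noteq> 0" "(\<Sum>v\<in>w ` {..<k}. u v *\<^sub>R v) = 0"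
    by (auto simp: dependent_finite)
  then have "(\<Sum>c<k. u (w c) *\<^sub>R w c) = 0"
    using lin_indep_inj_on[OF assms] by (simp add: sum.reindex)
  then have "\<forall>c<k. u (w c) = 0"
    using assms[unfolded lin_indep_def, rule_format, of "\<lambda>c. u (w c)"] by blast
  then show False
    using u by auto
qed

lemma dim_span_lin_indep:
  fixes w :: "nat \<Rightarrow> 'a::euclidean_space"
  assumes "lin_indep k w"
  shows "dim (span (w ` {..<k})) = k"
  using dim_eq_card_independent[OF lin_indep_independent[OF assms]] lin_indep_inj_on[OF assms]
  by (simp add: card_image)

lemma lin_indep_Suc:
  assumes w: "lin_indep k w" and v: "v \<notin> span (w ` {..<k})"
  shows "lin_indep (Suc k) (w(k := v))"
  unfolding lin_indep_def
proof (intro allI impI)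
  fix x c assume eq: "(\<Sum>c<Suc k. x c *\<^sub>R (w(k := v)) c) = 0" and c: "c < Suc k"
  have S: "(\<Sum>c<k. x c *\<^sub>R w c) + x k *\<^sub>R v = 0"
    using eq by simp
  have "x k = 0"
  proof (rule ccontr)
    assume "x k \<noteq> 0"
    then have "v = (- 1 / x k) *\<^sub>R (\<Sum>c<k. x c *\<^sub>R w c)"
      using S by (simp add: eq_neg_iff_add_eq_0[symmetric])
    moreover have "(- 1 / x k) *\<^sub>R (\<Sum>c<k. x c *\<^sub>R w c) \<in> span (w ` {..<k})"
      by (intro span_scale span_sum) (auto intro: span_base)
    ultimately show False using v by simp
  qed
  moreover have "\<forall>c<k. x c = 0"
    using S \<open>x k = 0\<close> w unfolding lin_indep_def by simp
  ultimately show "x c = 0"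
    using c less_Suc_eq by auto
qed

lemma span_image_nat:
  fixes w :: "nat \<Rightarrow> 'a::real_vector"
  shows "v \<in> span (w ` {..<k}) \<longleftrightarrow> (\<exists>x. v = (\<Sum>c<k. x c *\<^sub>R w c))"
proof (induction k arbitrary: v)
  case (Suc k)
  have *: "w ` {..<Suc k} = insert (w k) (w ` {..<k})"
    by (simp add: lessThan_Suc)
  show ?case
  proof
    assume "v \<in> span (w ` {..<Suc k})"
    then obtain y where "v - y *\<^sub>R w k \<in> span (w ` {..<k})"
      unfolding * by (auto simp: span_insert)
    then obtain x where "v - y *\<^sub>R w k = (\<Sum>c<k. x c *\<^sub>R w c)"
      using Suc.IH by blast
    then have "v = (\<Sum>c<Suc k. (x(k := y)) c *\<^sub>R w c)"
      by (simp add: algebra_simps)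
    then show "\<exists>x. v = (\<Sum>c<Suc k. x c *\<^sub>R w c)" by blast
  next
    assume "\<exists>x. v = (\<Sum>c<Suc k. x c *\<^sub>R w c)"
    then show "v \<in> span (w ` {..<Suc k})"
      by (auto simp del: sum.lessThan_Suc intro!: span_sum span_scale intro: span_base)
  qed
qed simp

text \<open>Greedy completion: as long as fewer than \<open>k\<close> rows are chosen, some
  coefficient vector is killed by all of them, and a row of \<open>X\<close> that does not kill it
  is independent of them. Prescribing \<open>l\<close> rows is what later forces all rows of
  \<open>J\<close> into the selection.\<close>

lemma select_minor:
  fixes w :: "nat \<Rightarrow> real ^ 's::finite"
  assumes indep: "\<And>x. (\<And>s. s \<in> X \<Longrightarrow> (\<Sum>c<k. x c * w c $ s) = 0) \<Longrightarrow> \<forall>c<k. x c = 0"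
    and f0: "\<And>a. a < l \<Longrightarrow> f0 a \<in> X" and l: "l \<le> k"
    and rows: "\<And>y. (\<And>c. c < k \<Longrightarrow> (\<Sum>a<l. y a * w c $ f0 a) = 0) \<Longrightarrow> \<forall>a<l. y a = 0"
  shows "\<exists>f. (\<forall>a<k. f a \<in> X) \<and> (\<forall>a<l. f a = f0 a) \<and> dt k (\<lambda>a c. w c $ f a) \<noteq> 0"
  using l f0 rows
proof (induction l arbitrary: f0 rule: inc_induct)
  case base
  have "dt k (\<lambda>a c. w c $ f0 a) \<noteq> 0"
    unfolding dt_eq_0_iff_row using base(2) by blast
  with base(1) show ?case by blast
next
  case (step l)
  obtain x where x: "\<exists>i<k. x i \<noteq> 0" "\<forall>a<l. (\<Sum>i<k. w i $ f0 a * x i) = 0"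
    using underdetermined_kernel[OF step.hyps(2), of "\<lambda>a i. w i $ f0 a"] by blast
  then obtain s where s: "s \<in> X" "(\<Sum>c<k. x c * w c $ s) \<noteq> 0"
    using indep[of x] by blast
  define f1 where "f1 = f0(l := s)"
  have rows1: "\<forall>a<Suc l. y a = 0" if y: "\<And>c. c < k \<Longrightarrow> (\<Sum>a<Suc l. y a * w c $ f1 a) = 0" for y
  proof -
    have split: "(\<Sum>a<Suc l. y a * w c $ f1 a) = (\<Sum>a<l. y a * w c $ f0 a) + y l * w c $ s" for c
      by (auto simp: f1_def intro!: sum.cong)
    \<comment> \<open>Pairing a relation among the rows with the kernel vector \<open>x\<close>
      removes the old rows and leaves the coefficient of the new one.\<close>
    have "0 = (\<Sum>c<k. x c * (\<Sum>a<Suc l. y a * w c $ f1 a))"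
      using y by simp
    also have "\<dots> = (\<Sum>c<k. \<Sum>a<l. x c * (y a * w c $ f0 a)) + (\<Sum>c<k. x c * (y l * w c $ s))"
      unfolding split by (simp add: distrib_left sum.distrib sum_distrib_left)
    also have "(\<Sum>c<k. \<Sum>a<l. x c * (y a * w c $ f0 a)) = (\<Sum>a<l. y a * (\<Sum>c<k. w c $ f0 a * x c))"
      by (subst sum.swap) (simp add: sum_distrib_left mult_ac)
    also have "\<dots> = 0"
      using x(2) by simp
    also have "(\<Sum>c<k. x c * (y l * w c $ s)) = y l * (\<Sum>c<k. x c * w c $ s)"
      by (simp add: sum_distrib_left mult_ac)
    finally have yl: "y l = 0"
      using s(2) by simp
    then have "\<forall>a<l. y a = 0"
      using y unfolding split by (intro step.prems(2)) simp
    with yl show ?thesis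
      by (simp add: less_Suc_eq)
  qed
  obtain f where "\<forall>a<k. f a \<in> X" "\<forall>a<Suc l. f a = f1 a" "dt k (\<lambda>a c. w c $ f a) \<noteq> 0"
  proof -
    have "f1 a \<in> X" if "a < Suc l" for a
      using that step.prems(1) s(1) by (auto simp: f1_def less_Suc_eq)
    then have "\<exists>f. (\<forall>a<k. f a \<in> X) \<and> (\<forall>a<Suc l. f a = f1 a) \<and> dt k (\<lambda>a c. w c $ f a) \<noteq> 0"
      using rows1 by (rule step.IH)
    with that show thesis by blast
  qed
  then show ?case
    by (intro exI[of _ f]) (auto simp: f1_def)
qed

section \<open>Coordinate subspaces and transversality of graphs\<close>

definition coord_space :: "'s set \<Rightarrow> (real ^ 's::finite) set" where
  "coord_space X = {v. \<forall>s. s \<notin> X \<longrightarrow> v $ s = 0}"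

lemma subspace_coord_space: "subspace (coord_space X)"
  by (auto simp: subspace_def coord_space_def)

lemma dim_coord_space: "dim (coord_space X :: (real ^ 's::finite) set) = card X"
proof -
  have "dim (coord_space X :: (real ^ 's) set) = vec.dim (coord_space X :: (real ^ 's) set)"
    by (simp add: dim_vec_eq)
  then show ?thesis
    by (simp add: coord_space_def dim_substandard_cart)
qed

definition nonplanar_set :: "(real ^ 'n::finite ^ 'm::finite) set \<Rightarrow> bool" where
  "nonplanar_set Ys \<longleftrightarrow>
    (\<forall>A B. rank (augmented A B) = CARD('n) \<longrightarrow> (\<exists>Y\<in>Ys. det (A ** Y + B) \<noteq> 0))"

text \<open>The rows of \<open>augmented A B\<close> are taken to be a basis of \<open>T\<close>. A
  vector whose \<open>Inl\<close> coordinates vanish after \<open>block_act\<close> has the form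
  \<open>(Y q, q)\<close>, and orthogonality to \<open>T\<close> then reads
  \<open>(A Y + B) q = 0\<close>. Thus the graph of \<open>Y\<close> meets the m-dimensional
  orthogonal complement of \<open>T\<close> only in 0.\<close>

lemma nonplanar_subspace:
  fixes Ys :: "(real ^ 'n::finite ^ 'm::finite) set" and T :: "(real ^ ('m + 'n)) set"
  assumes np: "nonplanar_set Ys"
    and T: "subspace T" "dim T = CARD('n)"
  shows "\<exists>Y\<in>Ys. \<forall>v. (\<forall>y\<in>T. y \<bullet> v = 0) \<and> (\<forall>j. block_act Y v $ Inl j = 0) \<longrightarrow> v = 0"
proof -
  obtain C where C: "C \<subseteq> T" "independent C" "T \<subseteq> span C" "card C = CARD('n)"
    using basis_exists[of T] T(2) by metis
  have "finite C"
    using C(2) by (rule independent_imp_finite)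
  then obtain e :: "'n \<Rightarrow> real ^ ('m + 'n)" where e: "bij_betw e UNIV C"
    using C(4) by (metis bij_betw_iff_card finite_class.finite_UNIV)
  define A :: "real ^ 'm ^ 'n" where "A = (\<chi> i j. e i $ Inl j)"
  define B :: "real ^ 'n ^ 'n" where "B = (\<chi> i l. e i $ Inr l)"
  have aug: "augmented A B = (\<chi> i. e i)"
    unfolding augmented_def A_def B_def vec_eq_iff vec_lambda_beta
    by (intro allI) (simp split: sum.split)
  have "rows (augmented A B) = C"
    using bij_betw_imp_surj_on[OF e] by (auto simp: rows_def row_def aug image_def vec_nth_inverse)
  then have "rank (augmented A B) = CARD('n)"
    using C(2,4) by (simp add: row_rank_def dim_eq_card_independent)
  then obtain Y where Y: "Y \<in> Ys" "det (A ** Y + B) \<noteq> 0"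
    using np unfolding nonplanar_set_def by blast
  have "v = 0" if v: "\<forall>y\<in>T. y \<bullet> v = 0" "\<forall>j. block_act Y v $ Inl j = 0" for v
  proof -
    define q :: "real ^ 'n" where "q = (\<chi> i. v $ Inr i)"
    define p :: "real ^ 'm" where "p = (\<chi> j. v $ Inl j)"
    have p: "Y *v q = p"
      using v(2) by (simp add: vec_eq_iff matrix_vector_mult_def p_def q_def block_act_Inl)
    have "((A ** Y + B) *v q) $ i = 0" for i
    proof -
      have "((A ** Y + B) *v q) $ i = (A *v p) $ i + (B *v q) $ i"
        by (simp add: matrix_vector_mult_add_rdistrib matrix_vector_mul_assoc[symmetric] p)
      also have "\<dots> = e i \<bullet> v"
        by (simp add: matrix_vector_mult_def A_def B_def p_def q_def inner_vec_def sum_UNIV_sum)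
      also have "\<dots> = 0"
        using v(1) C(1) bij_betwE[OF e] by blast
      finally show ?thesis .
    qed
    then have "(A ** Y + B) *v q = 0"
      by (simp add: vec_eq_iff)
    then have "q = 0"
      using Y(2) by (metis invertible_det_nz invertible_def matrix_left_invertible_ker)
    moreover from this have "p = 0"
      using p by simp
    ultimately show "v = 0"
      by (auto simp: vec_eq_iff p_def q_def) (metis sum.exhaust)
  qed
  with Y(1) show ?thesis by blast
qed

text \<open>\<open>J\<close> will be the set of the rows of positive weight; the other rows impose no condition and must be
  dropped, since the flow cannot make the corresponding coordinates small. The two alternatives for \<open>f\<close> ensure that
  the flow does not contract the chosen Pluecker coordinate.\<close>

lemma nonplanar_minor:
  fixes Ys :: "(real ^ 'n::finite ^ 'm::finite) set" and w :: "nat \<Rightarrow> real ^ ('m + 'n)"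
    and J :: "'m set"
  defines "X \<equiv> Inl ` J \<union> range Inr"
  assumes np: "nonplanar_set Ys"
    and w: "lin_indep k w" and wX: "\<And>c. c < k \<Longrightarrow> w c \<in> coord_space X"
  shows "\<exists>Y\<in>Ys. \<exists>f. (\<forall>a<k. f a \<in> X) \<and> (f ` {..<k} \<subseteq> Inl ` J \<or> Inl ` J \<subseteq> f ` {..<k}) \<and>
           dt k (\<lambda>a c. block_act Y (w c) $ f a) \<noteq> 0"
proof -
  define V where "V = span (w ` {..<k})"
  \<comment> \<open>The coordinate space of the dropped rows is adjoined to \<open>V\<close>. Since
    \<open>block_act\<close> is minus the identity on \<open>E\<close>, a statement about all upper
    rows on \<open>Vp\<close> becomes one about the rows of \<open>J\<close> on
    \<open>V\<close>.\<close>
  define E :: "(real ^ ('m + 'n)) set" where "E = coord_space (Inl ` (- J))"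
  define Vp where "Vp = {x + y | x y. x \<in> V \<and> y \<in> E}"
  have subs: "subspace V" "subspace E"
    by (simp_all add: V_def E_def subspace_coord_space)
  then have Vp: "subspace Vp"
    unfolding Vp_def by (rule subspace_sums)
  have V_X: "V \<subseteq> coord_space X"
    unfolding V_def using wX by (intro span_minimal subspace_coord_space) auto
  have VE: "v = 0" if "v \<in> V" "v \<in> E" for v
  proof -
    have "v $ s = 0" for s
    proof (cases "s \<in> Inl ` (- J)")
      case True
      then have "s \<notin> X"
        by (auto simp: X_def)
      then show ?thesis
        using that(1) V_X by (auto simp: coord_space_def)
    next
      case False
      then show ?thesis
        using that(2) by (auto simp: E_def coord_space_def)
    qed
    then show ?thesis by (simp add: vec_eq_iff)
  qed
  have J: "card J \<le> CARD('m)"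
    by (simp add: card_mono)
  have "dim Vp + dim (V \<inter> E) = dim V + dim E"
    unfolding Vp_def using subs by (rule dim_sums_Int)
  moreover have "dim (V \<inter> E) = 0"
    using VE by (auto simp: dim_eq_0)
  moreover have "dim V = k"
    unfolding V_def using w by (rule dim_span_lin_indep)
  moreover have "dim E = CARD('m) - card J"
    by (simp add: E_def dim_coord_space card_image Compl_eq_Diff_UNIV card_Diff_subset)
  ultimately have dimVp: "dim Vp = k + (CARD('m) - card J)"
    by simp
  have act_E: "block_act Y e = - e" if "e \<in> E" for Y and e
  proof -
    have "e $ Inr i = 0" for i
      using that by (auto simp: E_def coord_space_def)
    then have "block_act Y e $ s = (- e) $ s" for s
      by (cases s) (simp_all add: block_act_Inl block_act_Inr)
    then show ?thesis
      by (simp add: vec_eq_iff)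
  qed
  have comb: "(\<Sum>c<k. x c * block_act Y (w c) $ s) = block_act Y (\<Sum>c<k. x c *\<^sub>R w c) $ s" for x Y s
    by (simp add: linear_sum[OF linear_block_act] linear_cmul[OF linear_block_act])
  have combV: "(\<Sum>c<k. x c *\<^sub>R w c) \<in> V" for x
    unfolding V_def by (intro span_sum span_scale) (auto intro: span_base)
  have zero: "\<forall>c<k. x c = 0" if "(\<Sum>c<k. x c *\<^sub>R w c) = 0" for x
    using w that unfolding lin_indep_def by blast
  show ?thesis
  proof (cases "k \<le> card J")
    case True
    \<comment> \<open>Here \<open>Vp\<close> has dimension at most m, so an n-dimensional
      \<open>T\<close> can be chosen orthogonal to it; the upper coordinates are then injective on
      \<open>Vp\<close>.\<close>
    have "dim {y \<in> UNIV. \<forall>x\<in>Vp. orthogonal x y} + dim Vp = CARD('m) + CARD('n)"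
      using dim_subspace_orthogonal_to_vectors[OF Vp subspace_UNIV] by simp
    then have "CARD('n) \<le> dim {y. \<forall>x\<in>Vp. orthogonal x y}"
      using True J dimVp by simp
    then obtain T where T: "subspace T" "T \<subseteq> span {y. \<forall>x\<in>Vp. orthogonal x y}" "dim T = CARD('n)"
      by (rule choose_subspace_of_subspace)
    have T_orth: "T \<subseteq> {y. \<forall>x\<in>Vp. orthogonal x y}"
      using T(2) span_eq_iff[of "{y. \<forall>x\<in>Vp. orthogonal x y}"] subspace_orthogonal_to_vectors by blast
    obtain Y where Y: "Y \<in> Ys"
        and inj: "\<And>v. (\<forall>y\<in>T. y \<bullet> v = 0) \<Longrightarrow> (\<forall>j. block_act Y v $ Inl j = 0) \<Longrightarrow> v = 0"
      using nonplanar_subspace[OF np T(1,3)] by metis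
    have indep: "\<forall>c<k. x c = 0"
      if x: "\<And>s. s \<in> Inl ` J \<Longrightarrow> (\<Sum>c<k. x c * block_act Y (w c) $ s) = 0" for x
    proof -
      define v where "v = (\<Sum>c<k. x c *\<^sub>R w c)"
      \<comment> \<open>The upper coordinates outside \<open>J\<close> that may survive are
        cancelled by a vector of \<open>E\<close>; injectivity on \<open>Vp\<close> applies to the
        corrected vector.\<close>
      define e :: "real ^ ('m + 'n)" where
        "e = (\<chi> s. case s of Inl j \<Rightarrow> if j \<in> J then 0 else block_act Y v $ Inl j | Inr _ \<Rightarrow> 0)"
      have e: "e \<in> E"
        by (auto simp: E_def coord_space_def e_def split: sum.split)
      have vV: "v \<in> V"
        unfolding v_def by (rule combV)
      have "block_act Y (v + e) $ Inl j = 0" for j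
      proof -
        have "block_act Y (v + e) $ Inl j = block_act Y v $ Inl j - e $ Inl j"
          by (simp add: linear_add[OF linear_block_act] act_E[OF e])
        then show ?thesis
          using x[of "Inl j"] by (auto simp: e_def v_def comb)
      qed
      moreover have "v + e \<in> Vp"
        unfolding Vp_def using vV e by blast
      then have "\<forall>y\<in>T. y \<bullet> (v + e) = 0"
        using T_orth by (force simp: orthogonal_def inner_commute)
      ultimately have "v + e = 0"
        using inj by blast
      then have "v = - e"
        by (simp add: eq_neg_iff_add_eq_0)
      then have "v = 0"
        using VE[OF vV] e subspace_neg[OF subs(2) e] by simp
      then show ?thesis
        using zero by (simp add: v_def)
    qed
    obtain f where "\<forall>a<k. f a \<in> Inl ` J" "dt k (\<lambda>a c. block_act Y (w c) $ f a) \<noteq> 0"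
      using select_minor[where X = "Inl ` J" and k = k and w = "\<lambda>c. block_act Y (w c)" and l = 0] indep by auto
    then show ?thesis
      using Y by (intro bexI[of _ Y] exI[of _ f]) (auto simp: X_def)
  next
    case False
    \<comment> \<open>The upper coordinates are injective, hence onto, on an m-dimensional subspace
      \<open>W\<close> of \<open>Vp\<close>; this makes the rows of \<open>J\<close> independent on
      \<open>V\<close>, and all of them are put into the selection.\<close>
    then have "CARD('m) \<le> dim Vp"
      using J dimVp by simp
    then obtain W where W: "subspace W" "W \<subseteq> span Vp" "dim W = CARD('m)"
      by (rule choose_subspace_of_subspace)
    have WVp: "W \<subseteq> Vp"
      using W(2) Vp by (metis span_eq_iff)
    define T where "T = {y \<in> UNIV. \<forall>x\<in>W. orthogonal x y}"
    have "dim T + dim W = CARD('m) + CARD('n)"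
      unfolding T_def using dim_subspace_orthogonal_to_vectors[OF W(1) subspace_UNIV] by simp
    then have T: "subspace T" "dim T = CARD('n)"
      using W(3) subspace_orthogonal_to_vectors[of W] by (simp_all add: T_def)
    obtain Y where Y: "Y \<in> Ys"
        and inj: "\<And>v. (\<forall>y\<in>T. y \<bullet> v = 0) \<Longrightarrow> (\<forall>j. block_act Y v $ Inl j = 0) \<Longrightarrow> v = 0"
      using nonplanar_subspace[OF np T] by metis
    have injW: "v = 0" if "v \<in> W" "\<forall>j. block_act Y v $ Inl j = 0" for v
      using that by (intro inj) (auto simp: T_def orthogonal_def inner_commute)
    define tp :: "real ^ ('m + 'n) \<Rightarrow> real ^ 'm" where "tp v = (\<chi> j. block_act Y v $ Inl j)" for v
    have lin_tp: "linear tp"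
      by (rule linearI)
        (simp_all add: tp_def vec_eq_iff linear_add[OF linear_block_act] linear_cmul[OF linear_block_act])
    have "inj_on tp W"
      using injW by (subst linear_inj_on_iff_eq_0[OF lin_tp W(1)]) (auto simp: tp_def vec_eq_iff)
    then have "dim (tp ` W) = CARD('m)"
      using dim_image_eq[OF lin_tp, of W] W(1,3) by (metis span_eq_iff)
    moreover have "subspace (tp ` W)"
      using lin_tp W(1) by (rule linear_subspace_image)
    ultimately have surj: "tp ` W = UNIV"
      by (metis dim_eq_full DIM_cart DIM_real mult.right_neutral span_eq_iff)
    obtain g where g: "bij_betw g {..<card J} J"
      using ex_bij_betw_nat_finite[of J] by (auto simp: lessThan_atLeast0)
    have rows: "\<forall>a<card J. y a = 0"
      if y: "\<And>c. c < k \<Longrightarrow> (\<Sum>a<card J. y a * block_act Y (w c) $ Inl (g a)) = 0" for y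
    proof (intro allI impI)
      fix a0 assume a0: "a0 < card J"
      \<comment> \<open>A relation among the rows of \<open>J\<close> on \<open>V\<close> also
        vanishes on \<open>E\<close>, hence on \<open>W\<close>, where the upper coordinates take
        every value, unit vectors included.\<close>
      define \<phi> where "\<phi> v = (\<Sum>a<card J. y a * block_act Y v $ Inl (g a))" for v
      have lin: "linear \<phi>"
        by (rule linearI)
          (simp_all add: \<phi>_def linear_add[OF linear_block_act] linear_cmul[OF linear_block_act]
            algebra_simps sum.distrib sum_distrib_left)
      have \<phi>V: "\<phi> v = 0" if "v \<in> V" for v
        using that y linear_eq_0_on_span[OF lin, of "w ` {..<k}"] unfolding V_def by (auto simp: \<phi>_def)
      have \<phi>E: "\<phi> e = 0" if e: "e \<in> E" for e
      proof -
        have "e $ Inl (g a) = 0" if "a < card J" for a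
          using that bij_betwE[OF g] e by (auto simp: E_def coord_space_def)
        then show ?thesis
          by (simp add: \<phi>_def act_E[OF e])
      qed
      obtain v where v: "v \<in> W" "tp v = axis (g a0) 1"
        using surj by (metis UNIV_I imageE)
      obtain v1 e where "v = v1 + e" "v1 \<in> V" "e \<in> E"
        using v(1) WVp by (auto simp: Vp_def)
      then have "0 = \<phi> v"
        using \<phi>V \<phi>E by (simp add: linear_add[OF lin])
      also have "\<phi> v = (\<Sum>a<card J. y a * tp v $ g a)"
        by (simp add: \<phi>_def tp_def)
      also have "\<dots> = (\<Sum>a<card J. if a = a0 then y a0 else 0)"
        using bij_betw_imp_inj_on[OF g] a0 by (intro sum.cong) (auto simp: v(2) axis_def inj_on_def)
      also have "\<dots> = y a0"
        using a0 by simp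
      finally show "y a0 = 0" by simp
    qed
    have indep: "\<forall>c<k. x c = 0"
      if x: "\<And>s. s \<in> X \<Longrightarrow> (\<Sum>c<k. x c * block_act Y (w c) $ s) = 0" for x
    proof -
      define v where "v = (\<Sum>c<k. x c *\<^sub>R w c)"
      have vX: "v \<in> coord_space X"
        using combV V_X by (auto simp: v_def)
      have act0: "block_act Y v $ s = 0" if "s \<in> X" for s
        using x[OF that] by (simp add: comb v_def)
      have r: "v $ Inr i = 0" for i
        using act0[of "Inr i"] by (simp add: X_def block_act_Inr)
      have "v $ s = 0" for s
        using act0[of s] r vX by (cases s) (auto simp: X_def block_act_Inl coord_space_def)
      then have "v = 0"
        by (simp add: vec_eq_iff)
      then show ?thesis
        using zero by (simp add: v_def)
    qed
    have "\<exists>f. (\<forall>a<k. f a \<in> X) \<and> (\<forall>a<card J. f a = Inl (g a)) \<and> dt k (\<lambda>a c. block_act Y (w c) $ f a) \<noteq> 0"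
    proof (rule select_minor)
      show "Inl (g a) \<in> X" if "a < card J" for a
        using that bij_betwE[OF g] by (auto simp: X_def)
    qed (use indep rows False in auto)
    then obtain f where f: "\<forall>a<k. f a \<in> X" "\<forall>a<card J. f a = Inl (g a)"
        "dt k (\<lambda>a c. block_act Y (w c) $ f a) \<noteq> 0"
      by blast
    have "Inl ` J \<subseteq> f ` {..<k}"
    proof
      fix s :: "'m + 'n" assume "s \<in> Inl ` J"
      then obtain a where "a < card J" "s = Inl (g a)"
        using bij_betw_imp_surj_on[OF g] by auto
      then show "s \<in> f ` {..<k}"
        using f(2) False by (intro image_eqI[of _ _ a]) auto
    qed
    with f Y show ?thesis by blast
  qed
qed


section \<open>Compactness and uniform growth at time zero\<close>

lemma common_convergent_subsequence:
  fixes u :: "nat \<Rightarrow> nat \<Rightarrow> 'a::euclidean_space"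
  assumes "\<And>n c. c < k \<Longrightarrow> norm (u n c) \<le> b"
  shows "\<exists>\<rho> l. strict_mono (\<rho> :: nat \<Rightarrow> nat) \<and> (\<forall>c<k. (\<lambda>n. u (\<rho> n) c) \<longlonglongrightarrow> l c)"
  using assms
proof (induction k)
  case 0
  then show ?case by (auto intro!: exI[of _ id] simp: strict_mono_id)
next
  case (Suc k)
  then obtain \<rho> l where \<rho>: "strict_mono \<rho>" "\<And>c. c < k \<Longrightarrow> (\<lambda>n. u (\<rho> n) c) \<longlonglongrightarrow> l c"
    by (metis less_SucI)
  have "bounded (range (\<lambda>n. u (\<rho> n) k))"
    using Suc.prems by (intro boundedI[of _ b]) auto
  then obtain \<sigma> l' where \<sigma>: "strict_mono \<sigma>" "((\<lambda>n. u (\<rho> n) k) \<circ> \<sigma>) \<longlonglongrightarrow> l'"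
    using bounded_imp_convergent_subsequence by blast
  have "(\<lambda>n. u ((\<rho> \<circ> \<sigma>) n) c) \<longlonglongrightarrow> (l(k := l')) c" if "c < Suc k" for c
    using that \<sigma>(2) LIMSEQ_subseq_LIMSEQ[OF \<rho>(2)[of c] \<sigma>(1)]
    by (cases "c = k") (auto simp: comp_def)
  moreover have "strict_mono (\<rho> \<circ> \<sigma>)"
    using \<rho>(1) \<sigma>(1) by (rule strict_mono_o)
  ultimately show ?case by blast
qed

lemma tendsto_dt:
  assumes "\<And>a c. a < k \<Longrightarrow> c < k \<Longrightarrow> (\<lambda>n. M n a c) \<longlonglongrightarrow> L a c"
  shows "(\<lambda>n. dt k (M n)) \<longlonglongrightarrow> dt k L"
  unfolding dt_def
proof (intro tendsto_sum tendsto_mult tendsto_prod tendsto_const assms)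
  fix \<pi> a assume *: "\<pi> \<in> {\<pi>. \<pi> permutes {..<k}}" "a \<in> {..<k}"
  then show "\<pi> a < k"
    using permutes_in_image[of \<pi> "{..<k}" a] by simp
qed simp

definition admissible :: "'m set \<Rightarrow> nat \<Rightarrow> (nat \<Rightarrow> 'm + 'n) \<Rightarrow> bool" where
  "admissible J k f \<longleftrightarrow> (\<forall>a<k. f a \<in> Inl ` J \<union> range Inr) \<and>
    (f ` {..<k} \<subseteq> Inl ` J \<or> Inl ` J \<subseteq> f ` {..<k})"

definition grows :: "(real ^ 'n ^ 'm) set \<Rightarrow> 'm::finite set \<Rightarrow> nat \<Rightarrow> real \<Rightarrow>
    (nat \<Rightarrow> real ^ ('m + 'n::finite)) \<Rightarrow> bool" where
  "grows Ys J k \<kappa> w \<longleftrightarrow>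
    (\<exists>Y\<in>Ys. \<exists>f. admissible J k f \<and> \<kappa> \<le> \<bar>dt k (\<lambda>a c. block_act Y (w c) $ f a)\<bar>)"

text \<open>A compact set of families: the rows \<open>f0\<close> form the identity, so that limits
  stay independent, and the bound on the entries can be achieved when \<open>f0\<close> selects a
  minor of maximal modulus.\<close>

definition normalised :: "'s::finite set \<Rightarrow> nat \<Rightarrow> (nat \<Rightarrow> 's) \<Rightarrow> (nat \<Rightarrow> real ^ 's) \<Rightarrow> bool" where
  "normalised X k f0 W \<longleftrightarrow> (\<forall>c<k. W c \<in> coord_space X) \<and> (\<forall>c<k. \<forall>s. \<bar>W c $ s\<bar> \<le> 1) \<and>
    (\<forall>a<k. \<forall>c<k. W c $ f0 a = (if a = c then 1 else 0))"

lemma dt_basis_change: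
  assumes L: "linear L" and W: "\<And>c. c < k \<Longrightarrow> W c = (\<Sum>d<k. T d c *\<^sub>R w d)"
  shows "dt k (\<lambda>a c. L (W c) $ f a) = dt k (\<lambda>a c. L (w c) $ f a) * dt k T"
  unfolding dt_mult[symmetric]
  by (intro dt_cong) (simp add: W linear_sum[OF L] linear_cmul[OF L] mult.commute)

text \<open>Otherwise normalised families with growth tending to 0 would converge to an independent
  family all of whose admissible coordinates vanish for every matrix in \<open>Ys\<close>, against
  \<open>nonplanar_minor\<close>. At the limit a single \<open>Y\<close> and \<open>f\<close> are
  fixed, so no limit is taken in \<open>Ys\<close>.\<close>

lemma growth_normalised:
  fixes Ys :: "(real ^ 'n::finite ^ 'm::finite) set" and f0 :: "nat \<Rightarrow> 'm + 'n"
  assumes np: "nonplanar_set Ys"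
  shows "\<exists>\<kappa>>0. \<forall>W. normalised (Inl ` J \<union> range Inr) k f0 W \<longrightarrow> grows Ys J k \<kappa> W"
proof (rule ccontr)
  let ?X = "Inl ` J \<union> range Inr :: ('m + 'n) set"
  assume neg: "\<not> ?thesis"
  have "\<exists>W. normalised ?X k f0 W \<and> \<not> grows Ys J k (1 / real (Suc n)) W" for n
  proof -
    have "(0::real) < 1 / real (Suc n)"
      by simp
    with neg show ?thesis by blast
  qed
  then obtain W where norm_W: "\<And>n. normalised ?X k f0 (W n)"
      and small: "\<And>n. \<not> grows Ys J k (1 / real (Suc n)) (W n)"
    by metis
  have W: "\<And>n c. c < k \<Longrightarrow> W n c \<in> coord_space ?X"
      "\<And>n c s. c < k \<Longrightarrow> \<bar>W n c $ s\<bar> \<le> 1"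
      "\<And>n a c. a < k \<Longrightarrow> c < k \<Longrightarrow> W n c $ f0 a = (if a = c then 1 else 0)"
    using norm_W unfolding normalised_def by blast+
  have W4: "\<bar>dt k (\<lambda>a c. block_act Y (W n c) $ f a)\<bar> < 1 / real (Suc n)"
    if "Y \<in> Ys" "admissible J k f" for n Y f
    using small[of n] that unfolding grows_def not_le[symmetric] by blast
  have "norm (W n c) \<le> real CARD('m + 'n)" if "c < k" for n c
  proof -
    have "norm (W n c) \<le> (\<Sum>s\<in>UNIV. \<bar>W n c $ s\<bar>)"
      by (rule norm_le_l1_cart)
    also have "\<dots> \<le> (\<Sum>s\<in>(UNIV :: ('m + 'n) set). 1)"
      using W(2)[OF that] by (intro sum_mono) auto
    finally show ?thesis by simp
  qed
  then have "\<exists>\<rho> l. strict_mono (\<rho> :: nat \<Rightarrow> nat) \<and> (\<forall>c<k. (\<lambda>n. W (\<rho> n) c) \<longlonglongrightarrow> l c)"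
    by (rule common_convergent_subsequence)
  then obtain \<rho> l where \<rho>: "strict_mono (\<rho> :: nat \<Rightarrow> nat)"
      and l: "\<And>c. c < k \<Longrightarrow> (\<lambda>n. W (\<rho> n) c) \<longlonglongrightarrow> l c"
    by blast
  have l_nth: "(\<lambda>n. W (\<rho> n) c $ s) \<longlonglongrightarrow> l c $ s" if "c < k" for c s
    using l[OF that] by (rule tendsto_vec_nth)
  have lX: "l c \<in> coord_space ?X" if c: "c < k" for c
    unfolding coord_space_def
  proof (intro CollectI allI impI)
    fix s assume "s \<notin> ?X"
    then have "W (\<rho> n) c $ s = 0" for n
      using W(1)[OF c] by (auto simp: coord_space_def)
    then show "l c $ s = 0"
      using l_nth[OF c, of s] LIMSEQ_unique[OF _ tendsto_const] by fastforce
  qed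
  have lI: "l c $ f0 a = (if a = c then 1 else 0)" if "a < k" "c < k" for a c
    using l_nth[OF that(2), of "f0 a"] W(3)[OF that] LIMSEQ_unique[OF _ tendsto_const] by fastforce
  have "lin_indep k l"
    unfolding lin_indep_def
  proof (intro allI impI)
    fix x a assume eq: "(\<Sum>c<k. x c *\<^sub>R l c) = 0" and a: "a < k"
    have "0 = (\<Sum>c<k. x c *\<^sub>R l c) $ f0 a"
      by (simp add: eq)
    also have "\<dots> = (\<Sum>c<k. x c * (if a = c then 1 else 0))"
      using a by (simp add: lI)
    also have "\<dots> = x a"
      using a by (simp add: if_distrib[where f = "(*) _"] cong: if_cong)
    finally show "x a = 0"
      using a by simp
  qed
  from nonplanar_minor[OF np this lX] obtain Y f where Y: "Y \<in> Ys" and f: "admissible J k f"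
      "dt k (\<lambda>a c. block_act Y (l c) $ f a) \<noteq> 0"
    unfolding admissible_def by blast
  have "(\<lambda>n. dt k (\<lambda>a c. block_act Y (W (\<rho> n) c) $ f a)) \<longlonglongrightarrow> dt k (\<lambda>a c. block_act Y (l c) $ f a)"
    unfolding block_act_def vec_lambda_beta by (intro tendsto_dt tendsto_sum tendsto_mult tendsto_const l_nth)
  moreover have "(\<lambda>n. dt k (\<lambda>a c. block_act Y (W (\<rho> n) c) $ f a)) \<longlonglongrightarrow> 0"
  proof (rule Lim_null_comparison)
    show "\<forall>\<^sub>F n in sequentially. norm (dt k (\<lambda>a c. block_act Y (W (\<rho> n) c) $ f a)) \<le> 1 / real (Suc (\<rho> n))"
      using W4[OF Y f(1)] by (simp add: less_imp_le)
    show "(\<lambda>n. 1 / real (Suc (\<rho> n))) \<longlonglongrightarrow> 0"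
      using LIMSEQ_subseq_LIMSEQ[OF LIMSEQ_Suc[OF lim_inverse_n'] \<rho>] by (simp add: comp_def)
  qed
  ultimately show False
    using f(2) LIMSEQ_unique by blast
qed

text \<open>Dividing by the submatrix of a minor \<open>f0\<close> of maximal modulus normalises the
  family: by Cramer's rule the new entries are quotients of minors. Since the maximal minor is at
  least 1 in modulus, undoing the division does not diminish the admissible coordinates.\<close>

lemma growth_uniform:
  fixes Ys :: "(real ^ 'n::finite ^ 'm::finite) set"
  assumes np: "nonplanar_set Ys"
  shows "\<exists>\<kappa>>0. \<forall>w. (\<forall>c<k. w c \<in> coord_space (Inl ` J \<union> range Inr)) \<longrightarrow>
      (\<exists>f\<in>{..<k} \<rightarrow>\<^sub>E Inl ` J \<union> range Inr. 1 \<le> \<bar>dt k (\<lambda>a c. w c $ f a)\<bar>) \<longrightarrow>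
      grows Ys J k \<kappa> w"
proof -
  let ?X = "Inl ` J \<union> range Inr :: ('m + 'n) set"
  let ?F = "{..<k} \<rightarrow>\<^sub>E ?X"
  have finF: "finite ?F"
    by (intro finite_PiE) auto
  have "\<exists>\<kappa>>0. \<forall>W. normalised ?X k f0 W \<longrightarrow> grows Ys J k \<kappa> W" for f0
    using np by (rule growth_normalised)
  then obtain \<kappa>0 where \<kappa>0: "\<And>f0. 0 < \<kappa>0 f0"
      and growth: "\<And>f0 W. normalised ?X k f0 W \<Longrightarrow> grows Ys J k (\<kappa>0 f0) W"
    by metis
  define \<kappa> where "\<kappa> = Min (insert 1 (\<kappa>0 ` ?F))"
  have \<kappa>: "0 < \<kappa>" "\<And>f0. f0 \<in> ?F \<Longrightarrow> \<kappa> \<le> \<kappa>0 f0"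
    using finF \<kappa>0 by (auto simp: \<kappa>_def)
  have "grows Ys J k \<kappa> w"
    if wX: "\<forall>c<k. w c \<in> coord_space ?X" and ex: "\<exists>f\<in>?F. 1 \<le> \<bar>dt k (\<lambda>a c. w c $ f a)\<bar>" for w
  proof -
    let ?g = "\<lambda>f. \<bar>dt k (\<lambda>a c. w c $ f a)\<bar>"
    have "Max (?g ` ?F) \<in> ?g ` ?F"
      using finF ex by (intro Max_in) auto
    then obtain f0 where f0: "f0 \<in> ?F" "?g f0 = Max (?g ` ?F)"
      by force
    have max: "?g f \<le> ?g f0" if "f \<in> ?F" for f
      using finF that by (simp add: f0(2))
    have ge1: "1 \<le> ?g f0"
    proof -
      obtain f where "f \<in> ?F" "1 \<le> ?g f"
        using ex by blast
      with max[of f] show ?thesis by linarith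
    qed
    then have "dt k (\<lambda>a c. w c $ f0 a) \<noteq> 0"
      by auto
    then obtain T where T: "\<And>a c. a < k \<Longrightarrow> c < k \<Longrightarrow> (\<Sum>d<k. w d $ f0 a * T d c) = (if a = c then 1 else 0)"
        "dt k (\<lambda>a c. w c $ f0 a) * dt k T = 1"
      by (rule dt_inverse) blast
    define W where "W c = (\<Sum>d<k. T d c *\<^sub>R w d)" for c
    have dtT: "?g f0 * \<bar>dt k T\<bar> = 1"
      using T(2) by (metis abs_mult abs_one)
    have change: "dt k (\<lambda>a c. L (W c) $ f a) = dt k (\<lambda>a c. L (w c) $ f a) * dt k T" if "linear L"
      for L :: "real ^ ('m + 'n) \<Rightarrow> real ^ ('m + 'n)" and f
      by (rule dt_basis_change[OF that W_def])
    have WX: "\<forall>c<k. W c \<in> coord_space ?X"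
      using wX by (auto simp: W_def intro!: subspace_sum subspace_scale subspace_coord_space)
    have WI: "\<forall>a<k. \<forall>c<k. W c $ f0 a = (if a = c then 1 else 0)"
      using T(1) by (simp add: W_def mult.commute)
    have "\<bar>W c $ s\<bar> \<le> 1" if c: "c < k" for c s
    proof (cases "s \<in> ?X")
      case False
      then show ?thesis
        using WX c by (auto simp: coord_space_def)
    next
      case True
      have f1: "f0(c := s) \<in> ?F"
      proof (rule PiE_I)
        show "(f0(c := s)) a \<in> ?X" if "a \<in> {..<k}" for a
          using PiE_mem[OF f0(1) that] True by simp
        show "(f0(c := s)) a = undefined" if "a \<notin> {..<k}" for a
          using PiE_arb[OF f0(1) that] that c by auto
      qed
      \<comment> \<open>Exchanging row \<open>c\<close> of the identity for row \<open>s\<close> of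
        \<open>W\<close> gives a matrix of determinant \<open>W c $ s\<close>; its rows are the
        selection \<open>f0(c := s)\<close>, which cannot beat \<open>f0\<close>.\<close>
      have "W c $ s = dt k (\<lambda>a b. if a = c then W b $ s else if a = b then 1 else 0)"
        by (rule dt_identity_with_row[OF c, symmetric])
      also have "\<dots> = dt k (\<lambda>a b. W b $ (f0(c := s)) a)"
        using WI by (intro dt_cong) auto
      also have "\<dots> = dt k (\<lambda>a b. w b $ (f0(c := s)) a) * dt k T"
        using change[of "\<lambda>v. v" "f0(c := s)"] by (simp add: linear_id[unfolded id_def])
      finally have "\<bar>W c $ s\<bar> = ?g (f0(c := s)) * \<bar>dt k T\<bar>"
        by (simp add: abs_mult)
      also have "\<dots> \<le> ?g f0 * \<bar>dt k T\<bar>"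
        using max[OF f1] by (intro mult_right_mono) auto
      finally show ?thesis
        by (simp add: dtT)
    qed
    then obtain Y f where Y: "Y \<in> Ys" "admissible J k f"
        and ge: "\<kappa>0 f0 \<le> \<bar>dt k (\<lambda>a c. block_act Y (W c) $ f a)\<bar>"
      using growth[of f0 W] WX WI unfolding normalised_def grows_def by blast
    have "\<kappa> \<le> \<bar>dt k (\<lambda>a c. block_act Y (w c) $ f a)\<bar> * \<bar>dt k T\<bar>"
      using ge \<kappa>(2)[OF f0(1)] by (simp add: change[OF linear_block_act] abs_mult)
    also have "\<dots> \<le> \<bar>dt k (\<lambda>a c. block_act Y (w c) $ f a)\<bar> * 1"
    proof (intro mult_left_mono)
      have "1 * \<bar>dt k T\<bar> \<le> ?g f0 * \<bar>dt k T\<bar>"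
        using ge1 by (intro mult_right_mono) auto
      then show "\<bar>dt k T\<bar> \<le> 1"
        by (simp add: dtT)
    qed simp
    finally show ?thesis
      using Y unfolding grows_def by auto
  qed
  with \<kappa>(1) show ?thesis by blast
qed

section \<open>Covolumes of rational subspaces\<close>

text \<open>The diagonal flow applied to the lattice attached to \<open>Y\<close>, as in the Dani
  correspondence: good approximations become short vectors.\<close>

definition flow_act :: "real ^ ('m::finite + 'n::finite) \<Rightarrow> real \<Rightarrow> real ^ 'n ^ 'm \<Rightarrow>
    real ^ ('m + 'n) \<Rightarrow> real ^ ('m + 'n)" where
  "flow_act wt t Y v = (\<chi> s. exp (t * wt $ s) * block_act Y v $ s)"

lemma linear_flow_act: "linear (flow_act wt t Y)"
  by (rule linearI)
    (simp_all add: flow_act_def vec_eq_iff linear_add[OF linear_block_act] linear_cmul[OF linear_block_act]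
      algebra_simps)

lemma dt_scale_rows: "dt k (\<lambda>a c. r a * M a c) = (\<Prod>a<k. r a) * dt k M"
  unfolding dt_def sum_distrib_left by (intro sum.cong refl) (simp add: prod.distrib mult_ac)

lemma dt_flow_act:
  "dt k (\<lambda>a c. flow_act wt t Y (w c) $ f a)
    = exp (t * (\<Sum>a<k. wt $ f a)) * dt k (\<lambda>a c. block_act Y (w c) $ f a)"
  by (simp add: flow_act_def dt_scale_rows exp_sum[symmetric] sum_distrib_left)

text \<open>Selections with repetition contribute 0 and reorderings only a sign, so this is the
  supremum norm of the exterior product, restricted to the coordinates in \<open>X\<close>.\<close>

definition plucker_norm :: "'s set \<Rightarrow> nat \<Rightarrow> (nat \<Rightarrow> real ^ 's::finite) \<Rightarrow> real" where
  "plucker_norm X k u = Max ((\<lambda>f. \<bar>dt k (\<lambda>a c. u c $ f a)\<bar>) ` ({..<k} \<rightarrow>\<^sub>E X))"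

lemma finite_selections: "finite ({..<k::nat} \<rightarrow>\<^sub>E (X :: 's::finite set))"
  by (intro finite_PiE) auto

lemma plucker_norm_ge: "f \<in> {..<k} \<rightarrow>\<^sub>E X \<Longrightarrow> \<bar>dt k (\<lambda>a c. u c $ f a)\<bar> \<le> plucker_norm X k u"
  unfolding plucker_norm_def by (intro Max_ge) (auto simp: finite_selections)

lemma plucker_norm_attained:
  assumes "X \<noteq> {}"
  obtains f where "f \<in> {..<k} \<rightarrow>\<^sub>E X" "plucker_norm X k u = \<bar>dt k (\<lambda>a c. u c $ f a)\<bar>"
proof -
  have "plucker_norm X k u \<in> (\<lambda>f. \<bar>dt k (\<lambda>a c. u c $ f a)\<bar>) ` ({..<k} \<rightarrow>\<^sub>E X)"
    unfolding plucker_norm_def using assms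
    by (intro Max_in) (auto simp: finite_selections PiE_eq_empty_iff)
  with that show thesis by blast
qed

lemma plucker_norm_ge_dt:
  assumes "\<And>a. a < k \<Longrightarrow> f a \<in> X"
  shows "\<bar>dt k (\<lambda>a c. u c $ f a)\<bar> \<le> plucker_norm X k u"
proof -
  have "dt k (\<lambda>a c. u c $ f a) = dt k (\<lambda>a c. u c $ restrict f {..<k} a)"
    by (intro dt_cong) auto
  then show ?thesis
    using plucker_norm_ge[of "restrict f {..<k}" k X u] assms by auto
qed

lemma plucker_norm_0: "X \<noteq> {} \<Longrightarrow> plucker_norm X 0 u = 1"
  using plucker_norm_attained[of X 0 u] by auto

text \<open>Laplace expansion along the last vector. With \<open>B\<close> small it says that
  adjoining a short vector to a subspace makes the covolume small.\<close>

lemma plucker_norm_Suc_le: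
  assumes X: "X \<noteq> {}" and B: "\<And>s. s \<in> X \<Longrightarrow> \<bar>u k $ s\<bar> \<le> B"
  shows "plucker_norm X (Suc k) u \<le> real (Suc k) * (B * plucker_norm X k u)"
proof -
  obtain f where f: "f \<in> {..<Suc k} \<rightarrow>\<^sub>E X"
      and eq: "plucker_norm X (Suc k) u = \<bar>dt (Suc k) (\<lambda>a c. u c $ f a)\<bar>"
    using plucker_norm_attained[OF X] .
  have "\<bar>dt (Suc k) (\<lambda>a c. u c $ f a)\<bar>
      = \<bar>\<Sum>i<Suc k. u k $ f i * ((-1) ^ (i + k) *
          dt k (\<lambda>a c. u (insert_index k c) $ f (insert_index i a)))\<bar>"
    by (subst dt_laplace_col[of k]) simp_all
  also have "\<dots> \<le> (\<Sum>i<Suc k. \<bar>u k $ f i * ((-1) ^ (i + k) *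
          dt k (\<lambda>a c. u (insert_index k c) $ f (insert_index i a)))\<bar>)"
    by (rule sum_abs)
  also have "\<dots> \<le> (\<Sum>i<Suc k. B * plucker_norm X k u)"
  proof (intro sum_mono)
    fix i assume i: "i \<in> {..<Suc k}"
    have fX: "f a \<in> X" if "a < Suc k" for a
      using f that by auto
    have "dt k (\<lambda>a c. u (insert_index k c) $ f (insert_index i a)) = dt k (\<lambda>a c. u c $ (f \<circ> insert_index i) a)"
      by (intro dt_cong) (simp add: insert_index_def)
    also have "\<bar>\<dots>\<bar> \<le> plucker_norm X k u"
      by (intro plucker_norm_ge_dt) (auto simp: insert_index_def intro!: fX)
    finally have dt_le: "\<bar>dt k (\<lambda>a c. u (insert_index k c) $ f (insert_index i a))\<bar> \<le> plucker_norm X k u" .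
    have "\<bar>u k $ f i\<bar> \<le> B"
      using i by (intro B fX) simp
    then have "\<bar>u k $ f i\<bar> * \<bar>dt k (\<lambda>a c. u (insert_index k c) $ f (insert_index i a))\<bar>
        \<le> B * plucker_norm X k u"
      using dt_le by (intro mult_mono) auto
    then show "\<bar>u k $ f i * ((-1) ^ (i + k) *
          dt k (\<lambda>a c. u (insert_index k c) $ f (insert_index i a)))\<bar> \<le> B * plucker_norm X k u"
      by (simp add: abs_mult power_abs)
  qed
  finally show ?thesis
    by (simp add: eq)
qed

section \<open>Integer vectors, covolumes and flags\<close>

definition int_vec :: "real ^ 's \<Rightarrow> bool" where
  "int_vec v \<longleftrightarrow> (\<forall>s. v $ s \<in> \<int>)"

text \<open>Independence and span are over the reals: the integer vectors \<open>w\<close> need not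
  generate all integer points of \<open>V\<close>.\<close>

definition lattice_basis :: "'s::finite set \<Rightarrow> (real ^ 's) set \<Rightarrow> (nat \<Rightarrow> real ^ 's) \<Rightarrow> bool" where
  "lattice_basis X V w \<longleftrightarrow> lin_indep (dim V) w \<and>
    (\<forall>c<dim V. w c \<in> coord_space X \<and> int_vec (w c)) \<and> span (w ` {..<dim V}) = V"

definition rational_subspaces :: "'s::finite set \<Rightarrow> (real ^ 's) set set" where
  "rational_subspaces X = {V. 0 < dim V \<and> (\<exists>w. lattice_basis X V w)}"

definition minimal_basis :: "'s::finite set \<Rightarrow> (real ^ 's) set \<Rightarrow> nat \<Rightarrow> real ^ 's" where
  "minimal_basis X V = (SOME w. lattice_basis X V w \<and>
    (\<forall>w'. lattice_basis X V w' \<longrightarrow> plucker_norm X (dim V) w \<le> plucker_norm X (dim V) w'))"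

text \<open>This is the covolume, in the supremum norm on Pluecker coordinates, of the image under \<open>L\<close> of
  the group of integer points of \<open>V\<close>. Choosing integer vectors that span \<open>V\<close> and have minimal Pluecker
  norm avoids having to know that this group has a basis.\<close>

definition covolume :: "'s::finite set \<Rightarrow> (real ^ 's \<Rightarrow> real ^ 's) \<Rightarrow> (real ^ 's) set \<Rightarrow> real" where
  "covolume X L V = plucker_norm X (dim V) (\<lambda>c. L (minimal_basis X V c))"

definition has_short_vector :: "'s::finite set \<Rightarrow> (real ^ 's \<Rightarrow> real ^ 's) \<Rightarrow> real \<Rightarrow> bool" where
  "has_short_vector X L \<delta> \<longleftrightarrow>
    (\<exists>v. v \<noteq> 0 \<and> v \<in> coord_space X \<and> int_vec v \<and> (\<forall>s\<in>X. \<bar>L v $ s\<bar> \<le> \<delta>))"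

lemma dt_Ints: "(\<And>a c. a < k \<Longrightarrow> c < k \<Longrightarrow> M a c \<in> \<int>) \<Longrightarrow> dt k M \<in> \<int>"
  unfolding dt_def
proof (intro Ints_sum Ints_mult Ints_prod)
  fix \<pi> a assume "\<And>a c. a < k \<Longrightarrow> c < k \<Longrightarrow> M a c \<in> \<int>" "\<pi> \<in> {\<pi>. \<pi> permutes {..<k}}" "a \<in> {..<k}"
  then show "M a (\<pi> a) \<in> \<int>"
    using permutes_in_image[of \<pi> "{..<k}" a] by simp
qed simp

text \<open>Minors of integer vectors are integers, and one of them is nonzero by independence.
  Integrality makes the minimum in \<open>minimal_basis\<close> exist; the lower bound 1 feeds the
  growth estimate.\<close>

lemma lattice_basis_plucker_norm:
  assumes X: "X \<noteq> {}" and w: "lattice_basis X V w"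
  shows "plucker_norm X (dim V) w \<in> \<int>" and "1 \<le> plucker_norm X (dim V) w"
proof -
  let ?k = "dim V"
  have ind: "lin_indep ?k w" and wX: "\<And>c. c < ?k \<Longrightarrow> w c \<in> coord_space X"
      and wI: "\<And>c s. c < ?k \<Longrightarrow> w c $ s \<in> \<int>"
    using w by (auto simp: lattice_basis_def int_vec_def)
  obtain f where "plucker_norm X ?k w = \<bar>dt ?k (\<lambda>a c. w c $ f a)\<bar>"
    using plucker_norm_attained[OF X] .
  moreover have "dt ?k (\<lambda>a c. w c $ f a) \<in> \<int>"
    by (intro dt_Ints wI)
  ultimately show int: "plucker_norm X ?k w \<in> \<int>"
    by simp
  have "\<exists>f. (\<forall>a<?k. f a \<in> X) \<and> (\<forall>a<0. f a = undefined a) \<and> dt ?k (\<lambda>a c. w c $ f a) \<noteq> 0"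
  proof (rule select_minor)
    fix x assume x: "\<And>s. s \<in> X \<Longrightarrow> (\<Sum>c<?k. x c * w c $ s) = 0"
    have "(\<Sum>c<?k. x c *\<^sub>R w c) $ s = 0" for s
    proof (cases "s \<in> X")
      case False
      then have "w c $ s = 0" if "c < ?k" for c
        using wX[OF that] by (simp add: coord_space_def)
      then show ?thesis by simp
    qed (use x in simp)
    then have "(\<Sum>c<?k. x c *\<^sub>R w c) = 0"
      by (simp add: vec_eq_iff)
    then show "\<forall>c<?k. x c = 0"
      using ind unfolding lin_indep_def by blast
  qed auto
  then obtain f where "\<forall>a<?k. f a \<in> X" "dt ?k (\<lambda>a c. w c $ f a) \<noteq> 0"
    by blast
  then have "0 < plucker_norm X ?k w"
    using plucker_norm_ge_dt[of ?k f X w] by fastforce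
  then show "1 \<le> plucker_norm X ?k w"
    using int by (auto elim!: Ints_cases)
qed

lemma minimal_basis:
  assumes X: "X \<noteq> {}" and V: "V \<in> rational_subspaces X"
  shows "lattice_basis X V (minimal_basis X V)"
    and "lattice_basis X V w \<Longrightarrow>
      plucker_norm X (dim V) (minimal_basis X V) \<le> plucker_norm X (dim V) w"
proof -
  let ?h = "\<lambda>w. nat \<lfloor>plucker_norm X (dim V) w\<rfloor>"
  obtain w0 where "lattice_basis X V w0"
    using V by (auto simp: rational_subspaces_def)
  then obtain w1 where w1: "lattice_basis X V w1" "\<And>w. lattice_basis X V w \<Longrightarrow> ?h w1 \<le> ?h w"
    using ex_has_least_nat[of "lattice_basis X V" w0 ?h] by blast
  have "plucker_norm X (dim V) w1 \<le> plucker_norm X (dim V) w" if w: "lattice_basis X V w" for w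
  proof -
    have eq: "plucker_norm X (dim V) w = real (?h w)" if "lattice_basis X V w" for w
      using lattice_basis_plucker_norm[OF X that] by (auto elim!: Ints_cases)
    have "real (?h w1) \<le> real (?h w)"
      using w1(2)[OF w] by (rule of_nat_mono)
    then show ?thesis
      using eq[OF w] eq[OF w1(1)] by linarith
  qed
  then have "\<exists>w. lattice_basis X V w \<and>
    (\<forall>w'. lattice_basis X V w' \<longrightarrow> plucker_norm X (dim V) w \<le> plucker_norm X (dim V) w')"
    using w1(1) by blast
  from someI_ex[OF this] show "lattice_basis X V (minimal_basis X V)"
    and "lattice_basis X V w \<Longrightarrow>
      plucker_norm X (dim V) (minimal_basis X V) \<le> plucker_norm X (dim V) w"
    unfolding minimal_basis_def[symmetric] by blast+
qed

text \<open>The matrix expressing \<open>w\<close> in the minimal basis multiplies all Pluecker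
  coordinates by its determinant \<tau>, both before and after \<open>L\<close>. Minimality before
  \<open>L\<close> gives \<tau> modulus at least 1, and this is used after \<open>L\<close>.\<close>

lemma covolume_le:
  fixes X :: "'s::finite set"
  assumes X: "X \<noteq> {}" and V: "V \<in> rational_subspaces X" and w: "lattice_basis X V w" and L: "linear L"
  shows "covolume X L V \<le> plucker_norm X (dim V) (\<lambda>c. L (w c))"
proof -
  let ?k = "dim V" and ?b = "minimal_basis X V"
  note b = minimal_basis(1)[OF X V]
  have "w c \<in> span (?b ` {..<?k})" if "c < ?k" for c
    using w b that unfolding lattice_basis_def by (metis imageI lessThan_iff span_base)
  then have "\<exists>T. \<forall>c<?k. w c = (\<Sum>d<?k. T c d *\<^sub>R ?b d)"
    unfolding span_image_nat by metis
  then obtain T where T: "\<And>c. c < ?k \<Longrightarrow> w c = (\<Sum>d<?k. T c d *\<^sub>R ?b d)"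
    by blast
  define \<tau> where "\<tau> = dt ?k (\<lambda>d c. T c d)"
  have change: "dt ?k (\<lambda>a c. L (w c) $ f a) = dt ?k (\<lambda>a c. L (?b c) $ f a) * \<tau>" if "linear L" for L :: "real ^ 's \<Rightarrow> real ^ 's" and f
    unfolding \<tau>_def by (rule dt_basis_change[OF that T])
  have "1 \<le> \<bar>\<tau>\<bar>"
  proof (rule ccontr)
    assume "\<not> 1 \<le> \<bar>\<tau>\<bar>"
    obtain f where f: "f \<in> {..<?k} \<rightarrow>\<^sub>E X" "plucker_norm X ?k w = \<bar>dt ?k (\<lambda>a c. w c $ f a)\<bar>"
      using plucker_norm_attained[OF X] .
    have "plucker_norm X ?k w = \<bar>dt ?k (\<lambda>a c. ?b c $ f a)\<bar> * \<bar>\<tau>\<bar>"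
      using change[OF linear_id, of f] f(2) by (simp add: abs_mult)
    also have "\<dots> \<le> plucker_norm X ?k ?b * \<bar>\<tau>\<bar>"
      using plucker_norm_ge[OF f(1)] by (intro mult_right_mono) auto
    also have "\<dots> < plucker_norm X ?k ?b * 1"
      using \<open>\<not> 1 \<le> \<bar>\<tau>\<bar>\<close> lattice_basis_plucker_norm(2)[OF X b] by (intro mult_strict_left_mono) auto
    also have "\<dots> \<le> plucker_norm X ?k w"
      using minimal_basis(2)[OF X V w] by simp
    finally show False by simp
  qed
  obtain f where f: "f \<in> {..<?k} \<rightarrow>\<^sub>E X"
      "plucker_norm X ?k (\<lambda>c. L (?b c)) = \<bar>dt ?k (\<lambda>a c. L (?b c) $ f a)\<bar>"
    using plucker_norm_attained[OF X] .
  have "covolume X L V = \<bar>dt ?k (\<lambda>a c. L (?b c) $ f a)\<bar> * 1"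
    by (simp add: covolume_def f(2))
  also have "\<dots> \<le> \<bar>dt ?k (\<lambda>a c. L (?b c) $ f a)\<bar> * \<bar>\<tau>\<bar>"
    using \<open>1 \<le> \<bar>\<tau>\<bar>\<close> by (intro mult_left_mono) auto
  also have "\<dots> = \<bar>dt ?k (\<lambda>a c. L (w c) $ f a)\<bar>"
    by (simp add: change[OF L] abs_mult)
  also have "\<dots> \<le> plucker_norm X ?k (\<lambda>c. L (w c))"
    by (rule plucker_norm_ge[OF f(1)])
  finally show ?thesis .
qed

lemma lattice_basis_subset:
  assumes "lattice_basis X V w"
  shows "V \<subseteq> coord_space X" and "subspace V"
proof -
  have V: "V = span (w ` {..<dim V})"
    using assms by (simp add: lattice_basis_def)
  show "subspace V"
    by (subst V) (rule subspace_span)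
  have "span (w ` {..<dim V}) \<subseteq> coord_space X"
    using assms by (intro span_minimal subspace_coord_space) (auto simp: lattice_basis_def)
  then show "V \<subseteq> coord_space X"
    using V by simp
qed

text \<open>Let \<open>V1\<close> be the largest flag member that misses \<open>v\<close>, or 0 if
  there is none. The sum \<open>V'\<close> of \<open>V1\<close> and the line of \<open>v\<close> is
  comparable with the whole flag, so its covolume is at least \<epsilon>; but adjoining a vector of
  size \<delta> to \<open>V1\<close>, whose covolume is at most 1, gives at most
  \<open>card X * \<delta>\<close>.\<close>

lemma no_short_vector:
  fixes X :: "'s::finite set"
  assumes X: "X \<noteq> {}" and L: "linear L"
    and marked: "marked (\<lambda>V V'. V \<subseteq> V' \<or> V' \<subseteq> V) (\<lambda>V y. covolume X L V) \<epsilon> \<rho> (rational_subspaces X) y"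
    and \<rho>: "\<epsilon> \<le> \<rho>" "\<rho> \<le> 1"
    and v: "v \<in> coord_space X" "int_vec v" "v \<noteq> 0" and \<delta>: "\<And>s. s \<in> X \<Longrightarrow> \<bar>L v $ s\<bar> \<le> \<delta>"
  shows "\<epsilon> \<le> real (card X) * \<delta>"
proof -
  from marked[unfolded marked_def]
  obtain T where T: "T \<subseteq> rational_subspaces X" "finite T" "pairwise (\<lambda>V V'. V \<subseteq> V' \<or> V' \<subseteq> V) T"
      and val': "\<forall>V\<in>T. \<epsilon> \<le> covolume X L V \<and> covolume X L V \<le> \<rho>"
      and out': "\<forall>V\<in>rational_subspaces X. (\<forall>V'\<in>T. V \<subseteq> V' \<or> V' \<subseteq> V) \<longrightarrow> V \<in> T \<or> \<rho> \<le> covolume X L V"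
    by (elim exE conjE) (rule that; assumption)
  note val = bspec[OF val']
  note out = mp[OF bspec[OF out']]
  have comparable: "V \<subseteq> V' \<or> V' \<subseteq> V" if "V \<in> T" "V' \<in> T" for V V'
    using T(3) that by (cases "V = V'") (auto simp: pairwise_def)
  have \<delta>0: "0 \<le> \<delta>"
    using \<delta> X by (meson abs_ge_zero all_not_in_conv order_trans)
  have "\<exists>k w. lin_indep k w \<and> (\<forall>c<k. w c \<in> coord_space X \<and> int_vec (w c)) \<and> v \<notin> span (w ` {..<k}) \<and>
      (\<forall>V\<in>T. V \<subseteq> span (w ` {..<k}) \<or> insert v (w ` {..<k}) \<subseteq> V) \<and> plucker_norm X k (\<lambda>c. L (w c)) \<le> 1"
  proof (cases "\<exists>V\<in>T. v \<notin> V")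
    \<comment> \<open>All flag members contain \<open>v\<close>: the zero subspace serves, with the
      empty determinant 1.\<close>
    case False
    then show ?thesis
      using v(3) X by (intro exI[of _ 0]) (auto simp: lin_indep_def plucker_norm_0)
  next
    case True
    define T0 where "T0 = {V \<in> T. v \<notin> V}"
    have T0: "finite T0" "T0 \<noteq> {}"
      using T(2) True by (auto simp: T0_def)
    obtain V1 where V1: "V1 \<in> T0" "\<And>V. V \<in> T0 \<Longrightarrow> V1 \<subseteq> V \<Longrightarrow> V1 = V"
      using finite_has_maximal[OF T0] by blast
    have V1_max: "V \<subseteq> V1" if "V \<in> T0" for V
      using V1(2)[OF that] comparable[of V V1] that V1(1) by (auto simp: T0_def)
    have V1_rat: "V1 \<in> rational_subspaces X" and V1T: "V1 \<in> T" "v \<notin> V1"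
      using V1(1) T(1) by (auto simp: T0_def)
    let ?w = "minimal_basis X V1"
    have b: "lattice_basis X V1 ?w"
      using minimal_basis(1)[OF X V1_rat] .
    have sp: "span (?w ` {..<dim V1}) = V1"
      using b by (simp add: lattice_basis_def)
    have "V \<subseteq> V1 \<or> insert v (?w ` {..<dim V1}) \<subseteq> V" if V: "V \<in> T" for V
    proof (cases "v \<in> V")
      case True
      then have "\<not> V \<subseteq> V1"
        using V1T(2) by blast
      then have "V1 \<subseteq> V"
        using comparable[OF V V1T(1)] by blast
      moreover have "?w ` {..<dim V1} \<subseteq> V1"
        using span_superset[of "?w ` {..<dim V1}"] by (simp only: sp)
      ultimately show ?thesis
        using True by blast
    next
      case False
      then show ?thesis
        using V1_max V by (simp add: T0_def)
    qed
    moreover have "plucker_norm X (dim V1) (\<lambda>c. L (?w c)) \<le> 1"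
      using val[OF V1T(1)] \<rho>(2) by (simp add: covolume_def)
    ultimately show ?thesis
      using b V1T(2) by (intro exI[of _ "dim V1"] exI[of _ ?w]) (auto simp: sp lattice_basis_def)
  qed
  then obtain k w where ind: "lin_indep k w" and lat: "\<forall>c<k. w c \<in> coord_space X \<and> int_vec (w c)"
      and vw: "v \<notin> span (w ` {..<k})"
      and flag': "\<forall>V\<in>T. V \<subseteq> span (w ` {..<k}) \<or> insert v (w ` {..<k}) \<subseteq> V"
      and le1: "plucker_norm X k (\<lambda>c. L (w c)) \<le> 1"
    by (elim exE conjE) (rule that; assumption)
  note flag = bspec[OF flag']
  define u where "u = w(k := v)"
  define V' where "V' = span (u ` {..<Suc k})"
  have u: "lin_indep (Suc k) u"
    unfolding u_def using ind vw by (rule lin_indep_Suc)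
  have u_im: "u ` {..<Suc k} = insert v (w ` {..<k})"
    by (auto simp: u_def lessThan_Suc image_iff)
  have dimV': "dim V' = Suc k"
    unfolding V'_def using u by (rule dim_span_lin_indep)
  have basis: "lattice_basis X V' u"
    unfolding lattice_basis_def dimV'
  proof (intro conjI allI impI u)
    show "u c \<in> coord_space X" "int_vec (u c)" if "c < Suc k" for c
      using that lat v by (auto simp: u_def less_Suc_eq)
  qed (simp add: V'_def)
  then have rat: "V' \<in> rational_subspaces X"
    by (auto simp: rational_subspaces_def dimV')
  have "V' \<subseteq> V \<or> V \<subseteq> V'" if V: "V \<in> T" for V
    using flag[OF V]
  proof
    assume "V \<subseteq> span (w ` {..<k})"
    also have "\<dots> \<subseteq> V'"
      unfolding V'_def u_im by (intro span_mono) auto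
    finally show ?thesis by blast
  next
    assume "insert v (w ` {..<k}) \<subseteq> V"
    moreover have "subspace V"
      using T(1) V lattice_basis_subset(2) by (auto simp: rational_subspaces_def)
    ultimately show ?thesis
      unfolding V'_def u_im by (intro disjI1 span_minimal)
  qed
  then have "\<epsilon> \<le> covolume X L V'"
    using out[OF rat] val \<rho>(1) by fastforce
  also have "\<dots> \<le> plucker_norm X (Suc k) (\<lambda>c. L (u c))"
    using covolume_le[OF X rat basis L] by (simp add: dimV')
  also have "\<dots> \<le> real (Suc k) * (\<delta> * plucker_norm X k (\<lambda>c. L (u c)))"
    using \<delta> by (intro plucker_norm_Suc_le[OF X]) (simp add: u_def)
  also have "plucker_norm X k (\<lambda>c. L (u c)) = plucker_norm X k (\<lambda>c. L (w c))"
    unfolding plucker_norm_def by (intro arg_cong[where f = Max] image_cong refl arg_cong[where f = abs] dt_cong)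
      (simp add: u_def)
  also have "real (Suc k) * (\<delta> * plucker_norm X k (\<lambda>c. L (w c))) \<le> real (Suc k) * (\<delta> * 1)"
    using le1 \<delta>0 by (intro mult_left_mono) auto
  also have "\<dots> \<le> real (card X) * (\<delta> * 1)"
  proof (intro mult_right_mono)
    have "dim V' \<le> dim (coord_space X)"
      using lattice_basis_subset(1)[OF basis] by (rule dim_subset)
    then show "real (Suc k) \<le> real (card X)"
      by (simp add: dimV' dim_coord_space)
  qed (use \<delta>0 in simp)
  finally show ?thesis by simp
qed

text \<open>An admissible selection has nonnegative total weight: it consists of coordinates from
  \<open>J\<close> only, or it contains all of them and omits only nonpositive weights from a total
  of 0. For \<open>t \<ge> 0\<close> the flow does not decrease the coordinate, and the bound at
  time 0 persists.\<close>

lemma covolume_growth: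
  fixes Ys :: "(real ^ 'n::finite ^ 'm::finite) set" and wt :: "real ^ ('m + 'n)"
    and J :: "'m set"
  defines "X \<equiv> Inl ` J \<union> range Inr"
  assumes np: "nonplanar_set Ys"
    and wt: "\<And>j. j \<in> J \<Longrightarrow> 0 \<le> wt $ Inl j" "\<And>i. wt $ Inr i \<le> 0" "(\<Sum>s\<in>X. wt $ s) = 0"
  shows "\<exists>\<kappa>>0. \<forall>V\<in>rational_subspaces X. \<forall>t\<ge>0. \<exists>Y\<in>Ys. \<kappa> \<le> covolume X (flow_act wt t Y) V"
proof -
  have X: "X \<noteq> {}"
    by (auto simp: X_def)
  define Q where "Q \<kappa> k \<longleftrightarrow> (\<forall>w. (\<forall>c<k. w c \<in> coord_space X) \<longrightarrow>
      (\<exists>f\<in>{..<k} \<rightarrow>\<^sub>E X. 1 \<le> \<bar>dt k (\<lambda>a c. w c $ f a)\<bar>) \<longrightarrow>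
      grows Ys J k \<kappa> w)" for \<kappa> k
  have "\<exists>\<kappa>>0. Q \<kappa> k" for k
    unfolding Q_def X_def using np by (rule growth_uniform)
  then obtain \<kappa>0 where \<kappa>0: "\<And>k. 0 < \<kappa>0 k" "\<And>k. Q (\<kappa>0 k) k"
    by metis
  define \<kappa> where "\<kappa> = Min (\<kappa>0 ` {..card X})"
  have \<kappa>: "0 < \<kappa>" "\<And>k. k \<le> card X \<Longrightarrow> \<kappa> \<le> \<kappa>0 k"
    using \<kappa>0(1) by (auto simp: \<kappa>_def)
  have "\<exists>Y\<in>Ys. \<kappa> \<le> covolume X (flow_act wt t Y) V" if V: "V \<in> rational_subspaces X" and t: "0 \<le> t" for V t
  proof -
    let ?k = "dim V" and ?b = "minimal_basis X V"
    have b: "lattice_basis X V ?b"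
      using minimal_basis(1)[OF X V] .
    have k: "?k \<le> card X"
      using dim_subset[OF lattice_basis_subset(1)[OF b]] by (simp add: dim_coord_space)
    have "\<exists>f\<in>{..<?k} \<rightarrow>\<^sub>E X. 1 \<le> \<bar>dt ?k (\<lambda>a c. ?b c $ f a)\<bar>"
      using plucker_norm_attained[OF X, of ?k ?b] lattice_basis_plucker_norm(2)[OF X b] by metis
    moreover have "\<forall>c<?k. ?b c \<in> coord_space X"
      using b by (simp add: lattice_basis_def)
    ultimately obtain Y f where Y: "Y \<in> Ys" and f: "admissible J ?k f"
        and ge: "\<kappa>0 ?k \<le> \<bar>dt ?k (\<lambda>a c. block_act Y (?b c) $ f a)\<bar>"
      using \<kappa>0(2)[of ?k] unfolding Q_def grows_def by blast
    have fX: "f a \<in> X" if "a < ?k" for a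
      using f that by (auto simp: admissible_def X_def)
    have inj: "inj_on f {..<?k}"
    proof (rule inj_onI, rule ccontr)
      fix a b assume "a \<in> {..<?k}" "b \<in> {..<?k}" "f a = f b" "a \<noteq> b"
      then have "dt ?k (\<lambda>a c. block_act Y (?b c) $ f a) = 0"
        by (intro dt_equal_rows[of a ?k b]) auto
      with ge \<kappa>0(1)[of ?k] show False by simp
    qed
    have "0 \<le> (\<Sum>a<?k. wt $ f a)"
    proof (cases "f ` {..<?k} \<subseteq> Inl ` J")
      case True
      show ?thesis
      proof (intro sum_nonneg)
        fix a assume "a \<in> {..<?k}"
        then obtain j where "j \<in> J" "f a = Inl j"
          using True by blast
        then show "0 \<le> wt $ f a"
          using wt(1) by simp
      qed
    next
      case False
      then have sub: "Inl ` J \<subseteq> f ` {..<?k}"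
        using f by (auto simp: admissible_def)
      have "0 = (\<Sum>s\<in>f ` {..<?k}. wt $ s) + (\<Sum>s\<in>X - f ` {..<?k}. wt $ s)"
        using wt(3) sum.subset_diff[of "f ` {..<?k}" X "\<lambda>s. wt $ s"] fX by (auto simp: add.commute)
      moreover have "(\<Sum>s\<in>X - f ` {..<?k}. wt $ s) \<le> 0"
        using sub wt(2) by (intro sum_nonpos) (auto simp: X_def)
      moreover have "(\<Sum>s\<in>f ` {..<?k}. wt $ s) = (\<Sum>a<?k. wt $ f a)"
        using inj by (simp add: sum.reindex)
      ultimately show ?thesis by linarith
    qed
    then have "1 \<le> exp (t * (\<Sum>a<?k. wt $ f a))"
      using t by simp
    then have "1 * \<bar>dt ?k (\<lambda>a c. block_act Y (?b c) $ f a)\<bar>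
        \<le> exp (t * (\<Sum>a<?k. wt $ f a)) * \<bar>dt ?k (\<lambda>a c. block_act Y (?b c) $ f a)\<bar>"
      by (intro mult_right_mono) auto
    also have "\<dots> = \<bar>dt ?k (\<lambda>a c. flow_act wt t Y (?b c) $ f a)\<bar>"
      by (simp add: dt_flow_act abs_mult)
    also have "\<dots> \<le> covolume X (flow_act wt t Y) V"
      unfolding covolume_def by (intro plucker_norm_ge_dt fX)
    finally show ?thesis
      using \<kappa>(2)[OF k] ge Y by (intro bexI[of _ Y]) auto
  qed
  with \<kappa>(1) show ?thesis by blast
qed

lemma continuous_on_Max:
  fixes g :: "'i \<Rightarrow> 'a::topological_space \<Rightarrow> real"
  assumes "finite A" "A \<noteq> {}" "\<And>i. i \<in> A \<Longrightarrow> continuous_on S (g i)"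
  shows "continuous_on S (\<lambda>x. Max ((\<lambda>i. g i x) ` A))"
  using assms
proof (induction A rule: finite_ne_induct)
  case (insert i A)
  have "Max ((\<lambda>j. g j x) ` insert i A) = max (g i x) (Max ((\<lambda>j. g j x) ` A))" for x
    using insert.hyps by simp
  then show ?case
    using insert by (simp add: continuous_on_max)
qed simp

lemma continuous_on_covolume:
  fixes F :: "'a::topological_space \<Rightarrow> real ^ 'n::finite ^ 'm::finite"
  assumes X: "X \<noteq> {}" and F: "continuous_on S F"
  shows "continuous_on S (\<lambda>x. covolume X (flow_act wt t (F x)) V)"
proof -
  have entry: "continuous_on S (\<lambda>x. block_entry (F x) s s')" for s s'
    using F by (cases s; cases s') (simp_all add: continuous_on_component)
  show ?thesis
    unfolding covolume_def plucker_norm_def dt_flow_act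
    unfolding dt_def block_act_def vec_lambda_beta
    by (intro continuous_on_Max finite_selections continuous_intros entry)
      (use X in \<open>auto simp: PiE_eq_empty_iff\<close>)
qed

section \<open>Short vectors and transference near a point of the support\<close>

lemma continuous_on_minor_span:
  fixes g :: "real ^ 'n::{finite,linorder} ^ 'm::{finite,linorder} \<Rightarrow> real"
  assumes "g \<in> minor_span"
  shows "continuous_on S g"
proof -
  obtain a0 a where g: "\<And>Y. g Y = a0 + (\<Sum>s\<in>minor_index. a s * minor Y s)"
    using assms by (auto simp: minor_span_def)
  have "continuous_on S (\<lambda>Y :: real ^ 'n::{finite,linorder} ^ 'm::{finite,linorder}. minor Y s)" for s
    unfolding minor_def by (cases s) (auto intro!: continuous_intros)
  then show ?thesis
    unfolding g by (intro continuous_intros)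
qed

lemma affine_row_in_span:
  "(\<lambda>Y :: real ^ 'n::{finite,linorder} ^ 'm::{finite,linorder}. (Y *v u) $ j + b) \<in> minor_span"
proof -
  have dt1: "dt (Suc 0) M = M 0 0" for M
    using dt_laplace_row[of 0 "Suc 0" M] by simp
  have "(\<lambda>Y :: real ^ 'n::{finite,linorder} ^ 'm::{finite,linorder}. Y $ j $ i) \<in> minor_span" for i
    using dt_block_in_span[of "Suc 0" "\<lambda>_. Inl j" "\<lambda>_. Inr i"] by (simp add: dt1)
  then have "(\<lambda>Y :: real ^ 'n::{finite,linorder} ^ 'm::{finite,linorder}. (\<Sum>i\<in>UNIV. u $ i * Y $ j $ i) + b) \<in> minor_span"
    by (intro minor_span_add minor_span_sum minor_span_cmult minor_span_const)
  then show ?thesis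
    by (simp add: matrix_vector_mult_def mult.commute)
qed

text \<open>The hypotheses as they hold on one small ball. Goodness is stated for the whole span of
  the minors, with the supremum norm replaced by a value \<sigma> that is reached at a point of the
  support.\<close>

locale local_data = doubling_measure \<mu> \<Omega> D
  for \<mu> :: "(real ^ 'd::finite) measure" and \<Omega> D +
  fixes F :: "real ^ 'd \<Rightarrow> real ^ 'n::{finite,linorder} ^ 'm::{finite,linorder}" and C \<alpha> :: real
  assumes cont_F: "continuous_on \<Omega> F"
    and D_finite: "D < \<infinity>" and finite_Omega: "emeasure \<mu> \<Omega> < \<infinity>"
    and C: "0 < C" and \<alpha>: "0 < \<alpha>"
    and msupp_sets: "msupp \<mu> \<inter> \<Omega> \<in> sets \<mu>" and msupp_full: "emeasure \<mu> (\<Omega> - msupp \<mu>) = 0"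
    and good: "g \<in> minor_span \<Longrightarrow> c \<in> msupp \<mu> \<Longrightarrow> 0 < r \<Longrightarrow> ball c r \<subseteq> \<Omega> \<Longrightarrow> 0 < \<epsilon> \<Longrightarrow> 0 < \<sigma> \<Longrightarrow>
      y \<in> ball c r \<inter> msupp \<mu> \<Longrightarrow> \<sigma> \<le> \<bar>g (F y)\<bar> \<Longrightarrow>
      emeasure \<mu> {x \<in> ball c r. \<bar>g (F x)\<bar> < \<epsilon>} \<le> ennreal (C * (\<epsilon> / \<sigma>) powr \<alpha>) * emeasure \<mu> (ball c r)"
    and nonplanar: "c \<in> msupp \<mu> \<Longrightarrow> 0 < r \<Longrightarrow> ball c r \<subseteq> \<Omega> \<Longrightarrow> rank (augmented A B) = CARD('n) \<Longrightarrow>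
      \<exists>x\<in>ball c r \<inter> msupp \<mu>. det (A ** F x + B) \<noteq> 0"
begin

lemma nonplanar_image:
  "c \<in> msupp \<mu> \<Longrightarrow> 0 < r \<Longrightarrow> ball c r \<subseteq> \<Omega> \<Longrightarrow> nonplanar_set (F ` (ball c r \<inter> msupp \<mu>))"
  using nonplanar unfolding nonplanar_set_def by blast

lemma Omega_sets: "\<Omega> \<in> sets \<mu>"
  using open_Omega by (intro borel_sets) auto

lemma ball_sets: "ball c r \<subseteq> \<Omega> \<Longrightarrow> ball c r \<in> sets \<mu>"
  by (intro borel_sets) auto

lemma open_sublevel:
  assumes g: "g \<in> minor_span" and B: "open B" "B \<subseteq> \<Omega>"
  shows "open {x \<in> B. \<bar>g (F x)\<bar> < \<epsilon>}"
proof -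
  have "continuous_on B (\<lambda>x. \<bar>g (F x)\<bar>)"
    using continuous_on_compose2[OF continuous_on_minor_span[OF g, of UNIV] continuous_on_subset[OF cont_F B(2)]]
    by (intro continuous_intros) auto
  then have "open (B \<inter> (\<lambda>x. \<bar>g (F x)\<bar>) -` {..<\<epsilon>})"
    using B(1) by (intro continuous_open_preimage) auto
  moreover have "B \<inter> (\<lambda>x. \<bar>g (F x)\<bar>) -` {..<\<epsilon>} = {x \<in> B. \<bar>g (F x)\<bar> < \<epsilon>}"
    by auto
  ultimately show ?thesis by simp
qed

abbreviation short_points where
  "short_points X wt t \<delta> B \<equiv> {x \<in> B \<inter> msupp \<mu>. has_short_vector X (flow_act wt t (F x)) \<delta>}"

text \<open>Nondivergence for the rational subspaces, ordered by inclusion, ranked by dimension and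
  measured by \<open>covolume\<close>. Goodness turns the ratio \<epsilon> / \<rho> into a power
  \<alpha>; as \<kappa> does not depend on \<open>t\<close>, the bound is uniform in time.\<close>

theorem homogeneous:
  fixes wt :: "real ^ ('m + 'n)" and J :: "'m set"
  defines "X \<equiv> Inl ` J \<union> range Inr"
  assumes wt: "\<And>j. j \<in> J \<Longrightarrow> 0 \<le> wt $ Inl j" "\<And>i. wt $ Inr i \<le> 0" "(\<Sum>s\<in>X. wt $ s) = 0"
    and c: "c \<in> msupp \<mu>" and r: "0 < r" and sub: "ball c (5 ^ card X * r) \<subseteq> \<Omega>"
  shows "\<exists>\<delta>0>0. \<exists>K\<ge>0. \<forall>t\<ge>0. \<forall>\<delta>. 0 < \<delta> \<and> \<delta> \<le> \<delta>0 \<longrightarrow>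
    outer_le \<mu> (short_points X wt t \<delta> (ball c r)) (ennreal (K * \<delta> powr \<alpha>))"
proof -
  have X: "X \<noteq> {}" and cX: "0 < card X"
    by (auto simp: X_def card_gt_0_iff)
  have "1 * r \<le> 5 ^ card X * r"
    using r by (intro mult_right_mono) auto
  then have subr: "ball c r \<subseteq> \<Omega>"
    using sub subset_ball[of "1 * r" "5 ^ card X * r" c] by auto
  obtain \<kappa> where \<kappa>: "0 < \<kappa>" and growth: "\<And>V t. V \<in> rational_subspaces X \<Longrightarrow> 0 \<le> t \<Longrightarrow>
      \<exists>Y\<in>F ` (ball c r \<inter> msupp \<mu>). \<kappa> \<le> covolume X (flow_act wt t Y) V"
  proof -
    show thesis
      using covolume_growth[OF nonplanar_image[OF c r subr] wt[unfolded X_def]] that unfolding X_def by blast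
  qed
  \<comment> \<open>The bound by \<kappa> makes every subspace reach \<rho> in the ball at every
    time; the bound by 1 is what \<open>no_short_vector\<close> asks of the flag.\<close>
  define \<rho> where "\<rho> = min 1 \<kappa>"
  have \<rho>: "0 < \<rho>" "\<rho> \<le> 1" "\<rho> \<le> \<kappa>"
    using \<kappa> by (auto simp: \<rho>_def)
  define nc where "nc = enn2real (nondiv_const D (card X))"
  define M where "M = enn2real (emeasure \<mu> \<Omega>)"
  define K where "K = nc * (C * (2 * card X / \<rho>) powr \<alpha>) * M"
  have nc: "nondiv_const D (card X) = ennreal nc"
    using nondiv_const_finite[OF D_finite, of "card X"] by (simp add: nc_def)
  have M: "emeasure \<mu> \<Omega> = ennreal M"
    using finite_Omega by (simp add: M_def)
  have pos: "0 \<le> nc" "0 \<le> M" "0 \<le> K"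
    using C by (auto simp: nc_def M_def K_def)
  have "outer_le \<mu> (short_points X wt t \<delta> (ball c r))
      (ennreal (K * \<delta> powr \<alpha>))"
    if t: "0 \<le> t" and \<delta>: "0 < \<delta>" "\<delta> \<le> \<rho> / (2 * card X)" for t \<delta>
  proof -
    \<comment> \<open>The factor 2 makes \<open>card X * \<delta> < \<epsilon>\<close> strict, so
      that a marked point has no vector of size \<delta>.\<close>
    define \<epsilon> where "\<epsilon> = 2 * card X * \<delta>"
    have \<epsilon>: "0 < \<epsilon>" "\<epsilon> \<le> \<rho>" "card X * \<delta> < \<epsilon>"
      using \<delta> cX by (auto simp: \<epsilon>_def field_simps)
    let ?P = "rational_subspaces X" and ?cmp = "\<lambda>V V' :: (real ^ ('m + 'n)) set. V \<subseteq> V' \<or> V' \<subseteq> V"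
    let ?\<psi> = "\<lambda>V x. covolume X (flow_act wt t (F x)) V"
    let ?\<eta> = "ennreal (C * (\<epsilon> / \<rho>) powr \<alpha>)"
    have sub_coord: "V \<subseteq> coord_space X" "subspace V" if "V \<in> ?P" for V
      using that lattice_basis_subset by (auto simp: rational_subspaces_def)
    have dims: "dim ` ?P \<subseteq> {1..card X}"
    proof
      fix k assume "k \<in> dim ` ?P"
      then obtain V where V: "V \<in> ?P" "k = dim V"
        by blast
      then show "k \<in> {1..card X}"
        using dim_subset[OF sub_coord(1)[OF V(1)]] by (auto simp: dim_coord_space rational_subspaces_def)
    qed
    have "outer_le \<mu> {x \<in> ball c r \<inter> msupp \<mu>. \<not> marked ?cmp ?\<psi> \<epsilon> \<rho> ?P x}
      (nondiv_const D (card X) * ?\<eta> * emeasure \<mu> (ball c r))"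
    proof (rule nondivergence[where rk = dim])
      show "symp ?cmp"
        by (auto simp: symp_def)
      show "dim V \<noteq> dim V'" if "V \<in> ?P" "V' \<in> ?P" "?cmp V V'" "V \<noteq> V'" for V V'
        using that sub_coord(2) subspace_dim_equal[of V V'] subspace_dim_equal[of V' V] by force
      show "finite (dim ` ?P)"
        using dims finite_subset by blast
      show "card (dim ` ?P) \<le> card X"
        using card_mono[OF _ dims] by simp
      show "emeasure \<mu> {z \<in> ball b s. ?\<psi> V z < \<epsilon>} \<le> ?\<eta> * emeasure \<mu> (ball b s)"
        if V: "V \<in> ?P" and b: "b \<in> msupp \<mu>" "0 < s" "ball b s \<subseteq> \<Omega>" and ex: "\<exists>y\<in>ball b s \<inter> msupp \<mu>. \<rho> \<le> ?\<psi> V y"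
        for V b s
      proof -
        obtain y where y: "y \<in> ball b s \<inter> msupp \<mu>" "\<rho> \<le> ?\<psi> V y"
          using ex by blast
        let ?k = "dim V" and ?w = "minimal_basis X V"
        obtain f where f: "f \<in> {..<?k} \<rightarrow>\<^sub>E X"
            "?\<psi> V y = \<bar>dt ?k (\<lambda>a c. flow_act wt t (F y) (?w c) $ f a)\<bar>"
          unfolding covolume_def using plucker_norm_attained[OF X] .
        \<comment> \<open>The Pluecker coordinate that is largest at \<open>y\<close>, kept fixed.
          It bounds the covolume from below everywhere, so the sublevel set of the covolume lies in
          that of a single good function.\<close>
        define g where "g Y = exp (t * (\<Sum>a<?k. wt $ f a)) * dt ?k (\<lambda>a c. block_act Y (?w c) $ f a)" for Y
        have g: "g \<in> minor_span"
          unfolding g_def by (intro minor_span_cmult dt_block_act_in_span)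
        have gF: "\<bar>g (F z)\<bar> \<le> ?\<psi> V z" for z
          unfolding g_def dt_flow_act[symmetric] covolume_def by (rule plucker_norm_ge[OF f(1)])
        have "\<rho> \<le> \<bar>g (F y)\<bar>"
          using y(2) f(2) by (simp add: g_def dt_flow_act)
        have "emeasure \<mu> {z \<in> ball b s. ?\<psi> V z < \<epsilon>} \<le> emeasure \<mu> {z \<in> ball b s. \<bar>g (F z)\<bar> < \<epsilon>}"
        proof (intro emeasure_mono)
          show "{z \<in> ball b s. ?\<psi> V z < \<epsilon>} \<subseteq> {z \<in> ball b s. \<bar>g (F z)\<bar> < \<epsilon>}"
            using gF le_less_trans by blast
          show "{z \<in> ball b s. \<bar>g (F z)\<bar> < \<epsilon>} \<in> sets \<mu>"
            using open_sublevel[OF g _ b(3), of \<epsilon>] b(3) by (intro borel_sets) auto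
        qed
        also have "\<dots> \<le> ?\<eta> * emeasure \<mu> (ball b s)"
          by (rule good[OF g b \<epsilon>(1) \<rho>(1) y(1) \<open>\<rho> \<le> \<bar>g (F y)\<bar>\<close>])
        finally show ?thesis .
      qed
      show "continuous_on \<Omega> (?\<psi> V)" if "V \<in> ?P" for V
        using X cont_F by (rule continuous_on_covolume)
      show "\<exists>y\<in>ball c r \<inter> msupp \<mu>. \<rho> \<le> ?\<psi> V y" if "V \<in> ?P" for V
        using growth[OF that t] \<rho>(3) by force
    qed (use c r sub in auto)
    then obtain N where N: "N \<in> sets \<mu>"
        "{x \<in> ball c r \<inter> msupp \<mu>. \<not> marked ?cmp ?\<psi> \<epsilon> \<rho> ?P x} \<subseteq> N"
        "emeasure \<mu> N \<le> nondiv_const D (card X) * ?\<eta> * emeasure \<mu> (ball c r)"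
      by blast
    have "\<not> marked ?cmp ?\<psi> \<epsilon> \<rho> ?P x" if short: "has_short_vector X (flow_act wt t (F x)) \<delta>" for x
    proof
      from short obtain v
        where v: "v \<noteq> 0" "v \<in> coord_space X" "int_vec v" "\<forall>s\<in>X. \<bar>flow_act wt t (F x) v $ s\<bar> \<le> \<delta>"
        unfolding has_short_vector_def by (elim exE conjE) (rule that; assumption)
      assume "marked ?cmp ?\<psi> \<epsilon> \<rho> ?P x"
      then have "marked ?cmp (\<lambda>V y. covolume X (flow_act wt t (F x)) V) \<epsilon> \<rho> ?P x"
        by (simp add: marked_def)
      then have "\<epsilon> \<le> real (card X) * \<delta>"
        using v by (intro no_short_vector[OF X linear_flow_act _ \<epsilon>(2) \<rho>(2) v(2,3,1)]) auto
      with \<epsilon>(3) show False by simp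
    qed
    then have "short_points X wt t \<delta> (ball c r) \<subseteq> N"
      using N(2) by blast
    moreover have "emeasure \<mu> N \<le> ennreal (K * \<delta> powr \<alpha>)"
    proof -
      note N(3)
      also have "nondiv_const D (card X) * ?\<eta> * emeasure \<mu> (ball c r) \<le> nondiv_const D (card X) * ?\<eta> * emeasure \<mu> \<Omega>"
        using subr Omega_sets by (intro mult_left_mono emeasure_mono) auto
      also have "\<dots> = ennreal (nc * (C * (\<epsilon> / \<rho>) powr \<alpha>) * M)"
        using pos C by (simp add: nc M ennreal_mult)
      also have "(\<epsilon> / \<rho>) powr \<alpha> = (2 * card X / \<rho>) powr \<alpha> * \<delta> powr \<alpha>"
        using \<delta> \<rho> by (simp add: \<epsilon>_def powr_mult[symmetric])
      finally show ?thesis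
        by (simp add: K_def mult_ac)
    qed
    ultimately show ?thesis
      using N(1) by blast
  qed
  moreover have "0 < \<rho> / (2 * card X)"
    using \<rho>(1) cX by simp
  ultimately show ?thesis
    using pos(3) by blast
qed

text \<open>A limit of approximate violations would be an affine relation satisfied by a row of \<open>F\<close>, which is excluded
  by \<open>nonplanar_minor\<close> applied to a line.\<close>

lemma escape_uniform:
  assumes c: "c \<in> msupp \<mu>" and r: "0 < r" and sub: "ball c r \<subseteq> \<Omega>"
  shows "\<exists>\<eta>>0. \<forall>q b. 1 \<le> norm q \<longrightarrow> (\<exists>y\<in>ball c r \<inter> msupp \<mu>. \<eta> \<le> \<bar>(F y *v q) $ j + b\<bar>)"
proof (rule ccontr)
  define R where "R \<eta> q b \<longleftrightarrow> (\<forall>y\<in>ball c r \<inter> msupp \<mu>. \<bar>(F y *v q) $ j + b\<bar> < \<eta>)" for \<eta> q b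
  assume "\<not> ?thesis"
  then have neg: "\<And>\<eta>. 0 < \<eta> \<Longrightarrow> \<exists>q b. 1 \<le> norm q \<and> R \<eta> q b"
    unfolding R_def by (meson not_le)
  have "\<exists>q b. 1 \<le> norm q \<and> R (1 / real (Suc n)) q b" for n
    by (rule neg) simp
  then obtain q b where q: "\<And>n. 1 \<le> norm (q n)" and Rn: "\<And>n. R (1 / real (Suc n)) (q n) (b n)"
    by metis
  define e where "e n = q n /\<^sub>R norm (q n)" for n
  have norm_e: "norm (e n) = 1" for n
  proof -
    have "norm (q n) \<noteq> 0"
      using q[of n] by linarith
    then show ?thesis
      by (simp add: e_def)
  qed
  have "bounded (range e)"
    using norm_e by (intro boundedI[of _ 1]) auto
  then obtain l \<sigma> where \<sigma>: "strict_mono (\<sigma> :: nat \<Rightarrow> nat)" "(e \<circ> \<sigma>) \<longlonglongrightarrow> l"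
    using bounded_imp_convergent_subsequence by blast
  have "norm l = 1"
    using tendsto_norm[OF \<sigma>(2)] by (simp add: norm_e comp_def LIMSEQ_const_iff)
  then have "l \<noteq> 0" by auto
  \<comment> \<open>Subtracting the value at \<open>c\<close> removes \<open>b\<close>, over which
    there is no control.\<close>
  have const: "(F y *v l) $ j = (F c *v l) $ j" if y: "y \<in> ball c r \<inter> msupp \<mu>" for y
  proof -
    have cc: "c \<in> ball c r \<inter> msupp \<mu>"
      using c r by simp
    have bound: "\<bar>((F y - F c) *v e n) $ j\<bar> \<le> 2 * (1 / real (Suc n))" for n
    proof -
      have "\<bar>((F y - F c) *v q n) $ j\<bar> = \<bar>((F y *v q n) $ j + b n) - ((F c *v q n) $ j + b n)\<bar>"
        by (simp add: matrix_vector_mult_diff_rdistrib)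
      also have "\<dots> \<le> 2 * (1 / real (Suc n))"
        using Rn[of n, unfolded R_def, rule_format, OF y] Rn[of n, unfolded R_def, rule_format, OF cc] by linarith
      finally have "\<bar>((F y - F c) *v q n) $ j\<bar> \<le> 2 * (1 / real (Suc n))" .
      moreover have "((F y - F c) *v e n) $ j = ((F y - F c) *v q n) $ j / norm (q n)"
        by (simp add: e_def matrix_vector_mult_scaleR divide_inverse)
      moreover have "\<bar>((F y - F c) *v q n) $ j\<bar> / norm (q n) \<le> \<bar>((F y - F c) *v q n) $ j\<bar> / 1"
        using q[of n] by (intro divide_left_mono) auto
      ultimately show ?thesis
        by (simp add: abs_divide)
    qed
    have "(\<lambda>n. ((F y - F c) *v e (\<sigma> n)) $ j) \<longlonglongrightarrow> ((F y - F c) *v l) $ j"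
      using \<sigma>(2) unfolding comp_def matrix_vector_mult_def vec_lambda_beta
      by (intro tendsto_intros)
    moreover have "(\<lambda>n. ((F y - F c) *v e (\<sigma> n)) $ j) \<longlonglongrightarrow> 0"
    proof (rule Lim_null_comparison)
      show "\<forall>\<^sub>F n in sequentially. norm (((F y - F c) *v e (\<sigma> n)) $ j) \<le> 2 * (1 / real (Suc (\<sigma> n)))"
        using bound by simp
      show "(\<lambda>n. 2 * (1 / real (Suc (\<sigma> n)))) \<longlonglongrightarrow> 0"
        using tendsto_mult_left[OF LIMSEQ_subseq_LIMSEQ[OF LIMSEQ_Suc[OF lim_inverse_n'] \<sigma>(1)], of 2]
        by (simp add: comp_def)
    qed
    ultimately have "((F y - F c) *v l) $ j = 0"
      using LIMSEQ_unique by blast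
    then show ?thesis
      by (simp add: matrix_vector_mult_diff_rdistrib)
  qed
  \<comment> \<open>The limiting relation as a point of the graph in row \<open>j\<close>. For a
    line both alternatives in \<open>nonplanar_minor\<close> force \<open>f 0 = Inl j\<close>, and
    that coordinate of \<open>block_act\<close> vanishes on the support in the ball.\<close>
  define w :: "real ^ ('m + 'n)" where
    "w = (\<chi> s. case s of Inl j' \<Rightarrow> if j' = j then (F c *v l) $ j else 0 | Inr i \<Rightarrow> l $ i)"
  have w_Inr: "w $ Inr i = l $ i" for i
    by (simp add: w_def)
  have "w \<noteq> 0"
  proof
    assume "w = 0"
    then have "l $ i = 0" for i
      using w_Inr[of i] by simp
    with \<open>l \<noteq> 0\<close> show False
      by (simp add: vec_eq_iff)
  qed
  then have ind: "lin_indep 1 (\<lambda>_. w)"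
    by (simp add: lin_indep_def)
  have wX: "w \<in> coord_space (Inl ` {j} \<union> range Inr)"
    by (auto simp: coord_space_def w_def split: sum.split)
  obtain y f where y: "y \<in> ball c r \<inter> msupp \<mu>"
      and f: "f ` {..<1} \<subseteq> Inl ` {j} \<or> Inl ` {j} \<subseteq> f ` {..<1::nat}"
      and nz: "dt 1 (\<lambda>a c. block_act (F y) w $ f a) \<noteq> 0"
    using nonplanar_minor[OF nonplanar_image[OF c r sub] ind, of "{j}"] wX by blast
  have "f 0 = Inl j"
    using f by auto
  then have "dt 1 (\<lambda>a c. block_act (F y) w $ f a) = block_act (F y) w $ Inl j"
    using dt_laplace_row[of 0 1 "\<lambda>a c. block_act (F y) w $ f a"] by simp
  also have "\<dots> = (F y *v l) $ j - (F c *v l) $ j"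
    by (simp add: block_act_Inl w_def matrix_vector_mult_def)
  also have "\<dots> = 0"
    using const[OF y] by simp
  finally show False
    using nz by simp
qed

section \<open>Maximal inequality and inhomogeneous transference\<close>

definition heavy_point :: "(real ^ 'd) set \<Rightarrow> real \<Rightarrow> real ^ 'd \<Rightarrow> bool" where
  "heavy_point H r x \<longleftrightarrow>
    (\<exists>\<rho>>0. \<rho> \<le> 2 * r / 5 \<and>
      emeasure \<mu> (ball x \<rho>) \<le> 2 * emeasure \<mu> (H \<inter> ball x \<rho>))"

text \<open>The weak-type maximal inequality at level one half: Vitali's lemma selects disjoint
  balls, each at least half filled by \<open>H\<close>, whose enlargements cover the heavy
  points.\<close>

lemma heavy_points:
  assumes H: "H \<in> sets \<mu>" and sub: "ball c (3 * r) \<subseteq> \<Omega>"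
  shows "outer_le \<mu> {x \<in> ball c r \<inter> msupp \<mu>. heavy_point H r x}
      ((2 * D ^ 3) * emeasure \<mu> H)"
proof -
  define E where "E = {x \<in> ball c r \<inter> msupp \<mu>. heavy_point H r x}"
  then have "\<forall>x\<in>E. \<exists>\<rho>. 0 < \<rho> \<and> \<rho> \<le> 2 * r / 5 \<and> emeasure \<mu> (ball x \<rho>) \<le> 2 * emeasure \<mu> (H \<inter> ball x \<rho>)"
    unfolding heavy_point_def by blast
  then obtain \<rho> where \<rho>: "\<And>x. x \<in> E \<Longrightarrow> 0 < \<rho> x \<and> \<rho> x \<le> 2 * r / 5"
      "\<And>x. x \<in> E \<Longrightarrow> emeasure \<mu> (ball x (\<rho> x)) \<le> 2 * emeasure \<mu> (H \<inter> ball x (\<rho> x))"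
    by metis
  have sub5: "ball x (5 * \<rho> x) \<subseteq> \<Omega>" if "x \<in> E" for x
  proof -
    have "ball x (5 * \<rho> x) \<subseteq> ball c (3 * r)"
      using \<rho>(1)[OF that] that by (auto simp: E_def ball_subset_ball_iff dist_commute)
    with sub show ?thesis by blast
  qed
  have sub1: "ball x s \<subseteq> \<Omega>" if "x \<in> E" "s \<le> \<rho> x" for x s
    using sub5[OF that(1)] \<rho>(1)[OF that(1)] that(2) subset_ball[of s "5 * \<rho> x" x] by auto
  have "outer_le \<mu> E
      ((2 * D ^ 3) * emeasure \<mu> H)"
  proof (rule vitali_outer[where \<rho> = \<rho> and N = "\<lambda>x. ball x (5 * \<rho> x)" and R = "2 * r / 5"])
    fix x assume x: "x \<in> E"
    have "emeasure \<mu> (ball x (5 * \<rho> x)) \<le> D ^ 3 * emeasure \<mu> (ball x (5 * \<rho> x / 10))"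
      using x \<rho>(1)[OF x] sub5[OF x] by (intro doubling3) (auto simp: E_def)
    also have "\<dots> \<le> D ^ 3 * emeasure \<mu> (ball x (\<rho> x))"
      using \<rho>(1)[OF x] ball_sets[OF sub1[OF x order_refl]]
      by (intro mult_left_mono emeasure_mono subset_ball) auto
    also have "\<dots> \<le> D ^ 3 * (2 * emeasure \<mu> (H \<inter> ball x (\<rho> x)))"
      using \<rho>(2)[OF x] by (intro mult_left_mono) auto
    finally show "emeasure \<mu> (ball x (5 * \<rho> x)) \<le> 2 * D ^ 3 * emeasure \<mu> (H \<inter> ball x (\<rho> x))"
      by (simp add: mult_ac)
  qed (use \<rho>(1) sub1 sub5 ball_sets H in auto)
  then show ?thesis
    by (simp add: E_def)
qed

text \<open>About a solution for the thresholds \<open>b\<close>, take a ball of nearly maximal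
  radius on which all forms stay below \<open>a\<close>. On the doubled ball some form reaches its
  \<open>a j\<close>, so goodness makes the solution set there a fraction \<theta>. If the centre is
  not heavy, at least half of the Vitali ball lies outside \<open>H\<close>, hence up to a null set
  in \<open>G i\<close>; these sets are disjoint for different \<open>i\<close>, so the sum over all
  \<open>i\<close> is bounded by a multiple of \<theta> times the total mass.\<close>

lemma transference_step:
  fixes g :: "'i \<Rightarrow> 'm \<Rightarrow> real ^ 'n::{finite,linorder} ^ 'm::{finite,linorder} \<Rightarrow> real"
  assumes I: "countable I" and g: "\<And>i j. g i j \<in> minor_span"
    and ab: "\<And>j. j \<in> J \<Longrightarrow> 0 < b j \<and> b j \<le> a j \<and> C * (b j / a j) powr \<alpha> \<le> \<theta>"
    and H: "H \<in> sets \<mu>"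
    and overlap: "\<And>i i' y. i \<in> I \<Longrightarrow> i' \<in> I \<Longrightarrow> i \<noteq> i' \<Longrightarrow> y \<in> ball c (3 * r) \<inter> msupp \<mu> \<Longrightarrow>
      \<forall>j\<in>J. \<bar>g i j (F y)\<bar> < a j \<Longrightarrow> \<forall>j\<in>J. \<bar>g i' j (F y)\<bar> < a j \<Longrightarrow> y \<in> H"
    and escape: "\<And>i. i \<in> I \<Longrightarrow> \<exists>y\<in>ball c r \<inter> msupp \<mu>. \<exists>j\<in>J. a j \<le> \<bar>g i j (F y)\<bar>"
    and r: "0 < r" and sub: "ball c (5 * r) \<subseteq> \<Omega>"
  shows "outer_le \<mu> {x \<in> ball c r \<inter> msupp \<mu>. \<exists>i\<in>I. \<forall>j\<in>J. \<bar>g i j (F x)\<bar> < b j}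
      ((2 * D ^ 3) * emeasure \<mu> H + (2 * D ^ 3 * ennreal \<theta>) * emeasure \<mu> \<Omega>)"
proof -
  define A where "A i = {y \<in> \<Omega>. \<forall>j\<in>J. \<bar>g i j (F y)\<bar> < a j}" for i
  have openA: "open (A i)" for i
  proof -
    have "A i = \<Omega> \<inter> (\<Inter>j\<in>J. {y \<in> \<Omega>. \<bar>g i j (F y)\<bar> < a j})"
      by (auto simp: A_def)
    then show ?thesis
      using open_sublevel[OF g open_Omega order_refl] open_Omega by (auto intro!: open_Int open_INT)
  qed
  define heavy where "heavy = {x \<in> ball c r \<inter> msupp \<mu>. heavy_point H r x}"
  have subs: "ball c s \<subseteq> \<Omega>" if "s \<le> 5 * r" for s
    using sub subset_ball[OF that, of c] by auto
  obtain Nh where Nh: "Nh \<in> sets \<mu>" "heavy \<subseteq> Nh" "emeasure \<mu> Nh \<le> (2 * D ^ 3) * emeasure \<mu> H"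
    using heavy_points[OF H subs[of "3 * r"]] r unfolding heavy_def by auto
  define E where "E i = {x \<in> ball c r \<inter> msupp \<mu>. \<forall>j\<in>J. \<bar>g i j (F x)\<bar> < b j} - heavy" for i
  define G where "G i = (A i \<inter> ball c (3 * r) \<inter> (msupp \<mu> \<inter> \<Omega>)) - H" for i
  define \<kappa> where "\<kappa> = 2 * D ^ 3 * ennreal \<theta>"
  have Gsets: "G i \<in> sets \<mu>" for i
  proof -
    have "A i \<in> sets \<mu>"
      using openA by (intro borel_sets) (auto simp: A_def)
    then show ?thesis
      unfolding G_def using ball_sets[OF subs[of "3 * r"]] r msupp_sets H by auto
  qed
  have "outer_le \<mu> (E i)
      (\<kappa> * emeasure \<mu> (G i))" if i: "i \<in> I" for i
  proof -
    have "\<exists>\<rho> N. 0 < \<rho> \<and> \<rho> \<le> 2 * r / 5 \<and> N \<in> sets \<mu> \<and> E i \<inter> ball x (5 * \<rho>) \<subseteq> N \<and>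
        emeasure \<mu> N \<le> \<kappa> * emeasure \<mu> (G i \<inter> ball x \<rho>)" if x: "x \<in> E i" for x
    proof -
      have xc: "x \<in> ball c r" "x \<in> msupp \<mu>" and xb: "\<forall>j\<in>J. \<bar>g i j (F x)\<bar> < b j" and light: "x \<notin> heavy"
        using x by (auto simp: E_def)
      define S where "S = {s. 0 < s \<and> ball x s \<inter> msupp \<mu> \<subseteq> A i}"
      have "x \<in> A i"
        using xc(1) xb ab subs[of r] r unfolding A_def by fastforce
      then obtain e where "0 < e" "ball x e \<subseteq> A i"
        using openA openE by blast
      then have "S \<noteq> {}"
        by (auto simp: S_def)
      \<comment> \<open>A larger ball about \<open>x\<close> would contain \<open>ball c r\<close>,
        where \<open>escape\<close> provides a point of the support outside
        \<open>A i\<close>.\<close>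
      moreover have "0 < s \<and> s \<le> 2 * r" if s: "s \<in> S" for s
      proof -
        have "s \<le> 2 * r"
        proof (rule ccontr)
          assume "\<not> s \<le> 2 * r"
          then have "ball c r \<subseteq> ball x s"
            using xc(1) by (auto simp: ball_subset_ball_iff)
          moreover obtain y j where "y \<in> ball c r \<inter> msupp \<mu>" "j \<in> J" "a j \<le> \<bar>g i j (F y)\<bar>"
            using escape[OF i] by blast
          ultimately show False
            using s unfolding S_def A_def by fastforce
        qed
        with s show ?thesis by (simp add: S_def)
      qed
      ultimately obtain s where s: "s \<in> S" "2 * s \<notin> S" "0 < s" "s \<le> 2 * r"
        using near_maximal_radius[of S "2 * r"] by metis
      have sub2: "ball x (2 * s) \<subseteq> \<Omega>"
      proof -
        have "ball x (2 * s) \<subseteq> ball c (5 * r)"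
          using xc(1) s(4) by (simp add: ball_subset_ball_iff dist_commute)
        with sub show ?thesis by blast
      qed
      have "\<not> ball x (2 * s) \<inter> msupp \<mu> \<subseteq> A i"
        using s(2,3) by (simp add: S_def)
      then obtain y where y: "y \<in> ball x (2 * s) \<inter> msupp \<mu>" and "y \<notin> A i"
        by blast
      then obtain j where j: "j \<in> J" and ge: "a j \<le> \<bar>g i j (F y)\<bar>"
        using sub2 unfolding A_def not_less[symmetric] by blast
      define N where "N = {z \<in> ball x (2 * s). \<bar>g i j (F z)\<bar> < b j}"
      have aj: "0 < a j"
        using ab[OF j] by linarith
      have "emeasure \<mu> N \<le> ennreal (C * (b j / a j) powr \<alpha>) * emeasure \<mu> (ball x (2 * s))"
        unfolding N_def using ab[OF j] aj s(3) by (intro good[OF g xc(2) _ sub2 _ _ y ge]) auto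
      also have "\<dots> \<le> ennreal \<theta> * (D ^ 3 * emeasure \<mu> (ball x (2 * s / 10)))"
        using ab[OF j] s(3) by (intro mult_mono ennreal_leI doubling3 xc(2) sub2) auto
      also have "\<dots> = (D ^ 3 * ennreal \<theta>) * emeasure \<mu> (ball x (s / 5))"
        by (simp add: mult_ac)
      also have "\<dots> \<le> (D ^ 3 * ennreal \<theta>) * (2 * emeasure \<mu> (G i \<inter> ball x (s / 5)))"
      proof (rule mult_left_mono)
        let ?B = "ball x (s / 5)"
        have B3: "?B \<subseteq> ball c (3 * r)"
          using xc(1) s(4) r by (simp add: ball_subset_ball_iff dist_commute)
        then have B\<Omega>: "?B \<subseteq> \<Omega>"
          using subs[of "3 * r"] r by auto
        note Bs = ball_sets[OF B\<Omega>]
        have "?B - H \<subseteq> (G i \<inter> ?B) \<union> (\<Omega> - msupp \<mu>)"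
        proof
          fix y assume y: "y \<in> ?B - H"
          have "y \<in> ball x s"
            using y s(3) by auto
          then show "y \<in> (G i \<inter> ?B) \<union> (\<Omega> - msupp \<mu>)"
            using y s(1) B3 B\<Omega> unfolding S_def G_def by blast
        qed
        moreover have null: "\<Omega> - msupp \<mu> \<in> sets \<mu>"
          using sets.Diff[OF Omega_sets msupp_sets] by (simp add: Diff_Int)
        ultimately have "emeasure \<mu> (?B - H) \<le> emeasure \<mu> ((G i \<inter> ?B) \<union> (\<Omega> - msupp \<mu>))"
          using Gsets Bs by (intro emeasure_mono) auto
        also have "\<dots> \<le> emeasure \<mu> (G i \<inter> ?B) + emeasure \<mu> (\<Omega> - msupp \<mu>)"
          using Gsets Bs null by (intro emeasure_subadditive) auto
        finally have le: "emeasure \<mu> (?B - H) \<le> emeasure \<mu> (G i \<inter> ?B)"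
          by (simp add: msupp_full)
        have "emeasure \<mu> (H \<inter> ?B) + emeasure \<mu> (?B - H) = emeasure \<mu> ((H \<inter> ?B) \<union> (?B - H))"
          using H Bs by (intro plus_emeasure) auto
        also have "(H \<inter> ?B) \<union> (?B - H) = ?B"
          by auto
        finally have split: "emeasure \<mu> ?B = emeasure \<mu> (H \<inter> ?B) + emeasure \<mu> (?B - H)" by simp
        have "\<not> emeasure \<mu> ?B \<le> 2 * emeasure \<mu> (H \<inter> ?B)"
        proof
          assume "emeasure \<mu> ?B \<le> 2 * emeasure \<mu> (H \<inter> ?B)"
          then have "heavy_point H r x"
            unfolding heavy_point_def using s(3,4) by (intro exI[of _ "s / 5"]) simp
          with light xc show False
            unfolding heavy_def by blast
        qed
        then have "emeasure \<mu> (H \<inter> ?B) \<le> emeasure \<mu> (?B - H)"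
          unfolding split by (metis add_left_mono mult_2 nle_le)
        then have "emeasure \<mu> ?B \<le> 2 * emeasure \<mu> (?B - H)"
          unfolding split by (simp add: mult_2 add_right_mono)
        also have "\<dots> \<le> 2 * emeasure \<mu> (G i \<inter> ?B)"
          using le by (intro mult_left_mono) auto
        finally show "emeasure \<mu> ?B \<le> 2 * emeasure \<mu> (G i \<inter> ?B)" .
      qed simp
      finally have "emeasure \<mu> N \<le> \<kappa> * emeasure \<mu> (G i \<inter> ball x (s / 5))"
        by (simp add: \<kappa>_def mult_ac)
      moreover have "E i \<inter> ball x (5 * (s / 5)) \<subseteq> N"
        using j s(3) by (auto simp: E_def N_def)
      moreover have "N \<in> sets \<mu>"
        unfolding N_def using open_sublevel[OF g _ sub2, of i j "b j"] sub2 by (intro borel_sets) auto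
      ultimately show ?thesis
        using s(3,4) by (intro exI[of _ "s / 5"] exI[of _ N]) auto
    qed
    then obtain \<rho> N where \<rho>N: "\<And>x. x \<in> E i \<Longrightarrow> 0 < \<rho> x \<and> \<rho> x \<le> 2 * r / 5"
        "\<And>x. x \<in> E i \<Longrightarrow> N x \<in> sets \<mu>" "\<And>x. x \<in> E i \<Longrightarrow> E i \<inter> ball x (5 * \<rho> x) \<subseteq> N x"
        "\<And>x. x \<in> E i \<Longrightarrow> emeasure \<mu> (N x) \<le> \<kappa> * emeasure \<mu> (G i \<inter> ball x (\<rho> x))"
      by metis
    show ?thesis
    proof (rule vitali_outer[where \<rho> = \<rho> and N = N and R = "2 * r / 5"])
      show "ball x (\<rho> x) \<subseteq> \<Omega>" if "x \<in> E i" for x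
      proof -
        have "ball x (\<rho> x) \<subseteq> ball c (3 * r)"
          using \<rho>N(1)[OF that] that r by (auto simp: E_def ball_subset_ball_iff dist_commute)
        then show ?thesis
          using subs[of "3 * r"] r by auto
      qed
    qed (use \<rho>N Gsets in auto)
  qed
  then obtain N where N: "\<And>i. i \<in> I \<Longrightarrow> N i \<in> sets \<mu>" "\<And>i. i \<in> I \<Longrightarrow> E i \<subseteq> N i"
      "\<And>i. i \<in> I \<Longrightarrow> emeasure \<mu> (N i) \<le> \<kappa> * emeasure \<mu> (G i)"
    by metis
  have le: "emeasure \<mu> (\<Union>i\<in>I. N i) \<le> \<kappa> * emeasure \<mu> \<Omega>"
  proof (rule emeasure_UN_le_disjoint[OF I N(1) Gsets _ N(3)])
    show "disjoint_family_on G I"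
      unfolding disjoint_family_on_def
    proof (intro ballI impI, rule ccontr)
      fix i i' assume i: "i \<in> I" "i' \<in> I" "i \<noteq> i'" "G i \<inter> G i' \<noteq> {}"
      then obtain y where y: "y \<in> G i" "y \<in> G i'" by blast
      then have "y \<in> H"
        using overlap[OF i(1-3), of y] by (auto simp: G_def A_def)
      with y show False by (simp add: G_def)
    qed
    show "G i \<subseteq> \<Omega>" for i
      by (auto simp: G_def)
  qed (use Omega_sets in auto)
  have Ns: "(\<Union>i\<in>I. N i) \<in> sets \<mu>"
    using I N(1) by (intro sets.countable_UN') auto
  have "{x \<in> ball c r \<inter> msupp \<mu>. \<exists>i\<in>I. \<forall>j\<in>J. \<bar>g i j (F x)\<bar> < b j} \<subseteq> Nh \<union> (\<Union>i\<in>I. N i)"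
    using Nh(2) N(2) unfolding E_def by blast
  moreover have "emeasure \<mu> (Nh \<union> (\<Union>i\<in>I. N i)) \<le> (2 * D ^ 3) * emeasure \<mu> H + \<kappa> * emeasure \<mu> \<Omega>"
    using emeasure_subadditive[OF Nh(1) Ns] add_mono[OF Nh(3) le] by (rule order_trans)
  ultimately show ?thesis
    using Nh(1) Ns unfolding \<kappa>_def by (intro bexI[of _ "Nh \<union> (\<Union>i\<in>I. N i)"]) auto
qed

end

section \<open>Discretization of the parameter\<close>

lemma countable_int_vectors: "countable (UNIV :: (int ^ 'n::finite) set)"
proof -
  have "countable (UNIV :: ('n \<Rightarrow> int) set)"
    using countable_PiE[of "UNIV :: 'n set" "\<lambda>_. UNIV :: int set"] by simp
  moreover have "(UNIV :: (int ^ 'n) set) = range vec_lambda"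
    by (metis UNIV_eq_I rangeI vec_lambda_eta)
  ultimately show ?thesis
    by simp
qed

lemma exp_decay:
  assumes "0 < s" "0 < \<eta>"
  shows "\<exists>n0. \<forall>n\<ge>n0. exp (- (s * real n)) \<le> \<eta>"
proof (intro exI allI impI)
  fix n assume "nat \<lceil>- ln \<eta> / s\<rceil> \<le> n"
  then have "- ln \<eta> / s \<le> real n"
    by linarith
  then have "- (s * real n) \<le> ln \<eta>"
    using assms(1) by (simp add: field_simps)
  then have "exp (- (s * real n)) \<le> exp (ln \<eta>)"
    by simp
  then show "exp (- (s * real n)) \<le> \<eta>"
    using assms(2) by simp
qed

section \<open>Approximability at integer times\<close>

abbreviation linear_form ::
  "real ^ 'n::finite ^ 'm \<Rightarrow> real ^ 'm \<Rightarrow> int ^ 'n \<Rightarrow> int ^ 'm \<Rightarrow> 'm \<Rightarrow> real" where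
  "linear_form Y z q p j \<equiv> (Y *v (\<chi> i. real_of_int (q $ i))) $ j + z $ j - real_of_int (p $ j)"

text \<open>The parameter is discretised as \<open>exp n\<close>. Rows of weight 0 are left out,
  which only enlarges the set to be bounded.\<close>

definition approximable ::
  "real ^ ('m::finite + 'n::finite) \<Rightarrow> real ^ 'm \<Rightarrow> real \<Rightarrow> nat \<Rightarrow> real ^ 'n ^ 'm \<Rightarrow> bool" where
  "approximable r z \<epsilon> n Y \<longleftrightarrow> (\<exists>(q :: int ^ 'n) (p :: int ^ 'm). q \<noteq> 0 \<and>
    (\<forall>j. 0 < r $ Inl j \<longrightarrow> \<bar>linear_form Y z q p j\<bar>
        < exp (- ((1 + \<epsilon>) * real n * r $ Inl j))) \<and>
    (\<forall>i. real_of_int \<bar>q $ i\<bar> < exp (real n * r $ Inr i)))"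

text \<open>Rounding \<open>ln Q\<close> up relaxes the bounds on \<open>q\<close> but tightens
  those on the forms by at most one unit of time; for large \<open>Q\<close> half of \<epsilon>
  absorbs this.\<close>

lemma VWA_imp_frequently_approximable:
  assumes r: "\<And>s. 0 \<le> r $ s" and "VWA r Y z"
  shows "\<exists>k. \<exists>\<^sub>F n in sequentially. approximable r z (1 / real (Suc k)) n Y"
proof -
  obtain \<epsilon> where \<epsilon>: "0 < \<epsilon>" and VWA: "\<And>T. \<exists>Q>T. 1 < Q \<and>
      (\<exists>(q :: int ^ 'b) (p :: int ^ 'a). q \<noteq> 0 \<and>
        (\<forall>j. \<bar>linear_form Y z q p j\<bar>
              < Q powr (- (1 + \<epsilon>) * r $ Inl j)) \<and>
        (\<forall>i. real_of_int \<bar>q $ i\<bar> < Q powr (r $ Inr i)))"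
    using assms(2) unfolding VWA_def by blast
  obtain k where k: "1 / real (Suc k) < \<epsilon> / 2"
    using \<epsilon> nat_approx_posE[of "\<epsilon> / 2"] by auto
  define \<eta> where "\<eta> = 1 / real (Suc k)"
  have \<eta>: "0 \<le> \<eta>" "\<eta> \<le> \<epsilon> / 2"
    using k by (auto simp: \<eta>_def)
  have "\<exists>n\<ge>m. approximable r z \<eta> n Y" for m
  proof -
    \<comment> \<open>The second entry of the maximum is what yields
      \<open>(1 + \<epsilon> / 2) * (L + 1) \<le> (1 + \<epsilon>) * L\<close> below.\<close>
    from VWA[of "exp (max (real m) (2 * (1 + \<epsilon>) / \<epsilon>))"]
    obtain Q q p where Q: "exp (max (real m) (2 * (1 + \<epsilon>) / \<epsilon>)) < Q" "1 < Q"
      and q: "(q :: int ^ 'b) \<noteq> 0"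
      and p: "\<forall>j. \<bar>linear_form Y z q p j\<bar>
              < Q powr (- (1 + \<epsilon>) * r $ Inl j)"
      and qQ: "\<forall>i. real_of_int \<bar>q $ i\<bar> < Q powr (r $ Inr i)"
      by (elim exE conjE) (rule that; assumption)
    define L where "L = ln Q"
    have Q_exp: "Q = exp L"
      using Q(2) by (simp add: L_def)
    have L: "max (real m) (2 * (1 + \<epsilon>) / \<epsilon>) < L" "0 < L"
      using Q unfolding Q_exp by (simp_all only: exp_less_cancel_iff one_less_exp_iff)
    have powr: "Q powr x = exp (x * L)" for x
      using Q(2) by (simp add: powr_def L_def)
    define n where "n = nat \<lceil>L\<rceil>"
    have n: "L \<le> real n" "real n \<le> L + 1"
      using L(2) by (auto simp: n_def)
    have "(1 + \<eta>) * real n \<le> (1 + \<epsilon> / 2) * (L + 1)"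
      using \<eta> \<epsilon> n by (intro mult_mono) auto
    also have "\<dots> \<le> (1 + \<epsilon>) * L"
    proof -
      define P where "P = \<epsilon> * L"
      have "2 * (1 + \<epsilon>) \<le> P"
        using L(1) \<epsilon> by (simp add: P_def field_simps)
      moreover have e1: "(1 + \<epsilon> / 2) * (L + 1) = L + P / 2 + (1 + \<epsilon> / 2)"
        by (simp add: P_def field_simps)
      moreover have e2: "(1 + \<epsilon>) * L = L + P"
        by (simp add: P_def field_simps)
      ultimately show ?thesis
        unfolding e1 e2 using \<epsilon> by (simp add: field_simps)
    qed
    finally have main: "(1 + \<eta>) * real n \<le> (1 + \<epsilon>) * L" .
    have "approximable r z \<eta> n Y"
      unfolding approximable_def
    proof (intro exI[of _ q] exI[of _ p] conjI allI impI q)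
      fix j
      have "((1 + \<eta>) * real n) * r $ Inl j \<le> ((1 + \<epsilon>) * L) * r $ Inl j"
        using main r by (intro mult_right_mono)
      then have "Q powr (- (1 + \<epsilon>) * r $ Inl j) \<le> exp (- ((1 + \<eta>) * real n * r $ Inl j))"
        unfolding powr by (simp add: algebra_simps)
      with p[rule_format, of j] show "\<bar>linear_form Y z q p j\<bar>
          < exp (- ((1 + \<eta>) * real n * r $ Inl j))"
        by linarith
    next
      fix i
      have "r $ Inr i * L \<le> r $ Inr i * real n"
        using n(1) r by (intro mult_left_mono)
      then have "Q powr (r $ Inr i) \<le> exp (real n * r $ Inr i)"
        unfolding powr by (simp add: mult.commute)
      with qQ[rule_format, of i] show "real_of_int \<bar>q $ i\<bar> < exp (real n * r $ Inr i)"
        by linarith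
    qed
    moreover have "m \<le> n"
      using L n by linarith
    ultimately show ?thesis by blast
  qed
  then show ?thesis
    unfolding frequently_sequentially \<eta>_def by blast
qed

text \<open>Measurability allows the almost everywhere statement to pass to the image measure. For
  fixed \<epsilon> and \<open>T\<close> the set is a union of open sets over all \<open>Q\<close>,
  and monotonicity reduces the quantifiers over \<epsilon> and \<open>T\<close> to countable
  ones.\<close>

lemma sets_VWA:
  fixes r :: "real ^ ('m::finite + 'n::finite)"
  assumes r: "\<And>s. 0 \<le> r $ s"
  shows "{Y. VWA r Y z} \<in> sets borel"
proof -
  define O' where "O' \<epsilon> Q q p = {Y :: real ^ 'n ^ 'm. q \<noteq> 0 \<and>
        (\<forall>j. \<bar>linear_form Y z q p j\<bar>
              < Q powr (- (1 + \<epsilon>) * r $ Inl j)) \<and>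
        (\<forall>i. real_of_int \<bar>q $ i\<bar> < Q powr (r $ Inr i))}" for \<epsilon> Q q p
  define G where "G \<epsilon> T = (\<Union>Q\<in>{Q. T < Q \<and> 1 < Q}. \<Union>q. \<Union>p. O' \<epsilon> Q q p)" for \<epsilon> T
  have "open (O' \<epsilon> Q q p)" for \<epsilon> Q q p
  proof -
    have cont: "continuous_on UNIV (\<lambda>Y :: real ^ 'n ^ 'm.
        \<bar>linear_form Y z q p j\<bar>)" for j
      unfolding matrix_vector_mult_def vec_lambda_beta by (intro continuous_intros)
    let ?G = "\<Inter>j. {Y :: real ^ 'n ^ 'm.
      \<bar>linear_form Y z q p j\<bar> < Q powr (- (1 + \<epsilon>) * r $ Inl j)}"
    have G: "open ?G"
      by (rule open_INT) (simp_all only: finite_class.finite_UNIV open_Collect_less[OF cont continuous_on_const] ball_simps simp_thms)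
    show ?thesis
    proof (cases "q \<noteq> 0 \<and> (\<forall>i. real_of_int \<bar>q $ i\<bar> < Q powr (r $ Inr i))")
      case True
      then have "O' \<epsilon> Q q p = ?G"
        unfolding O'_def by auto
      with G show ?thesis
        by (simp only:)
    next
      case False
      then have "O' \<epsilon> Q q p = {}"
        unfolding O'_def by auto
      then show ?thesis
        by (simp only: open_empty)
    qed
  qed
  then have openG: "open (G \<epsilon> T)" for \<epsilon> T
    unfolding G_def by (intro open_UN ballI)
  have VWA_iff: "VWA r Y z \<longleftrightarrow> (\<exists>\<epsilon>>0. \<forall>T. Y \<in> G \<epsilon> T)" for Y
    by (simp only: VWA_def G_def O'_def UN_iff mem_Collect_eq Bex_def UNIV_I simp_thms conj_assoc)
  have mono: "G \<epsilon> T \<subseteq> G \<epsilon>' T'" if "\<epsilon>' \<le> \<epsilon>" "T' \<le> T" for \<epsilon> \<epsilon>' T T'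
  proof
    fix Y assume "Y \<in> G \<epsilon> T"
    then obtain Q q p where Q: "T < Q" "1 < Q" and Y: "Y \<in> O' \<epsilon> Q q p"
      by (auto simp: G_def)
    have "Q powr (- (1 + \<epsilon>) * r $ Inl j) \<le> Q powr (- (1 + \<epsilon>') * r $ Inl j)" for j
      using Q(2) r that(1) by (intro powr_mono mult_right_mono) auto
    then have "Y \<in> O' \<epsilon>' Q q p"
      using Y unfolding O'_def by (blast intro: less_le_trans)
    then show "Y \<in> G \<epsilon>' T'"
      using Q that(2) unfolding G_def by (intro UN_I[of Q] UN_I[of q] UN_I[of p]) auto
  qed
  have "{Y. VWA r Y z} = (\<Union>k::nat. \<Inter>T::nat. G (1 / real (Suc k)) (real T))"
  proof (intro equalityI subsetI)
    fix Y assume "Y \<in> {Y. VWA r Y z}"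
    then obtain \<epsilon> where \<epsilon>: "0 < \<epsilon>" "\<And>T. Y \<in> G \<epsilon> T"
      by (auto simp: VWA_iff)
    obtain k where "1 / real (Suc k) < \<epsilon>"
      using \<epsilon>(1) nat_approx_posE by auto
    then have "Y \<in> G (1 / real (Suc k)) (real T)" for T
      using \<epsilon>(2) mono[of "1 / real (Suc k)" \<epsilon> "real T" "real T"] by auto
    then show "Y \<in> (\<Union>k::nat. \<Inter>T::nat. G (1 / real (Suc k)) (real T))"
      by blast
  next
    fix Y assume "Y \<in> (\<Union>k::nat. \<Inter>T::nat. G (1 / real (Suc k)) (real T))"
    then obtain k where k: "\<And>T::nat. Y \<in> G (1 / real (Suc k)) (real T)"
      by blast
    have "Y \<in> G (1 / real (Suc k)) T" for T
    proof -
      obtain T' :: nat where "T \<le> real T'"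
        using real_arch_simple by blast
      then show ?thesis
        using k mono[OF order_refl] by blast
    qed
    then have "\<exists>\<epsilon>>0. \<forall>T. Y \<in> G \<epsilon> T"
      by (intro exI[of _ "1 / real (Suc k)"]) auto
    then show "Y \<in> {Y. VWA r Y z}"
      by (simp add: VWA_iff)
  qed
  moreover have "(\<Union>k::nat. \<Inter>T::nat. G (1 / real (Suc k)) (real T)) \<in> sets borel"
    using openG by (intro sets.countable_UN sets.countable_INT'' borel_open) auto
  ultimately show ?thesis
    by simp
qed

context local_data
begin

text \<open>The homogeneous flow uses exponents \<open>(1 + \<epsilon> / 4) r\<close>: differences of two solutions with \<open>\<epsilon> / 2\<close> are then
  contracted in every coordinate of positive weight, and a coordinate of \<open>q\<close> of weight 0 vanishes because it is an
  integer of modulus less than 1.\<close>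

theorem approximable_decay:
  fixes r :: "real ^ ('m + 'n)" and z :: "real ^ 'm::{finite,linorder}"
  assumes r: "\<And>s. 0 \<le> r $ s" and sum_l: "(\<Sum>j\<in>UNIV. r $ Inl j) = 1" and sum_r: "(\<Sum>i\<in>UNIV. r $ Inr i) = 1"
    and \<epsilon>: "0 < \<epsilon>" and c: "c \<in> msupp \<mu>" and R: "0 < R"
    and sub: "ball c (5 ^ (CARD('m) + CARD('n)) * (3 * R)) \<subseteq> \<Omega>"
  shows "\<exists>\<gamma>>0. \<exists>K\<ge>0. \<exists>n0. \<forall>n\<ge>n0. \<exists>N\<in>sets \<mu>.
    {x \<in> ball c R \<inter> msupp \<mu>. approximable r z \<epsilon> n (F x)} \<subseteq> N \<and>
    emeasure \<mu> N \<le> ennreal (K * exp (- (\<gamma> * real n)))"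
proof -
  define J where "J = {j. 0 < r $ Inl j}"
  define X :: "('m + 'n) set" where "X = Inl ` J \<union> range Inr"
  \<comment> \<open>The smallest positive weight governs all rates of decay: each coordinate of
    positive weight decays at least at its rate.\<close>
  define rm where "rm = Min ((\<lambda>s. r $ s) ` {s. 0 < r $ s})"
  obtain j0 where j0: "j0 \<in> J"
  proof -
    have "\<exists>j. r $ Inl j \<noteq> 0"
    proof (rule ccontr)
      assume "\<not> ?thesis"
      with sum_l show False by simp
    qed
    with r that show thesis
      unfolding J_def by (metis (mono_tags) le_less mem_Collect_eq)
  qed
  have rm_le: "rm \<le> r $ s" if "0 < r $ s" for s
    unfolding rm_def using that by (intro Min_le) auto
  have "rm \<in> (\<lambda>s. r $ s) ` {s. 0 < r $ s}"
    unfolding rm_def using j0 by (intro Min_in) (auto simp: J_def)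
  then have rm: "0 < rm" by auto
  define wt :: "real ^ ('m + 'n)" where
    "wt = (\<chi> s. case s of Inl j \<Rightarrow> (1 + \<epsilon> / 4) * r $ Inl j | Inr i \<Rightarrow> - ((1 + \<epsilon> / 4) * r $ Inr i))"
  have wt: "wt $ Inl j = (1 + \<epsilon> / 4) * r $ Inl j" "wt $ Inr i = - ((1 + \<epsilon> / 4) * r $ Inr i)" for i j
    by (simp_all add: wt_def)
  have "(\<Sum>j\<in>J. r $ Inl j) = (\<Sum>j\<in>UNIV. r $ Inl j)"
    using r by (intro sum.mono_neutral_left) (auto simp: J_def not_less intro: antisym)
  then have sumJ: "(\<Sum>j\<in>J. r $ Inl j) = 1"
    using sum_l by simp
  have "(\<Sum>s\<in>X. wt $ s) = (\<Sum>s\<in>Inl ` J. wt $ s) + (\<Sum>s\<in>range Inr. wt $ s)"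
    unfolding X_def by (intro sum.union_disjoint) auto
  also have "\<dots> = (\<Sum>j\<in>J. wt $ Inl j) + (\<Sum>i\<in>UNIV. wt $ Inr i)"
    by (simp add: sum.reindex)
  also have "\<dots> = (1 + \<epsilon> / 4) * (\<Sum>j\<in>J. r $ Inl j) - (1 + \<epsilon> / 4) * (\<Sum>i\<in>UNIV. r $ Inr i)"
    by (simp add: wt sum_distrib_left sum_negf)
  finally have wt_sum: "(\<Sum>s\<in>X. wt $ s) = 0"
    by (simp add: sumJ sum_r)
  have subs: "ball c s \<subseteq> \<Omega>" if "s \<le> 5 ^ (CARD('m) + CARD('n)) * (3 * R)" for s
    using sub subset_ball[OF that, of c] by auto
  have five: "(5::real) ^ k \<le> 5 ^ (CARD('m) + CARD('n))" if "k \<le> CARD('m) + CARD('n)" for k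
    using that by (intro power_increasing) auto
  have cX: "card X \<le> CARD('m) + CARD('n)"
    using card_mono[of UNIV X] by simp
  have sub5: "ball c (5 * R) \<subseteq> \<Omega>"
  proof (rule subs)
    have "(5::real) ^ 1 \<le> 5 ^ (CARD('m) + CARD('n))"
      by (rule five) (simp add: Suc_leI)
    then have "5 \<le> (5::real) ^ (CARD('m) + CARD('n))"
      by (simp only: power_one_right)
    then have "5 * (3 * R) \<le> 5 ^ (CARD('m) + CARD('n)) * (3 * R)"
      by (rule mult_right_mono) (use R in simp)
    moreover have "5 * R \<le> 5 * (3 * R)"
      using R by simp
    ultimately show "5 * R \<le> 5 ^ (CARD('m) + CARD('n)) * (3 * R)"
      by (rule order_trans[rotated])
  qed
  \<comment> \<open>The radius \<open>3 * R\<close> is that of the ball in which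
    \<open>transference_step\<close> compares overlaps.\<close>
  have "\<exists>\<delta>0>0. \<exists>K\<ge>0. \<forall>t\<ge>0. \<forall>\<delta>. 0 < \<delta> \<and> \<delta> \<le> \<delta>0 \<longrightarrow>
    outer_le \<mu> (short_points X wt t \<delta> (ball c (3 * R))) (ennreal (K * \<delta> powr \<alpha>))"
    unfolding X_def
  proof (rule homogeneous[OF _ _ wt_sum[unfolded X_def] c])
    show "ball c (5 ^ card (Inl ` J \<union> range Inr :: ('m + 'n) set) * (3 * R)) \<subseteq> \<Omega>"
      unfolding X_def[symmetric] using five[OF cX] R by (intro subs mult_right_mono) auto
  qed (use r \<epsilon> R in \<open>auto simp: wt\<close>)
  then obtain \<delta>0 K1 where \<delta>0: "0 < \<delta>0" and K1: "0 \<le> K1" and hom: "\<forall>t\<ge>0. \<forall>\<delta>. 0 < \<delta> \<and> \<delta> \<le> \<delta>0 \<longrightarrow>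
    outer_le \<mu> (short_points X wt t \<delta> (ball c (3 * R))) (ennreal (K1 * \<delta> powr \<alpha>))"
    by (elim exE conjE) (rule that; assumption)
  have "ball c R \<subseteq> \<Omega>"
    using sub5 subset_ball[of R "5 * R" c] R by auto
  then obtain \<eta> where \<eta>: "0 < \<eta>" and escape: "\<And>q b. 1 \<le> norm q \<Longrightarrow>
      \<exists>y\<in>ball c R \<inter> msupp \<mu>. \<eta> \<le> \<bar>(F y *v q) $ j0 + b\<bar>"
    using escape_uniform[OF c R, of j0] by blast
  define \<sigma> where "\<sigma> = \<epsilon> / 4 * rm"
  have \<sigma>: "0 < \<sigma>"
    using \<epsilon> rm by (simp add: \<sigma>_def)
  obtain n1 where n1: "\<And>n. n1 \<le> n \<Longrightarrow> exp (- (\<sigma> * real n)) \<le> \<delta>0 / 2"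
    using exp_decay[OF \<sigma>, of "\<delta>0 / 2"] \<delta>0 by auto
  obtain n2 where n2: "\<And>n. n2 \<le> n \<Longrightarrow> exp (- (rm * real n)) \<le> \<eta>"
    using exp_decay[OF rm \<eta>] by auto
  define d3 where "d3 = enn2real (D ^ 3)"
  define M where "M = enn2real (emeasure \<mu> \<Omega>)"
  have d3: "D ^ 3 = ennreal d3" "0 \<le> d3"
    using D_finite by (simp_all add: d3_def power_less_top_ennreal)
  have M: "emeasure \<mu> \<Omega> = ennreal M" "0 \<le> M"
    using finite_Omega by (simp_all add: M_def)
  define K where "K = 2 * d3 * (K1 * 2 powr \<alpha>) + 2 * d3 * C * M"
  have K: "0 \<le> K"
    using d3(2) K1 C M(2) by (auto simp: K_def)
  have "outer_le \<mu> {x \<in> ball c R \<inter> msupp \<mu>. approximable r z \<epsilon> n (F x)}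
      (ennreal (K * exp (- (\<sigma> * \<alpha> * real n))))" if n: "max n1 n2 \<le> n" for n
  proof -
    \<comment> \<open>The factor 2 comes from the difference of two solutions.\<close>
    define \<delta> where "\<delta> = 2 * exp (- (\<sigma> * real n))"
    have \<delta>: "0 < \<delta>" "\<delta> \<le> \<delta>0"
      using n1[of n] n by (auto simp: \<delta>_def)
    from hom[rule_format, OF of_nat_0_le_iff conjI[OF \<delta>], of n]
    obtain H where H: "H \<in> sets \<mu>"
      and H_sub: "short_points X wt n \<delta> (ball c (3 * R)) \<subseteq> H"
      and H_le: "emeasure \<mu> H \<le> ennreal (K1 * \<delta> powr \<alpha>)"
      by (elim bexE conjE) (rule that; assumption)
    have expand: "exp (- (\<epsilon> / 4 * r $ s * real n)) \<le> exp (- (\<sigma> * real n))" if "0 < r $ s" for s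
    proof -
      have "\<epsilon> / 4 * rm * real n \<le> \<epsilon> / 4 * r $ s * real n"
        using rm_le[OF that] \<epsilon> by (intro mult_right_mono mult_left_mono) auto
      then show ?thesis
        by (simp add: \<sigma>_def)
    qed
    define rv :: "int ^ 'n::{finite,linorder} \<Rightarrow> real ^ 'n::{finite,linorder}" where "rv q = (\<chi> i. real_of_int (q $ i))" for q
    \<comment> \<open>Setting \<open>p\<close> to 0 outside \<open>J\<close> makes distinct pairs
      differ in a coordinate of \<open>X\<close>; otherwise pairs differing only in rows of weight 0
      would define the same set.\<close>
    define I :: "((int ^ 'n::{finite,linorder}) \<times> (int ^ 'm::{finite,linorder})) set" where
      "I = {(q, p). q \<noteq> 0 \<and> (\<forall>i. real_of_int \<bar>q $ i\<bar> < exp (real n * r $ Inr i)) \<and> (\<forall>j. j \<notin> J \<longrightarrow> p $ j = 0)}"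
    define g where "g i j Y = (Y *v rv (fst i)) $ j + (z $ j - real_of_int (snd i $ j))" for i j Y
    \<comment> \<open>The thresholds for \<epsilon> / 2 and for \<epsilon>; their quotient
      \<open>exp (- (\<epsilon> / 2 * r $ Inl j * real n))\<close> is what goodness converts into
      \<theta>.\<close>
    define a where "a j = exp (- ((1 + \<epsilon> / 2) * real n * r $ Inl j))" for j
    define b where "b j = exp (- ((1 + \<epsilon>) * real n * r $ Inl j))" for j
    define \<theta> where "\<theta> = C * exp (- (\<sigma> * \<alpha> * real n))"
    have "outer_le \<mu> {x \<in> ball c R \<inter> msupp \<mu>. \<exists>i\<in>I. \<forall>j\<in>J. \<bar>g i j (F x)\<bar> < b j}
      ((2 * D ^ 3) * emeasure \<mu> H + (2 * D ^ 3 * ennreal \<theta>) * emeasure \<mu> \<Omega>)"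
    proof (rule transference_step[where a = a])
      show "countable I"
        by (rule countable_subset[OF subset_UNIV])
          (simp add: UNIV_Times_UNIV[symmetric] countable_int_vectors del: UNIV_Times_UNIV)
      show "g i j \<in> minor_span" for i j
        unfolding g_def by (rule affine_row_in_span)
      show "0 < b j \<and> b j \<le> a j \<and> C * (b j / a j) powr \<alpha> \<le> \<theta>" if "j \<in> J" for j
      proof -
        have rj: "0 < r $ Inl j"
          using that by (simp add: J_def)
        have ba: "b j / a j = exp (- (\<epsilon> / 2 * r $ Inl j * real n))"
          by (simp add: a_def b_def exp_diff[symmetric] algebra_simps)
        have "b j \<le> a j"
          using \<epsilon> r by (auto simp: a_def b_def intro!: mult_right_mono)
        moreover have "(b j / a j) powr \<alpha> \<le> exp (- (\<sigma> * real n)) powr \<alpha>"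
        proof (intro powr_mono2)
          have "- (\<epsilon> / 2 * r $ Inl j * real n) \<le> - (\<epsilon> / 4 * r $ Inl j * real n)"
            using \<epsilon> rj by simp
          then have "b j / a j \<le> exp (- (\<epsilon> / 4 * r $ Inl j * real n))"
            unfolding ba by simp
          also have "\<dots> \<le> exp (- (\<sigma> * real n))"
            by (rule expand[OF rj])
          finally show "b j / a j \<le> exp (- (\<sigma> * real n))" .
        qed (use \<alpha> in \<open>auto simp: ba\<close>)
        then have "C * (b j / a j) powr \<alpha> \<le> \<theta>"
          using C by (simp add: \<theta>_def powr_def algebra_simps)
        ultimately show ?thesis
          by (simp add: b_def)
      qed
      show "y \<in> H"
        if ii: "i \<in> I" "i' \<in> I" "i \<noteq> i'" and y: "y \<in> ball c (3 * R) \<inter> msupp \<mu>"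
          and gi: "\<forall>j\<in>J. \<bar>g i j (F y)\<bar> < a j" "\<forall>j\<in>J. \<bar>g i' j (F y)\<bar> < a j" for i i' y
      proof -
        \<comment> \<open>The difference of the two integer solutions: \<open>z\<close> cancels, and
          \<open>v\<close> is a nonzero integer vector that the flow makes short at
          \<open>F y\<close>.\<close>
        define v :: "real ^ ('m + 'n)" where
          "v = (\<chi> s. case s of Inl j \<Rightarrow> real_of_int (snd i $ j - snd i' $ j)
                             | Inr k \<Rightarrow> real_of_int (fst i $ k - fst i' $ k))"
        have v: "v $ Inl j = real_of_int (snd i $ j - snd i' $ j)"
            "v $ Inr k = real_of_int (fst i $ k - fst i' $ k)" for j k
          by (simp_all add: v_def)
        have "v \<noteq> 0"
        proof
          assume v0: "v = 0"
          have "snd i $ j = snd i' $ j" "fst i $ k = fst i' $ k" for j k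
            using v(1)[of j] v(2)[of k] unfolding v0 by simp_all
          then have "i = i'"
            by (simp add: prod_eq_iff vec_eq_iff)
          with ii(3) show False by blast
        qed
        moreover have "v $ s = 0" if "s \<notin> X" for s
        proof (cases s)
          case (Inl j)
          then have "j \<notin> J"
            using that by (auto simp: X_def)
          then have "snd i $ j = 0" "snd i' $ j = 0"
            using ii(1,2) by (auto simp: I_def)
          then show ?thesis
            by (simp add: Inl v)
        qed (use that in \<open>simp add: X_def\<close>)
        then have "v \<in> coord_space X"
          by (simp add: coord_space_def)
        moreover have "v $ s \<in> \<int>" for s
          by (cases s) (simp_all add: v)
        then have "int_vec v"
          by (simp add: int_vec_def)
        moreover have "\<bar>flow_act wt n (F y) v $ s\<bar> \<le> \<delta>" if s: "s \<in> X" for s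
        proof (cases s)
          case (Inl j)
          then have j: "j \<in> J" "0 < r $ Inl j"
            using s by (auto simp: X_def J_def)
          have "block_act (F y) v $ Inl j = g i j (F y) - g i' j (F y)"
            by (simp add: block_act_Inl v g_def rv_def matrix_vector_mult_def algebra_simps sum_subtractf)
          then have "\<bar>block_act (F y) v $ Inl j\<bar> \<le> 2 * a j"
            using gi j(1) by fastforce
          then have "exp (n * wt $ Inl j) * \<bar>block_act (F y) v $ Inl j\<bar> \<le> exp (n * wt $ Inl j) * (2 * a j)"
            by (intro mult_left_mono) auto
          also have "\<dots> = 2 * exp (- (\<epsilon> / 4 * r $ Inl j * real n))"
            by (simp add: wt a_def exp_add[symmetric] algebra_simps)
          also have "\<dots> \<le> \<delta>"
            using expand[OF j(2)] by (simp add: \<delta>_def)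
          finally show ?thesis
            by (simp add: flow_act_def Inl abs_mult)
        next
          case (Inr k)
          have q: "\<bar>real_of_int (fst i $ k)\<bar> < exp (real n * r $ Inr k)"
              "\<bar>real_of_int (fst i' $ k)\<bar> < exp (real n * r $ Inr k)"
            using ii(1,2) by (auto simp: I_def)
          show ?thesis
          proof (cases "r $ Inr k = 0")
            case True
            then have "fst i $ k = 0" "fst i' $ k = 0"
              using q by simp_all
            then show ?thesis
              using \<delta>(1) by (simp add: flow_act_def Inr block_act_Inr v)
          next
            case False
            then have rk: "0 < r $ Inr k"
              using r[of "Inr k"] by linarith
            have "\<bar>v $ Inr k\<bar> \<le> 2 * exp (real n * r $ Inr k)"
              using q unfolding v by simp
            then have "exp (n * wt $ Inr k) * \<bar>v $ Inr k\<bar> \<le> exp (n * wt $ Inr k) * (2 * exp (real n * r $ Inr k))"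
              by (intro mult_left_mono) auto
            also have "\<dots> = 2 * exp (- (\<epsilon> / 4 * r $ Inr k * real n))"
              by (simp add: wt exp_add[symmetric] algebra_simps)
            also have "\<dots> \<le> \<delta>"
              using expand[OF rk] by (simp add: \<delta>_def)
            finally show ?thesis
              by (simp add: flow_act_def Inr abs_mult block_act_Inr)
          qed
        qed
        ultimately have "has_short_vector X (flow_act wt n (F y)) \<delta>"
          unfolding has_short_vector_def by blast
        with H_sub y show ?thesis by blast
      qed
      \<comment> \<open>A nonzero integer vector has norm at least 1, so
        \<open>escape_uniform\<close> makes row \<open>j0\<close> at least \<eta> somewhere, and for
        large \<open>n\<close> the threshold \<open>a j0\<close> is below \<eta>.\<close>
      show "\<exists>y\<in>ball c R \<inter> msupp \<mu>. \<exists>j\<in>J. a j \<le> \<bar>g i j (F y)\<bar>" if i: "i \<in> I" for i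
      proof -
        have "fst i \<noteq> 0"
          using i by (auto simp: I_def)
        then obtain k where k: "fst i $ k \<noteq> 0"
          by (auto simp: vec_eq_iff)
        then have "1 \<le> \<bar>rv (fst i) $ k\<bar>"
          by (simp add: rv_def)
        also have "\<dots> \<le> norm (rv (fst i))"
          by (rule component_le_norm_cart)
        finally obtain y where y: "y \<in> ball c R \<inter> msupp \<mu>" "\<eta> \<le> \<bar>g i j0 (F y)\<bar>"
          using escape[of "rv (fst i)" "z $ j0 - real_of_int (snd i $ j0)"] unfolding g_def by blast
        have "a j0 \<le> exp (- (rm * real n))"
        proof -
          have "rm * real n \<le> (1 * r $ Inl j0) * real n"
            using rm_le[of "Inl j0"] j0 by (intro mult_right_mono) (auto simp: J_def)
          also have "\<dots> \<le> ((1 + \<epsilon> / 2) * r $ Inl j0) * real n"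
            using \<epsilon> r by (intro mult_right_mono) auto
          finally show ?thesis
            by (simp add: a_def mult_ac)
        qed
        also have "\<dots> \<le> \<eta>"
          using n2 n by simp
        finally show ?thesis
          using y j0 by (intro bexI[of _ y] bexI[of _ j0]) auto
      qed
    qed (use H R sub5 in auto)
    then obtain N where N: "N \<in> sets \<mu>" "{x \<in> ball c R \<inter> msupp \<mu>. \<exists>i\<in>I. \<forall>j\<in>J. \<bar>g i j (F x)\<bar> < b j} \<subseteq> N"
        "emeasure \<mu> N \<le> (2 * D ^ 3) * emeasure \<mu> H + (2 * D ^ 3 * ennreal \<theta>) * emeasure \<mu> \<Omega>"
      by blast
    have "\<exists>i\<in>I. \<forall>j\<in>J. \<bar>g i j (F x)\<bar> < b j" if appr: "approximable r z \<epsilon> n (F x)" for x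
    proof -
      obtain q p where q: "q \<noteq> 0"
        and p: "\<And>j. 0 < r $ Inl j \<Longrightarrow> \<bar>(F x *v rv q) $ j + z $ j - real_of_int (p $ j)\<bar> < b j"
        and qn: "\<And>i. real_of_int \<bar>q $ i\<bar> < exp (real n * r $ Inr i)"
        using appr unfolding approximable_def rv_def b_def by blast
      define p' where "p' = (\<chi> j. if j \<in> J then p $ j else 0)"
      have "(q, p') \<in> I"
        using q qn by (simp add: I_def p'_def)
      moreover have "\<bar>g (q, p') j (F x)\<bar> < b j" if "j \<in> J" for j
        using p[of j] that by (simp add: g_def p'_def J_def algebra_simps)
      ultimately show ?thesis by blast
    qed
    then have "{x \<in> ball c R \<inter> msupp \<mu>. approximable r z \<epsilon> n (F x)} \<subseteq> N"
      using N(2) by blast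
    moreover have "emeasure \<mu> N \<le> ennreal (K * exp (- (\<sigma> * \<alpha> * real n)))"
    proof -
      note N(3)
      also have "(2 * D ^ 3) * emeasure \<mu> H + (2 * D ^ 3 * ennreal \<theta>) * emeasure \<mu> \<Omega>
          \<le> (2 * D ^ 3) * ennreal (K1 * \<delta> powr \<alpha>) + (2 * D ^ 3 * ennreal \<theta>) * emeasure \<mu> \<Omega>"
        using H_le by (intro add_right_mono mult_left_mono) auto
      also have "\<dots> = ennreal (2 * d3 * (K1 * \<delta> powr \<alpha>) + 2 * d3 * \<theta> * M)"
      proof -
        have "0 \<le> \<theta>"
          using C by (simp add: \<theta>_def)
        then show ?thesis
          using d3(2) M(2) K1
          by (simp add: d3(1) M(1) ennreal_mult ennreal_plus mult_ac flip: ennreal_numeral)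
      qed
      also have "\<delta> powr \<alpha> = 2 powr \<alpha> * exp (- (\<sigma> * \<alpha> * real n))"
        by (simp add: \<delta>_def powr_mult) (simp add: powr_def mult_ac)
      also have "2 * d3 * (K1 * (2 powr \<alpha> * exp (- (\<sigma> * \<alpha> * real n)))) + 2 * d3 * \<theta> * M
          = K * exp (- (\<sigma> * \<alpha> * real n))"
        by (simp add: K_def \<theta>_def algebra_simps)
      finally show ?thesis .
    qed
    ultimately show ?thesis
      using N(1) by blast
  qed
  then show ?thesis
    using K \<sigma> \<alpha> by (intro exI[of _ "\<sigma> * \<alpha>"] exI[of _ K] conjI exI[of _ "max n1 n2"]) auto
qed

text \<open>Borel-Cantelli over integer times for each \<open>1 / real (Suc k)\<close> in place of
  \<epsilon>, and a countable union over \<open>k\<close>.\<close>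

theorem VWA_null_near:
  fixes r :: "real ^ ('m + 'n)" and z :: "real ^ 'm::{finite,linorder}"
  assumes r: "\<And>s. 0 \<le> r $ s" and sum_l: "(\<Sum>j\<in>UNIV. r $ Inl j) = 1" and sum_r: "(\<Sum>i\<in>UNIV. r $ Inr i) = 1"
    and c: "c \<in> msupp \<mu>" and R: "0 < R"
    and sub: "ball c (5 ^ (CARD('m) + CARD('n)) * (3 * R)) \<subseteq> \<Omega>"
  shows "\<exists>N\<in>null_sets \<mu>. {x \<in> ball c R \<inter> msupp \<mu>. VWA r (F x) z} \<subseteq> N"
proof -
  define Bad where "Bad k = {x \<in> ball c R \<inter> msupp \<mu>.
      \<exists>\<^sub>F n in sequentially. approximable r z (1 / real (Suc k)) n (F x)}" for k
  have "\<exists>N\<in>null_sets \<mu>. Bad k \<subseteq> N" for k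
  proof -
    let ?A = "\<lambda>n. {x \<in> ball c R \<inter> msupp \<mu>. approximable r z (1 / real (Suc k)) n (F x)}"
    have "0 < 1 / real (Suc k)"
      by simp
    from approximable_decay[OF r sum_l sum_r this c R sub, where z = z]
    obtain \<gamma> K n0 where \<gamma>: "0 < \<gamma>" and K: "0 \<le> K" and ex: "\<forall>n\<ge>n0. \<exists>N\<in>sets \<mu>.
        ?A n \<subseteq> N \<and>
        emeasure \<mu> N \<le> ennreal (K * exp (- (\<gamma> * real n)))"
      by (elim exE conjE) (rule that; assumption)
    \<comment> \<open>Below \<open>n0\<close>, where no bound is available, the empty set is used;
      \<open>limsup\<close> does not see these terms.\<close>
    define P where "P n N \<longleftrightarrow> N \<in> sets \<mu> \<and>
        (n0 \<le> n \<longrightarrow> ?A n \<subseteq> N) \<and>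
        emeasure \<mu> N \<le> ennreal (K * exp (- (\<gamma> * real n)))" for n N
    have "\<exists>N. P n N" for n
    proof (cases "n0 \<le> n")
      case True
      from ex[rule_format, OF True] show ?thesis
        unfolding P_def Bex_def by (elim exE conjE) (intro exI conjI impI; assumption)
    next
      case False
      then show ?thesis
        unfolding P_def by (intro exI[of _ "{}"]) simp
    qed
    then obtain N where "\<And>n. P n (N n)"
      by metis
    then have N: "\<And>n. N n \<in> sets \<mu>"
        "\<And>n. n0 \<le> n \<Longrightarrow> ?A n \<subseteq> N n"
        "\<And>n. emeasure \<mu> (N n) \<le> ennreal (K * exp (- (\<gamma> * real n)))"
      unfolding P_def by simp_all
    have "limsup N \<in> null_sets \<mu>"
    proof (rule borel_cantelli_limsup1[OF N(1)])
      show "emeasure \<mu> (N n) < \<infinity>" for n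
        using N(3)[of n] by (simp add: le_less_trans)
      show "summable (\<lambda>n. measure \<mu> (N n))"
      proof (rule summable_comparison_test')
        show "summable (\<lambda>n. K * exp (- \<gamma>) ^ n)"
          using \<gamma> by (intro summable_mult summable_geometric) simp
        show "norm (measure \<mu> (N n)) \<le> K * exp (- \<gamma>) ^ n" if "0 \<le> n" for n
        proof -
          have "measure \<mu> (N n) \<le> K * exp (- (\<gamma> * real n))"
            unfolding measure_def using N(3)[of n] K by (intro enn2real_leI) auto
          also have "exp (- (\<gamma> * real n)) = exp (- \<gamma>) ^ n"
            by (simp add: exp_of_nat_mult[symmetric] mult.commute)
          finally show ?thesis by simp
        qed
      qed
    qed
    moreover have "Bad k \<subseteq> limsup N"
    proof
      fix x assume x: "x \<in> Bad k"
      then have "\<exists>\<^sub>F n in sequentially. approximable r z (1 / real (Suc k)) n (F x)"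
        by (simp add: Bad_def)
      moreover have "\<forall>\<^sub>F n in sequentially. approximable r z (1 / real (Suc k)) n (F x) \<longrightarrow> x \<in> N n"
        using x N(2) unfolding Bad_def by (intro eventually_sequentiallyI[of n0]) auto
      ultimately have "\<exists>\<^sub>F n in sequentially. x \<in> N n"
        by (rule frequently_mp[rotated])
      then show "x \<in> limsup N"
        by (simp add: mem_limsup_iff)
    qed
    ultimately show ?thesis by blast
  qed
  then obtain N where N: "\<And>k. N k \<in> null_sets \<mu>" "\<And>k. Bad k \<subseteq> N k"
    by metis
  have "{x \<in> ball c R \<inter> msupp \<mu>. VWA r (F x) z} \<subseteq> (\<Union>k. N k)"
  proof
    fix x assume x: "x \<in> {x \<in> ball c R \<inter> msupp \<mu>. VWA r (F x) z}"
    then obtain k where "\<exists>\<^sub>F n in sequentially. approximable r z (1 / real (Suc k)) n (F x)"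
      using VWA_imp_frequently_approximable[OF r, of "F x" z] by auto
    then have "x \<in> N k"
      using x by (intro subsetD[OF N(2)]) (simp add: Bad_def)
    then show "x \<in> (\<Union>k. N k)" by blast
  qed
  moreover have "(\<Union>k. N k) \<in> null_sets \<mu>"
    using N(1) by (intro null_sets_UN) auto
  ultimately show ?thesis by blast
qed

end


section \<open>From local to global\<close>

lemma sets_radon:
  assumes "radon_measure_on U \<mu>" "A \<in> sets borel" "A \<subseteq> U"
  shows "A \<in> sets \<mu>"
proof -
  have "A = U \<inter> A"
    using assms(3) by blast
  then show ?thesis
    using assms(1,2) by (auto simp: radon_measure_on_def sets_restrict_space)
qed

text \<open>The complement of the support is covered by open null sets, and second countability
  reduces these to countably many.\<close>

lemma msupp_complement:
  fixes \<mu> :: "'a::{metric_space, second_countable_topology} measure"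
  assumes U: "open U" and \<mu>: "radon_measure_on U \<mu>"
  shows "open (U - msupp \<mu>)" and "U - msupp \<mu> \<in> null_sets \<mu>"
proof -
  define \<F> where "\<F> = {W. open W \<and> W \<subseteq> U \<and> emeasure \<mu> W = 0}"
  have space: "space \<mu> = U"
    using \<mu> by (simp add: radon_measure_on_def)
  have Un: "\<Union>\<F> = U - msupp \<mu>"
  proof (intro equalityI subsetI)
    fix x assume "x \<in> \<Union>\<F>"
    then obtain W where "x \<in> W" "open W" "W \<subseteq> U" "emeasure \<mu> W = 0"
      by (auto simp: \<F>_def)
    then show "x \<in> U - msupp \<mu>"
      by (auto simp: msupp_def space Int_absorb2 intro!: exI[of _ W])
  next
    fix x assume x: "x \<in> U - msupp \<mu>"
    then obtain W where "open W" "x \<in> W" "emeasure \<mu> (W \<inter> U) = 0"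
      by (auto simp: msupp_def space)
    then have "W \<inter> U \<in> \<F>" "x \<in> W \<inter> U"
      using U x by (auto simp: \<F>_def)
    then show "x \<in> \<Union>\<F>" by blast
  qed
  show "open (U - msupp \<mu>)"
    unfolding Un[symmetric] by (intro open_Union) (auto simp: \<F>_def)
  obtain \<F>' where \<F>': "\<F>' \<subseteq> \<F>" "countable \<F>'" "\<Union>\<F>' = \<Union>\<F>"
    using Lindelof[of \<F>] by (auto simp: \<F>_def)
  have "(\<Union>W\<in>\<F>'. W) \<in> null_sets \<mu>"
  proof (rule null_sets_UN'[OF \<F>'(2)])
    fix W assume "W \<in> \<F>'"
    then have W: "open W" "W \<subseteq> U" "emeasure \<mu> W = 0"
      using \<F>'(1) by (auto simp: \<F>_def)
    then show "W \<in> null_sets \<mu>"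
      using sets_radon[OF \<mu> borel_open[OF W(1)] W(2)] by (intro null_setsI)
  qed
  then show "U - msupp \<mu> \<in> null_sets \<mu>"
    using \<F>'(3) Un by simp
qed

text \<open>A point of the support with value at least \<sigma> bounds the supremum norm from below.
  The norm may be infinite, in which case the quotient is 0; positivity of \<sigma> excludes an
  infinite quotient.\<close>

lemma C_alpha_good_onD:
  assumes good: "C_alpha_good_on C \<alpha> W \<mu> f" and C: "0 < C" and \<alpha>: "0 < \<alpha>"
    and c: "c \<in> msupp \<mu>" "0 < r" "ball c r \<subseteq> W" and \<epsilon>: "0 < \<epsilon>" and \<sigma>: "0 < \<sigma>"
    and y: "y \<in> ball c r \<inter> msupp \<mu>" "\<sigma> \<le> \<bar>f y\<bar>"
  shows "emeasure \<mu> {x \<in> ball c r. \<bar>f x\<bar> < \<epsilon>} \<le> ennreal (C * (\<epsilon> / \<sigma>) powr \<alpha>) * emeasure \<mu> (ball c r)"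
proof -
  define S where "S = supnorm_on \<mu> (ball c r) f"
  have "ennreal \<sigma> \<le> ennreal \<bar>f y\<bar>"
    using y(2) by (rule ennreal_leI)
  also have "\<dots> \<le> S"
    unfolding S_def supnorm_on_def using y(1) by (rule SUP_upper)
  finally have S: "ennreal \<sigma> \<le> S" .
  have le: "ennreal \<epsilon> / S \<le> ennreal (\<epsilon> / \<sigma>)"
  proof (cases S)
    case (real s)
    then have s: "\<sigma> \<le> s" "0 < s"
      using S \<sigma> by (auto simp: ennreal_le_iff)
    then have "ennreal \<epsilon> / S = ennreal (\<epsilon> / s)"
      using real \<epsilon> by (simp add: divide_ennreal)
    also have "\<dots> \<le> ennreal (\<epsilon> / \<sigma>)"
      using s \<epsilon> \<sigma> by (intro ennreal_leI divide_left_mono) auto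
    finally show ?thesis .
  qed simp
  then have fin: "ennreal \<epsilon> / S \<noteq> \<infinity>"
    using le_less_trans[OF le ennreal_less_top] by simp
  have "enn2real (ennreal \<epsilon> / S) \<le> \<epsilon> / \<sigma>"
    using le \<epsilon> \<sigma> by (intro enn2real_leI) auto
  then have "ennreal_rpow (ennreal \<epsilon> / S) \<alpha> \<le> ennreal ((\<epsilon> / \<sigma>) powr \<alpha>)"
    unfolding ennreal_rpow_def using fin \<alpha> by (auto intro!: ennreal_leI powr_mono2)
  then have "ennreal C * ennreal_rpow (ennreal \<epsilon> / S) \<alpha> * emeasure \<mu> (ball c r)
      \<le> ennreal C * ennreal ((\<epsilon> / \<sigma>) powr \<alpha>) * emeasure \<mu> (ball c r)"
    by (intro mult_right_mono mult_left_mono) auto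
  also have "ennreal C * ennreal ((\<epsilon> / \<sigma>) powr \<alpha>) = ennreal (C * (\<epsilon> / \<sigma>) powr \<alpha>)"
    using C by (simp add: ennreal_mult)
  finally show ?thesis
    using good c \<epsilon> order_trans unfolding C_alpha_good_on_def S_def by blast
qed

text \<open>Shrinking to one ball on which the Federer and goodness constants are uniform yields an
  instance of \<open>local_data\<close>.\<close>

lemma VWA_null_ball:
  fixes \<mu> :: "(real ^ 'd::finite) measure"
    and F :: "real ^ 'd \<Rightarrow> real ^ 'n::{finite,linorder} ^ 'm::{finite,linorder}"
    and r :: "real ^ ('m + 'n)"
  assumes U: "open U" and \<mu>: "radon_measure_on U \<mu>" and F: "continuous_on U F" and np: "weakly_nonplanar F \<mu>"
    and x: "x \<in> msupp \<mu>" and W: "open W" "x \<in> W" "W \<subseteq> U" "D_Federer_on D W \<mu>"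
    and V: "open V" "x \<in> V" "0 < C" "0 < \<alpha>"
    and good: "\<And>a0 a. C_alpha_good_on C \<alpha> V \<mu> (\<lambda>y. a0 + (\<Sum>s\<in>minor_index. a s * minor (F y) s))"
    and r: "\<And>s. 0 \<le> r $ s" and sum_l: "(\<Sum>j\<in>UNIV. r $ Inl j) = 1" and sum_r: "(\<Sum>i\<in>UNIV. r $ Inr i) = 1"
  shows "\<exists>B. open B \<and> x \<in> B \<and> (\<exists>N\<in>null_sets \<mu>. {y \<in> B \<inter> msupp \<mu>. VWA r (F y) z} \<subseteq> N)"
proof -
  have space: "space \<mu> = U"
    using \<mu> by (simp add: radon_measure_on_def)
  have "open (V \<inter> W)" "x \<in> V \<inter> W"
    using V W by auto
  \<comment> \<open>A closed ball, so that compactness gives \<open>\<Omega>\<close> finite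
    measure.\<close>
  then obtain s where s: "0 < s" "cball x s \<subseteq> V \<inter> W"
    using open_contains_cball by blast
  define \<Omega> where "\<Omega> = ball x s"
  have \<Omega>: "\<Omega> \<subseteq> V" "\<Omega> \<subseteq> W" "\<Omega> \<subseteq> U" "open \<Omega>" "\<Omega> \<subseteq> cball x s"
  proof -
    show "\<Omega> \<subseteq> cball x s"
      unfolding \<Omega>_def by (rule ball_subset_cball)
    then show "\<Omega> \<subseteq> V" "\<Omega> \<subseteq> W" "\<Omega> \<subseteq> U"
      using s(2) W(3) by blast+
  qed (simp add: \<Omega>_def)
  have comp: "(U - msupp \<mu>) \<inter> \<Omega> \<in> sets \<mu>"
    using msupp_complement(1)[OF U \<mu>] \<Omega> by (intro sets_radon[OF \<mu>]) auto
  interpret local_data \<mu> \<Omega> "ennreal D" F C \<alpha>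
  proof unfold_locales
    show "A \<in> sets \<mu>" if "A \<in> sets borel" "A \<subseteq> \<Omega>" for A
      using that \<Omega>(3) by (intro sets_radon[OF \<mu>]) auto
    show "emeasure \<mu> (ball y (3 * t)) \<le> ennreal D * emeasure \<mu> (ball y t)"
      if "y \<in> msupp \<mu>" "0 < t" "ball y (3 * t) \<subseteq> \<Omega>" for y t
    proof -
      have "ball y t \<subseteq> W"
        using that \<Omega>(2) subset_ball[of t "3 * t" y] by auto
      then have "emeasure \<mu> (ball y (3 * t) \<inter> space \<mu>) < ennreal D * emeasure \<mu> (ball y t)"
        using W(4) that(1,2) unfolding D_Federer_on_def by blast
      moreover have "ball y (3 * t) \<inter> space \<mu> = ball y (3 * t)"
        using that(3) \<Omega>(3) by (auto simp: space)
      ultimately show ?thesis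
        by (simp add: less_imp_le)
    qed
    show "continuous_on \<Omega> F"
      using F \<Omega>(3) by (rule continuous_on_subset)
    show "emeasure \<mu> \<Omega> < \<infinity>"
    proof -
      have "cball x s \<subseteq> U"
        using s(2) W(3) by auto
      then have "emeasure \<mu> (cball x s) < \<infinity>" "cball x s \<in> sets \<mu>"
        using \<mu>[unfolded radon_measure_on_def] sets_radon[OF \<mu> borel_closed[OF closed_cball]]
        by (blast intro: compact_cball)+
      then show ?thesis
        using emeasure_mono[OF \<Omega>(5)] le_less_trans by blast
    qed
    have "msupp \<mu> \<inter> \<Omega> = \<Omega> - (U - msupp \<mu>) \<inter> \<Omega>"
      using \<Omega>(3) by auto
    then show "msupp \<mu> \<inter> \<Omega> \<in> sets \<mu>"
      using comp \<Omega> sets_radon[OF \<mu>, of \<Omega>] by auto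
    have "emeasure \<mu> (\<Omega> - msupp \<mu>) \<le> emeasure \<mu> (U - msupp \<mu>)"
      using msupp_complement(2)[OF U \<mu>] \<Omega>(3) by (intro emeasure_mono) auto
    then show "emeasure \<mu> (\<Omega> - msupp \<mu>) = 0"
      using msupp_complement(2)[OF U \<mu>] by auto
    show "emeasure \<mu> {x \<in> ball c t. \<bar>g (F x)\<bar> < \<epsilon>} \<le> ennreal (C * (\<epsilon> / \<sigma>) powr \<alpha>) * emeasure \<mu> (ball c t)"
      if "g \<in> minor_span" "c \<in> msupp \<mu>" "0 < t" "ball c t \<subseteq> \<Omega>" "0 < \<epsilon>" "0 < \<sigma>"
        "y \<in> ball c t \<inter> msupp \<mu>" "\<sigma> \<le> \<bar>g (F y)\<bar>" for g c t \<epsilon> \<sigma> y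
    proof -
      from that(1) obtain a0 a where g: "\<And>Y. g Y = a0 + (\<Sum>s\<in>minor_index. a s * minor Y s)"
        by (auto simp: minor_span_def)
      have "C_alpha_good_on C \<alpha> V \<mu> (\<lambda>y. g (F y))"
        unfolding g by (rule good)
      moreover have "ball c t \<subseteq> V"
        using that(4) \<Omega>(1) by blast
      ultimately show ?thesis
        using V(3,4) that(2,3,5-8) by (intro C_alpha_good_onD[where W = V])
    qed
    show "\<exists>x\<in>ball c t \<inter> msupp \<mu>. det (A ** F x + B) \<noteq> 0"
      if "c \<in> msupp \<mu>" "0 < t" "ball c t \<subseteq> \<Omega>" "rank (augmented A B) = CARD('n)" for c t A B
    proof -
      have "det_hypersurface A B \<in> det_hypersurfaces"
        using that(4) by (auto simp: det_hypersurfaces_def)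
      moreover have "ball c t \<subseteq> space \<mu>"
        using that(3) \<Omega>(3) by (auto simp: space)
      ultimately have "\<not> F ` (ball c t \<inter> msupp \<mu>) \<subseteq> det_hypersurface A B"
        using np that(1,2) unfolding weakly_nonplanar_def by blast
      then show ?thesis
        by (auto simp: det_hypersurface_def)
    qed
  qed (use \<Omega> V in auto)
  \<comment> \<open>Chosen so that the enlarged ball required by \<open>VWA_null_near\<close> is
    exactly \<open>\<Omega>\<close>.\<close>
  define R where "R = s / (3 * 5 ^ (CARD('m) + CARD('n)))"
  have R: "0 < R" "5 ^ (CARD('m) + CARD('n)) * (3 * R) = s"
    using s(1) by (auto simp: R_def field_simps)
  have "\<exists>N\<in>null_sets \<mu>. {y \<in> ball x R \<inter> msupp \<mu>. VWA r (F y) z} \<subseteq> N"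
    using r sum_l sum_r x R(1) by (rule VWA_null_near) (simp add: R(2) \<Omega>_def)
  then show ?thesis
    using R(1) by (intro exI[of _ "ball x R"]) auto
qed

theorem theorem6p5:
  fixes U :: "(real ^ 'd::finite) set"
    and \<mu> :: "(real ^ 'd) measure"
    and F :: "real ^ 'd \<Rightarrow> real ^ 'n::{finite,linorder} ^ 'm::{finite,linorder}"
  assumes "open U"
    and "radon_measure_on U \<mu>"
    and "federer \<mu>"
    and "continuous_on U F"
    and "good_map F \<mu>"
    and "weakly_nonplanar F \<mu>"
  shows "\<forall>r :: real ^ ('m + 'n).
    (\<forall>k. r $ k \<ge> 0) \<and> (\<Sum>j\<in>UNIV. r $ Inl j) = 1 \<and> (\<Sum>i\<in>UNIV. r $ Inr i) = 1
    \<longrightarrow> inhom_extremal r (distr \<mu> borel F)"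
  unfolding inhom_extremal_def
proof (intro allI impI)
  fix r :: "real ^ ('m + 'n)" and z :: "real ^ 'm::{finite,linorder}"
  assume "(\<forall>k. r $ k \<ge> 0) \<and> (\<Sum>j\<in>UNIV. r $ Inl j) = 1 \<and> (\<Sum>i\<in>UNIV. r $ Inr i) = 1"
  then have r: "\<And>s. 0 \<le> r $ s" "(\<Sum>j\<in>UNIV. r $ Inl j) = 1" "(\<Sum>i\<in>UNIV. r $ Inr i) = 1"
    by auto
  have space: "space \<mu> = U" and sets: "sets \<mu> = sets (restrict_space borel U)"
    using assms(2) by (auto simp: radon_measure_on_def)
  define P where "P x B \<longleftrightarrow> open B \<and> x \<in> B \<and> (\<exists>N\<in>null_sets \<mu>. {y \<in> B \<inter> msupp \<mu>. VWA r (F y) z} \<subseteq> N)" for x B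
  have "AE x in \<mu>. x \<notin> U - msupp \<mu>"
    using msupp_complement(2)[OF assms(1,2)] by (rule AE_not_in)
  then have AE_P: "AE x in \<mu>. x \<in> msupp \<mu> \<and> (\<exists>B. P x B)"
    using assms(3)[unfolded federer_def] assms(5)[unfolded good_map_def good_family_def]
  proof eventually_elim
    case (elim x)
    from elim(2)[unfolded space] obtain W D
      where W: "open W" "x \<in> W" "W \<subseteq> U" "D_Federer_on D W \<mu>"
      by (elim exE conjE) (rule that; assumption)
    from elim(3) obtain V C \<alpha> where V: "open V" "x \<in> V" "0 < C" "0 < \<alpha>"
      and good: "\<And>a0 a. C_alpha_good_on C \<alpha> V \<mu> (\<lambda>y. a0 + (\<Sum>s\<in>minor_index. a s * minor (F y) s))"
      by (elim exE conjE) (rule that; (assumption | elim allE; assumption))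
    have x: "x \<in> msupp \<mu>"
      using elim(1) W(2,3) by blast
    have "\<exists>B. P x B"
      unfolding P_def using VWA_null_ball[OF assms(1,2,4,6) x W V good r] .
    with x show ?case by blast
  qed
  \<comment> \<open>By Lindelof countably many of these open sets cover the union of all, so the
    local null sets combine to one; the points outside that union are negligible by
    \<open>AE_P\<close>.\<close>
  define \<F> where "\<F> = {B. \<exists>x. P x B}"
  obtain \<F>' where \<F>': "\<F>' \<subseteq> \<F>" "countable \<F>'" "\<Union>\<F>' = \<Union>\<F>"
    using Lindelof[of \<F>] by (auto simp: \<F>_def P_def)
  have "\<forall>B\<in>\<F>'. \<exists>N. N \<in> null_sets \<mu> \<and> {y \<in> B \<inter> msupp \<mu>. VWA r (F y) z} \<subseteq> N"
    using \<F>'(1) by (auto simp: \<F>_def P_def)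
  from bchoice[OF this]
  obtain N where N: "\<forall>B\<in>\<F>'. N B \<in> null_sets \<mu> \<and> {y \<in> B \<inter> msupp \<mu>. VWA r (F y) z} \<subseteq> N B" ..
  have "(\<Union>B\<in>\<F>'. N B) \<in> null_sets \<mu>"
    using \<F>'(2) N by (intro null_sets_UN') auto
  then have "AE x in \<mu>. x \<notin> (\<Union>B\<in>\<F>'. N B)"
    by (rule AE_not_in)
  then have "AE x in \<mu>. \<not> VWA r (F x) z"
    using AE_P
  proof eventually_elim
    case (elim x)
    then obtain B where "P x B" and x: "x \<in> msupp \<mu>" by blast
    then have "x \<in> \<Union>\<F>"
      by (auto simp: \<F>_def P_def)
    then obtain B' where "B' \<in> \<F>'" "x \<in> B'"
      using \<F>'(3) by blast
    then show ?case
      using N x elim(1) by blast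
  qed
  moreover have "F \<in> measurable \<mu> borel"
    using borel_measurable_continuous_on_restrict[OF assms(4)] by (simp add: measurable_cong_sets[OF sets refl])
  moreover have "{Y \<in> space borel. \<not> VWA r Y z} \<in> sets borel"
  proof -
    have "{Y \<in> space borel. \<not> VWA r Y z} = space borel - {Y. VWA r Y z}"
      by auto
    then show ?thesis
      using sets.compl_sets[OF sets_VWA[OF r(1), of z]] by simp
  qed
  ultimately show "AE Y in distr \<mu> borel F. \<not> VWA r Y z"
    by (simp add: AE_distr_iff)
qed

end
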